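(* Consider the polytope $P$ of points $\mathbf{x}\in\mathbb{R}^n$ given by the inequalities $A\mathbf{x}\le\mathbf{b}$, where $A$ is an $m\times n$ integer matrix and $\mathbf{b}\in\mathbb{Z}^m$. For fixed $n$, the function $$(A,\mathbf{b})\ \mapsto\ \#\{\mathbf{x}\in\mathbb{Z}^n\cap P\}$$ is in $\#\mathsf{L}$, where the entries $A_{i,j}$ and $b_i$ are encoded in unary, with one extra bit to indicate their sign.
   Context: A polytope is bounded. The number $m$ of inequalities is not fixed. The input is the list of entries of $A$ and $\mathbf{b}$; each entry is written as a sign bit, followed by its absolute value in unary (a string of ones), followed by a delimiter $0$, so the input size is $\sum_{i,j}|A_{i,j}|+\sum_i|b_i|+2nm+2m$. The alphabet is $\Sigma=\{0,1\}$. A function given only on strings of a specified form is extended by $0$ to all other strings. $\#\mathsf{L}$ is the class of functions $f:\Sigma^*\to\mathbb{N}_0$ such that $f(x)$ is the number of accepting computation paths on input $x$ of a fixed nondeterministic Turing machine with read-only input tape that uses $O(\log|x|)$ work space and halts on every computation path. Equivalently: there are a polynomial $q$ and a deterministic $O(\log|x|)$-space Turing machine $M$ with an additional read-once, left-to-right witness tape such that $f(x)=\#\{w\in\Sigma^{q(|x|)}\mid M(x,w)=\mathsf{yes}\}$. *)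

theory Defs
  imports Complex_Main "Jordan_Normal_Form.Matrix"
begin

section \<open>Nondeterministic Turing machines with a read-only input tape\<close>

text \<open>
  The input tape holds the input between two end markers: cell \<open>0\<close> is the left marker, cells
  \<open>1, \<dots>, |x|\<close> hold the bits of the input \<open>x\<close>, and cell \<open>|x| + 1\<close> is the right marker.
\<close>

datatype input_symbol = Left_End | Right_End | Bit bool

datatype direction = Move_Left | Stay | Move_Right

fun shift :: "direction \<Rightarrow> int" where
  "shift Move_Left = -1"
| "shift Stay = 0"
| "shift Move_Right = 1"

text \<open>
  A machine has a fixed number of two-way infinite work tapes.  An element
  \<open>(q, a, ss, q', d, acts)\<close> of \<open>transitions\<close> says: in state \<open>q\<close>, reading \<open>a\<close> on the input tape and
  \<open>ss ! j\<close> on the \<open>j\<close>-th work tape, the machine may change to state \<open>q'\<close>, move the input head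
  by \<open>d\<close>, and, if \<open>acts ! j = (s, e)\<close>, write \<open>s\<close> on the \<open>j\<close>-th work tape and move its head by \<open>e\<close>.
\<close>

record ('q, 's) ntm =
  work_tapes :: nat
  start_state :: 'q
  accepting :: "'q set"
  blank :: 's
  transitions ::
    "('q \<times> input_symbol \<times> 's list \<times> 'q \<times> direction \<times> ('s \<times> direction) list) set"

text \<open>
  Finiteness of the transition relation bounds the sets of states and of work symbols that can
  play a role, so these two sets are not separate components of a machine.
\<close>

definition valid_ntm :: "('q, 's) ntm \<Rightarrow> bool" where
  "valid_ntm M \<longleftrightarrow> finite (transitions M) \<and>
     (\<forall>(q, a, ss, q', d, acts) \<in> transitions M.
        length ss = work_tapes M \<and> length acts = work_tapes M)"

text \<open>
  A configuration consists of the state, the position of the input head, and the content and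
  head position of every work tape.
\<close>

type_synonym ('q, 's) config = "'q \<times> int \<times> ((int \<Rightarrow> 's) \<times> int) list"

definition initial_config :: "('q, 's) ntm \<Rightarrow> ('q, 's) config" where
  "initial_config M = (start_state M, 0, replicate (work_tapes M) (\<lambda>_. blank M, 0))"

definition input_read :: "bool list \<Rightarrow> int \<Rightarrow> input_symbol" where
  "input_read x p =
     (if p \<le> 0 then Left_End
      else if p > int (length x) then Right_End
      else Bit (x ! nat (p - 1)))"

text \<open>
  A transition that would move the input head beyond an end marker is not applicable.
  Consequently, different transitions applicable to a configuration lead to different
  successors, and computation paths may be identified with sequences of configurations.
\<close>

inductive step :: "('q, 's) ntm \<Rightarrow> bool list \<Rightarrow> ('q, 's) config \<Rightarrow> ('q, 's) config \<Rightarrow> bool"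
  for M x where
  "\<lbrakk>(q, input_read x p, map (\<lambda>(t, h). t h) ws, q', d, acts) \<in> transitions M;
    0 \<le> p + shift d; p + shift d \<le> int (length x) + 1\<rbrakk> \<Longrightarrow>
   step M x (q, p, ws)
     (q', p + shift d, map2 (\<lambda>(t, h) (s, e). (t(h := s), h + shift e)) ws acts)"

definition accepting_paths :: "('q, 's) ntm \<Rightarrow> bool list \<Rightarrow> ('q, 's) config list set" where
  "accepting_paths M x =
     {cs. cs \<noteq> [] \<and> hd cs = initial_config M \<and> successively (step M x) cs \<and>
          (\<nexists>c. step M x (last cs) c) \<and> fst (last cs) \<in> accepting M}"

definition halts_on_every_path :: "('q, 's) ntm \<Rightarrow> bool list \<Rightarrow> bool" where
  "halts_on_every_path M x \<longleftrightarrow>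
     (\<nexists>cs :: nat \<Rightarrow> ('q, 's) config. cs 0 = initial_config M \<and> (\<forall>i. step M x (cs i) (cs (Suc i))))"

text \<open>
  On each of the fixed number of work tapes, the visited cells form an interval around \<open>0\<close>, so a
  bound on the head positions is, up to a constant factor, a bound on the number of visited
  cells.  The summand \<open>2\<close> only serves to make the logarithm positive for inputs of length
  \<open>0\<close> and \<open>1\<close>.
\<close>

definition log_space :: "('q, 's) ntm \<Rightarrow> bool" where
  "log_space M \<longleftrightarrow>
     (\<exists>C::real. \<forall>x q p ws. (step M x)\<^sup>*\<^sup>* (initial_config M) (q, p, ws) \<longrightarrow>
        (\<forall>(t, h) \<in> set ws. \<bar>real_of_int h\<bar> \<le> C * log 2 (real (length x) + 2)))"

text \<open>
  Using natural numbers for states and work symbols is no restriction, because only finitely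
  many of them are relevant.
\<close>

definition sharp_L :: "(bool list \<Rightarrow> nat) set" where
  "sharp_L = {f. \<exists>M :: (nat, nat) ntm. valid_ntm M \<and> log_space M \<and>
     (\<forall>x. halts_on_every_path M x \<and> f x = card (accepting_paths M x))}"


section \<open>Functions given only on encodings\<close>

text \<open>Meaningful if \<open>enc\<close> is injective on \<open>D\<close>.\<close>

definition extend_by_zero ::
  "'a set \<Rightarrow> ('a \<Rightarrow> bool list) \<Rightarrow> ('a \<Rightarrow> nat) \<Rightarrow> bool list \<Rightarrow> nat" where
  "extend_by_zero D enc f s = (if s \<in> enc ` D then f (inv_into D enc s) else 0)"


section \<open>Polytopes given by integer inequalities\<close>

definition polyhedron :: "int mat \<Rightarrow> int vec \<Rightarrow> real vec set" where
  "polyhedron A b =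
     {x \<in> carrier_vec (dim_col A). map_mat real_of_int A *\<^sub>v x \<le> map_vec real_of_int b}"

definition bounded_vecs :: "real vec set \<Rightarrow> bool" where
  "bounded_vecs P \<longleftrightarrow> (\<exists>B. \<forall>x \<in> P. \<forall>i < dim_vec x. \<bar>x $ i\<bar> \<le> B)"

definition polytope_inputs :: "nat \<Rightarrow> (int mat \<times> int vec) set" where
  "polytope_inputs n =
     {(A, b). \<exists>m. A \<in> carrier_mat m n \<and> b \<in> carrier_vec m \<and> bounded_vecs (polyhedron A b)}"

definition integer_points :: "real vec set \<Rightarrow> real vec set" where
  "integer_points P = {x \<in> P. \<forall>i < dim_vec x. x $ i \<in> \<int>}"

text \<open>The sign bit is set for negative numbers only; in particular, \<open>0\<close> has a unique encoding.\<close>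

definition encode_int :: "int \<Rightarrow> bool list" where
  "encode_int z = (z < 0) # replicate (nat \<bar>z\<bar>) True @ [False]"

text \<open>The entries of \<open>A\<close>, row by row, followed by the entries of \<open>b\<close>.\<close>

definition encode_input :: "int mat \<times> int vec \<Rightarrow> bool list" where
  "encode_input = (\<lambda>(A, b). concat (map encode_int (concat (mat_to_list A) @ list_of_vec b)))"

lemma length_encode_input:
  assumes "A \<in> carrier_mat m n" "b \<in> carrier_vec m"
  shows "int (length (encode_input (A, b))) =
    (\<Sum>i<m. \<Sum>j<n. \<bar>A $$ (i, j)\<bar>) + (\<Sum>i<m. \<bar>b $ i\<bar>) + 2 * int n * int m + 2 * int m"
proof -
  have [simp]: "int (length (encode_int z)) = \<bar>z\<bar> + 2" for z
    by (simp add: encode_int_def)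
  have len: "int (length (concat (map encode_int zs))) = (\<Sum>z\<leftarrow>zs. \<bar>z\<bar> + 2)" for zs
    by (induction zs) auto
  have cc: "(\<Sum>z\<leftarrow>concat zss. \<bar>z\<bar> + 2) = (\<Sum>zs\<leftarrow>zss. \<Sum>z\<leftarrow>zs. \<bar>z\<bar> + (2::int))" for zss
    by (induction zss) auto
  have lb: "list_of_vec b = map (\<lambda>i. b $ i) [0..<m]"
    using assms(2) by (intro nth_equalityI) auto
  have lA: "mat_to_list A = map (\<lambda>i. map (\<lambda>j. A $$ (i, j)) [0..<n]) [0..<m]"
    using assms(1) by (auto simp: mat_to_list_def)
  have up: "(\<Sum>i\<leftarrow>[0..<k]. g i) = (\<Sum>i<k. g i)" for g :: "nat \<Rightarrow> int" and k
    by (simp add: interv_sum_list_conv_sum_set_nat atLeast0LessThan)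
  have "int (length (encode_input (A, b))) =
      (\<Sum>z\<leftarrow>concat (mat_to_list A). \<bar>z\<bar> + 2) + (\<Sum>z\<leftarrow>list_of_vec b. \<bar>z\<bar> + 2)"
    by (simp only: encode_input_def prod.case len) simp
  also have "\<dots> = (\<Sum>i<m. \<Sum>j<n. \<bar>A $$ (i, j)\<bar> + 2) + (\<Sum>i<m. \<bar>b $ i\<bar> + 2)"
    by (simp only: cc lb lA map_map o_def up)
  finally show ?thesis
    by (simp add: sum.distrib)
qed

lemma encode_int_append_inject:
  "encode_int y @ u = encode_int z @ v \<longleftrightarrow> y = z \<and> u = v"
proof -
  have *: "replicate k True @ False # u = replicate l True @ False # v \<longleftrightarrow> k = l \<and> u = v" for k l
  proof (induction k arbitrary: l)
    case 0
    then show ?case by (cases l) auto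
  next
    case (Suc k)
    then show ?case by (cases l) auto
  qed
  show ?thesis
    by (auto simp: encode_int_def *)
qed

lemma concat_encode_int_inject:
  "concat (map encode_int ys) = concat (map encode_int zs) \<longleftrightarrow> ys = zs"
proof (induction ys arbitrary: zs)
  case Nil
  then show ?case by (cases zs) (auto simp: encode_int_def)
next
  case (Cons y ys)
  then show ?case
    by (cases zs) (auto simp: encode_int_append_inject, auto simp: encode_int_def)
qed

lemma inj_on_encode_input: "inj_on encode_input (polytope_inputs n)"
proof (rule inj_onI, clarsimp simp: polytope_inputs_def)
  fix A b A' b' m m'
  assume A: "A \<in> carrier_mat m n" and b: "b \<in> carrier_vec m"
    and A': "A' \<in> carrier_mat m' n" and b': "b' \<in> carrier_vec m'"
    and "encode_input (A, b) = encode_input (A', b')"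
  then have eq: "concat (mat_to_list A) @ list_of_vec b = concat (mat_to_list A') @ list_of_vec b'"
    by (simp only: encode_input_def prod.case concat_encode_int_inject)
  have lc: "length (concat (mat_to_list D)) = k * n" if "D \<in> carrier_mat k n" for D :: "int mat" and k
    using that by (simp add: mat_to_list_def length_concat o_def sum_list_triv)
  have "m * n + m = m' * n + m'"
    using arg_cong[OF eq, of length] A A' b b' by (simp add: lc)
  then have "m * Suc n = m' * Suc n" by simp
  then have m: "m' = m" by (simp only: mult_cancel2) simp
  then have cA: "concat (mat_to_list A) = concat (mat_to_list A')"
    and lb: "list_of_vec b = list_of_vec b'"
    using eq lc[OF A] lc[OF A'] by auto
  have "b = b'"
    using lb b b' m by (metis vec_list)
  moreover have "mat_to_list A = mat_to_list A'"
  proof (rule concat_injective[OF cA])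
    show "length (mat_to_list A) = length (mat_to_list A')"
      using A A' m by (simp add: mat_to_list_def)
    show "\<forall>(x, y) \<in> set (zip (mat_to_list A) (mat_to_list A')). length x = length y"
      using A A' m by (auto simp: mat_to_list_def set_zip)
  qed
  then have "A = A'"
    using A A' m by (intro eq_matI) (auto simp: mat_to_list_def)
  ultimately show "A = A' \<and> b = b'" by simp
qed

end

(*
  Let L be the input length and K = (2 (n + 1) (L + 1)) ^ (n + 1).  By simultaneous Diophantine
  approximation, a real point of the polyhedron A x <= b with a coordinate larger than K in absolute
  value yields a nonzero integer vector y with A y <= 0 and entries at most K.  Hence, if the box
  [-K, K]^n contains no such y, then the polyhedron lies in the box; and if it contains such a y, then
  the polyhedron is empty or unbounded, and the value is 0 in either case.  For fixed n the number K is
  polynomial in L, so a machine can first search the box for y deterministically, then guess an integer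
  point of the box and accept iff it satisfies A x <= b.

  The machine is obtained from a program over polynomially bounded counters, each of which
  is kept in binary on a work tape of its own.
*)

theory Submission
  imports "HOL-Analysis.Kronecker_Approximation_Theorem" Defs
begin

text \<open>Counting lattice points of the box is not enough: an unbounded polyhedron may have some,
  yet its input must get the value 0. Guessing a certificate of unboundedness would not help,
  because guesses add accepting paths and never remove them; hence the search comes before all
  branching. Since \<open>y = 0\<close> always satisfies \<open>A y <= 0\<close>, counting the
  solutions and comparing with 1 suffices. That a nonzero solution is fatal for a nonempty
  polyhedron is seen on the ray from any of its points in direction \<open>y\<close>.

  The unary code bounds every entry by L, and a product with an entry is a repeated addition while
  the head crosses its ones. Negative numbers are avoided by shifting the coordinates by K and by
  collecting both sides of an inequality in two nonnegative counters.

  On the machine side, path count, termination and head bound are put into a single inductive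
  predicate, so that one induction over the run of a program yields everything that
  \<open>sharp_L\<close> asks for.\<close>

section \<open>Counting accepting paths by induction\<close>

text \<open>One derivation certifies at once that \<open>N\<close> paths from \<open>c\<close>
  accept, that no path from \<open>c\<close> is infinite, and that the heads stay within
  \<open>H\<close> on everything reachable. The sum ranges over successor configurations rather than
  transitions, because paths are sequences of configurations.\<close>

inductive path_count :: "('q, 's) ntm \<Rightarrow> bool list \<Rightarrow> int \<Rightarrow> ('q, 's) config \<Rightarrow> nat \<Rightarrow> bool"
  for M x H where
  halt: "\<lbrakk>\<forall>(t, h) \<in> set (snd (snd c)). \<bar>h\<bar> \<le> H; \<And>d. \<not> step M x c d\<rbrakk>
    \<Longrightarrow> path_count M x H c (if fst c \<in> accepting M then 1 else 0)"
| succ: "\<lbrakk>\<forall>(t, h) \<in> set (snd (snd c)). \<bar>h\<bar> \<le> H; D = {d. step M x c d}; finite D; D \<noteq> {};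
     \<And>d. d \<in> D \<Longrightarrow> path_count M x H d (g d)\<rbrakk>
    \<Longrightarrow> path_count M x H c (\<Sum>d\<in>D. g d)"

definition accepting_paths_from ::
  "('q, 's) ntm \<Rightarrow> bool list \<Rightarrow> ('q, 's) config \<Rightarrow> ('q, 's) config list set" where
  "accepting_paths_from M x c =
     {cs. cs \<noteq> [] \<and> hd cs = c \<and> successively (step M x) cs \<and>
          (\<nexists>d. step M x (last cs) d) \<and> fst (last cs) \<in> accepting M}"

lemma accepting_paths_from_halt:
  assumes "\<And>d. \<not> step M x c d"
  shows "accepting_paths_from M x c = (if fst c \<in> accepting M then {[c]} else {})"
proof -
  have "cs = [c]" if "cs \<in> accepting_paths_from M x c" for cs
  proof (cases cs rule: remdups_adj.cases)
    case (3 a b ds)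
    then have "step M x c b" using that
      by (auto simp: accepting_paths_from_def simp del: split_paired_Ex split_paired_All)
    then show ?thesis using assms by blast
  qed (use that in \<open>auto simp: accepting_paths_from_def\<close>)
  moreover have "[c] \<in> accepting_paths_from M x c \<longleftrightarrow> fst c \<in> accepting M"
    using assms by (auto simp: accepting_paths_from_def simp del: split_paired_Ex split_paired_All)
  ultimately show ?thesis by auto
qed

text \<open>An accepting path must end in a halting configuration, so \<open>[c]\<close> itself is
  not one and every path has a second element.\<close>

lemma accepting_paths_from_step:
  assumes "step M x c e"
  shows "accepting_paths_from M x c =
    (\<Union>d\<in>{d. step M x c d}. (#) c ` accepting_paths_from M x d)"
proof (intro equalityI subsetI)
  fix cs assume cs: "cs \<in> accepting_paths_from M x c"
  show "cs \<in> (\<Union>d\<in>{d. step M x c d}. (#) c ` accepting_paths_from M x d)"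
  proof (cases cs rule: remdups_adj.cases)
    case (3 a b ds)
    then have "step M x c b" "b # ds \<in> accepting_paths_from M x b" "a = c"
      using cs
      by (auto simp: accepting_paths_from_def simp del: split_paired_Ex split_paired_All)
    then show ?thesis using 3 by blast
  next
    case (2 a)
    then have "\<not> step M x c e"
      using cs by (auto simp: accepting_paths_from_def simp del: split_paired_Ex split_paired_All)
    then show ?thesis using assms by contradiction
  qed (use cs in \<open>simp add: accepting_paths_from_def\<close>)
next
  fix cs assume "cs \<in> (\<Union>d\<in>{d. step M x c d}. (#) c ` accepting_paths_from M x d)"
  then show "cs \<in> accepting_paths_from M x c"
    by (auto simp: accepting_paths_from_def successively_Cons simp del: split_paired_Ex split_paired_All)
qed

text \<open>Paths through different successors differ in their second configuration, so the union is
  disjoint and the cardinalities add up.\<close>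

lemma path_count_card:
  "path_count M x H c N \<Longrightarrow>
    finite (accepting_paths_from M x c) \<and> card (accepting_paths_from M x c) = N"
proof (induction rule: path_count.induct)
  case (halt c)
  then show ?case by (simp add: accepting_paths_from_halt)
next
  case (succ c D g)
  then obtain e where e: "step M x c e" by auto
  let ?P = "\<lambda>d. (#) c ` accepting_paths_from M x d"
  have eq: "accepting_paths_from M x c = (\<Union>d\<in>D. ?P d)"
    using accepting_paths_from_step[OF e] succ.hyps(2) by simp
  have fin: "finite (?P d)" "card (?P d) = g d" if "d \<in> D" for d
    using succ.IH[OF that] by (auto simp: card_image)
  have "card (\<Union>d\<in>D. ?P d) = (\<Sum>d\<in>D. card (?P d))"
  proof (rule card_UN_disjoint)
    show "\<forall>d\<in>D. \<forall>d'\<in>D. d \<noteq> d' \<longrightarrow> ?P d \<inter> ?P d' = {}"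
      by (auto simp: accepting_paths_from_def)
  qed (use fin succ.hyps in auto)
  then show ?case using eq fin succ.hyps by simp
qed

text \<open>The tail of an infinite path is an infinite path from a successor, to which the
  induction hypothesis applies.\<close>

lemma path_count_halts:
  "path_count M x H c N \<Longrightarrow> \<not> (cs 0 = c \<and> (\<forall>i. step M x (cs i) (cs (Suc i))))"
proof (induction arbitrary: cs rule: path_count.induct)
  case (halt c)
  show ?case using halt.hyps(2)[of "cs (Suc 0)"] by auto
next
  case (succ c D g)
  show ?case
  proof
    assume *: "cs 0 = c \<and> (\<forall>i. step M x (cs i) (cs (Suc i)))"
    then have "cs (Suc 0) \<in> D" using succ.hyps(2) by auto
    from succ.IH[OF this, of "\<lambda>i. cs (Suc i)"] * show False by auto
  qed
qed

text \<open>Derivability passes to every successor, and both rules carry the head bound.\<close>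

lemma path_count_space:
  assumes "(step M x)\<^sup>*\<^sup>* c d" "path_count M x H c N"
  shows "\<forall>(t, h) \<in> set (snd (snd d)). \<bar>h\<bar> \<le> H"
proof -
  have succ: "\<exists>N'. path_count M x H e' N'" if "path_count M x H e N" "step M x e e'" for e e' N
    using that by cases blast+
  from assms(1) have "\<exists>N'. path_count M x H d N'"
  proof (induction rule: rtranclp_induct)
    case base
    show ?case using assms(2) by blast
  next
    case (step e e')
    then show ?case using succ by blast
  qed
  then obtain N' where "path_count M x H d N'" ..
  then show ?thesis by cases blast+
qed

lemma sharp_L_if_path_count:
  fixes M :: "(nat, nat) ntm"
  assumes "valid_ntm M"
    and count: "\<And>x. path_count M x (H x) (initial_config M) (f x)"
    and space: "\<And>x. real_of_int (H x) \<le> C * log 2 (real (length x) + 2)"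
  shows "f \<in> sharp_L"
proof -
  have "log_space M"
    unfolding log_space_def
  proof (intro exI allI impI)
    fix x q p ws
    assume "(step M x)\<^sup>*\<^sup>* (initial_config M) (q, p, ws)"
    from path_count_space[OF this count]
    have *: "\<forall>(t, h)\<in>set ws. \<bar>h\<bar> \<le> H x" by simp
    show "\<forall>(t, h)\<in>set ws. \<bar>real_of_int h\<bar> \<le> C * log 2 (real (length x) + 2)"
    proof (clarify)
      fix t h assume "(t, h) \<in> set ws"
      with * have "\<bar>h\<bar> \<le> H x" by auto
      then show "\<bar>real_of_int h\<bar> \<le> C * log 2 (real (length x) + 2)"
        using space[of x] by linarith
    qed
  qed
  moreover have "halts_on_every_path M x" for x
    unfolding halts_on_every_path_def
  proof
    assume "\<exists>cs. cs 0 = initial_config M \<and> (\<forall>i. step M x (cs i) (cs (Suc i)))"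
    then obtain cs where "cs 0 = initial_config M \<and> (\<forall>i. step M x (cs i) (cs (Suc i)))" ..
    with path_count_halts[OF count[of x], of cs] show False by simp
  qed
  moreover have "f x = card (accepting_paths M x)" for x
  proof -
    have "accepting_paths M x = accepting_paths_from M x (initial_config M)"
      by (simp add: accepting_paths_def accepting_paths_from_def)
    then show ?thesis using path_count_card[OF count[of x]] by simp
  qed
  ultimately show ?thesis using assms(1) by (auto simp: sharp_L_def)
qed

section \<open>Counter programs\<close>

datatype test = At input_symbol | Not_At input_symbol | Non_Zero nat

datatype com =
    Skip
  | Reject
  | Fwd
  | Rewind
  | Inc nat
  | Dec nat
  | Seq com com (infixr ";;" 60)
  | If test com com
  | While test com
  | Choice com com

fun holds :: "test \<Rightarrow> input_symbol \<Rightarrow> (nat \<Rightarrow> nat) \<Rightarrow> bool" where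
  "holds (At b) a s \<longleftrightarrow> a = b"
| "holds (Not_At b) a s \<longleftrightarrow> a \<noteq> b"
| "holds (Non_Zero r) a s \<longleftrightarrow> s r \<noteq> 0"

text \<open>
  In \<open>runs x V k p s N\<close> the number \<open>V\<close> caps all counters and \<open>N\<close> counts the accepting paths; the
  rules have no case for an infinite path.
\<close>

inductive runs :: "bool list \<Rightarrow> nat \<Rightarrow> com list \<Rightarrow> nat \<Rightarrow> (nat \<Rightarrow> nat) \<Rightarrow> nat \<Rightarrow> bool"
  for x V where
  Nil: "runs x V [] p s 1"
| Skip: "runs x V k p s N \<Longrightarrow> runs x V (Skip # k) p s N"
| Reject: "runs x V (Reject # k) p s 0"
| Fwd: "p \<le> length x \<Longrightarrow> runs x V k (Suc p) s N \<Longrightarrow> runs x V (Fwd # k) p s N"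
| Rewind: "runs x V k 0 s N \<Longrightarrow> runs x V (Rewind # k) p s N"
| Inc: "s r < V \<Longrightarrow> runs x V k p (s(r := Suc (s r))) N \<Longrightarrow> runs x V (Inc r # k) p s N"
| Dec: "s r \<noteq> 0 \<Longrightarrow> runs x V k p (s(r := s r - 1)) N \<Longrightarrow> runs x V (Dec r # k) p s N"
| Seq: "runs x V (c # d # k) p s N \<Longrightarrow> runs x V ((c ;; d) # k) p s N"
| If: "runs x V ((if holds t (input_read x (int p)) s then c else d) # k) p s N \<Longrightarrow>
    runs x V (If t c d # k) p s N"
| While: "runs x V (if holds t (input_read x (int p)) s then c # While t c # k else k) p s N \<Longrightarrow>
    runs x V (While t c # k) p s N"
| Choice: "c \<noteq> d \<Longrightarrow> runs x V (c # k) p s N \<Longrightarrow> runs x V (d # k) p s N' \<Longrightarrow>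
    runs x V (Choice c d # k) p s (N + N')"

section \<open>Counters in bijective binary notation\<close>

text \<open>
  Least significant digit first, with digits \<open>1\<close> and \<open>2\<close>.  The representation of a number is
  unique, and a counter is zero iff its tape is blank at the origin; so a zero test takes one step.
\<close>

fun inc_digits :: "nat list \<Rightarrow> nat list" where
  "inc_digits [] = [1]"
| "inc_digits (d # ds) = (if d = 2 then 1 # inc_digits ds else Suc d # ds)"

text \<open>A borrow that reaches a leading 1 removes it, as there is no digit 0. The value at
  \<open>[]\<close> agrees with \<open>0 - 1 = 0\<close>, so that \<open>digits_minus_1\<close>
  holds for every \<open>n\<close>.\<close>

fun dec_digits :: "nat list \<Rightarrow> nat list" where
  "dec_digits [] = []"
| "dec_digits (d # ds) =
    (if d = 1 then (if ds = [] then [] else 2 # dec_digits ds) else 1 # ds)"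

primrec digits :: "nat \<Rightarrow> nat list" where
  "digits 0 = []"
| "digits (Suc n) = inc_digits (digits n)"

lemma set_inc_digits: "set ds \<subseteq> {1, 2} \<Longrightarrow> set (inc_digits ds) \<subseteq> {1, 2}"
  by (induction ds) (auto split: if_splits)

lemma set_digits: "set (digits n) \<subseteq> {1, 2}"
  by (induction n) (use set_inc_digits in auto)

lemma inc_digits_not_Nil [simp]: "inc_digits ds \<noteq> []"
  by (cases ds) auto

lemma dec_inc_digits: "set ds \<subseteq> {1, 2} \<Longrightarrow> dec_digits (inc_digits ds) = ds"
  by (induction ds) auto

lemma digits_eq_Nil [simp]: "digits n = [] \<longleftrightarrow> n = 0"
  by (cases n) auto

lemma digits_minus_1: "digits (n - 1) = dec_digits (digits n)"
  by (cases n) (auto simp: dec_inc_digits[OF set_digits])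

text \<open>Every digit is at least 1, so a number with \<open>l\<close> digits is at least
  \<open>2 ^ l - 1\<close>.\<close>

lemma power_length_digits_le: "2 ^ length (digits n) \<le> Suc n"
proof -
  define val :: "nat list \<Rightarrow> nat" where "val ds = foldr (\<lambda>d v. d + 2 * v) ds 0" for ds
  have inc: "set ds \<subseteq> {1, 2} \<Longrightarrow> val (inc_digits ds) = Suc (val ds)" for ds
    by (induction ds) (auto simp: val_def)
  have val: "val (digits n) = n"
    by (induction n) (simp_all add: inc[OF set_digits], simp add: val_def)
  have "set ds \<subseteq> {1, 2} \<Longrightarrow> 2 ^ length ds \<le> Suc (val ds)" for ds
    by (induction ds) (auto simp: val_def)
  from this[OF set_digits[of n]] show ?thesis by (simp add: val)
qed

lemma length_digits_le: "n < 2 ^ h \<Longrightarrow> length (digits n) \<le> h"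
proof -
  assume "n < 2 ^ h"
  then have "(2 :: nat) ^ length (digits n) < 2 ^ Suc h"
    using power_length_digits_le[of n] by simp
  then have "length (digits n) < Suc h"
    by (rule power_less_imp_less_exp[rotated]) simp
  then show ?thesis by simp
qed

text \<open>The blank is 0, which is not a digit; hence both ends of the number are recognized by
  reading.\<close>

definition tape_of :: "nat list \<Rightarrow> int \<Rightarrow> nat" where
  "tape_of ds i = (if 0 \<le> i \<and> i < int (length ds) then ds ! nat i else 0)"

lemma tape_of_read [simp]: "tape_of (pre @ d # ds) (int (length pre)) = d"
  by (simp add: tape_of_def)

lemma tape_of_end [simp]: "tape_of ds (int (length ds)) = 0" "tape_of ds (- 1) = 0"
  by (simp_all add: tape_of_def)

lemma tape_of_update:
  "(tape_of (pre @ d # ds))(int (length pre) := e) = tape_of (pre @ e # ds)"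
  by (rule ext) (auto simp: tape_of_def nth_append nth_Cons split: nat.splits)

lemma tape_of_extend: "(tape_of pre)(int (length pre) := e) = tape_of (pre @ [e])"
  by (rule ext) (auto simp: tape_of_def nth_append)

lemma tape_of_trim: "(tape_of (pre @ [e]))(int (length pre) := 0) = tape_of pre"
  by (rule ext) (auto simp: tape_of_def nth_append)

lemma tape_of_le_2: "set ds \<subseteq> {1, 2} \<Longrightarrow> tape_of ds i \<le> 2"
  using nth_mem[of "nat i" ds] by (fastforce simp: tape_of_def)

lemma tape_of_nonzero: "set ds \<subseteq> {1, 2} \<Longrightarrow> 0 \<le> i \<Longrightarrow> i < int (length ds) \<Longrightarrow> tape_of ds i \<noteq> 0"
  using nth_mem[of "nat i" ds] by (fastforce simp: tape_of_def)

section \<open>Compiling counter programs to Turing machines\<close>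

datatype phase = Go | Back | Trim

instance input_symbol :: countable by countable_datatype
instance test :: countable by countable_datatype
instance com :: countable by countable_datatype
instance phase :: countable by countable_datatype

definition idle :: "nat list \<Rightarrow> (nat \<times> direction) list" where
  "idle ss = map (\<lambda>s. (s, Stay)) ss"

fun holds_read :: "test \<Rightarrow> input_symbol \<Rightarrow> nat list \<Rightarrow> bool" where
  "holds_read (At b) a ss \<longleftrightarrow> a = b"
| "holds_read (Not_At b) a ss \<longleftrightarrow> a \<noteq> b"
| "holds_read (Non_Zero r) a ss \<longleftrightarrow> ss ! r \<noteq> 0"

text \<open>
  A state is a list of commands still to be executed together with a phase.  In the phase
  \<open>Back\<close> the head of the counter returns to the origin; \<open>Trim\<close> erases a leading digit that a borrow
  has used up.
\<close>

fun delta :: "com list \<Rightarrow> phase \<Rightarrow> input_symbol \<Rightarrow> nat list \<Rightarrow>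
    ((com list \<times> phase) \<times> direction \<times> (nat \<times> direction) list) set" where
  "delta (Skip # k) Go a ss = {((k, Go), Stay, idle ss)}"
| "delta (Fwd # k) Go a ss = {((k, Go), Move_Right, idle ss)}"
| "delta (Rewind # k) Go a ss =
    (if a = Left_End then {((k, Go), Stay, idle ss)} else {((Rewind # k, Go), Move_Left, idle ss)})"
| "delta ((c ;; d) # k) Go a ss = {((c # d # k, Go), Stay, idle ss)}"
| "delta (If t c d # k) Go a ss =
    {(((if holds_read t a ss then c else d) # k, Go), Stay, idle ss)}"
| "delta (While t c # k) Go a ss =
    {((if holds_read t a ss then c # While t c # k else k, Go), Stay, idle ss)}"
| "delta (Choice c d # k) Go a ss = {((c # k, Go), Stay, idle ss), ((d # k, Go), Stay, idle ss)}"
| "delta (Inc r # k) Go a ss =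
    (if ss ! r = 2 then {((Inc r # k, Go), Stay, (idle ss)[r := (1, Move_Right)])}
     else {((Inc r # k, Back), Stay, (idle ss)[r := (Suc (ss ! r), Stay)])})"
| "delta (Inc r # k) Back a ss =
    (if ss ! r = 0 then {((k, Go), Stay, (idle ss)[r := (0, Move_Right)])}
     else {((Inc r # k, Back), Stay, (idle ss)[r := (ss ! r, Move_Left)])})"
| "delta (Dec r # k) Go a ss =
    (if ss ! r = 1 then {((Dec r # k, Go), Stay, (idle ss)[r := (2, Move_Right)])}
     else if ss ! r = 2 then {((Dec r # k, Back), Stay, (idle ss)[r := (1, Stay)])}
     else {((Dec r # k, Trim), Stay, (idle ss)[r := (0, Move_Left)])})"
| "delta (Dec r # k) Trim a ss = {((Dec r # k, Back), Stay, (idle ss)[r := (0, Move_Left)])}"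
| "delta (Dec r # k) Back a ss =
    (if ss ! r = 0 then {((k, Go), Stay, (idle ss)[r := (0, Move_Right)])}
     else {((Dec r # k, Back), Stay, (idle ss)[r := (ss ! r, Move_Left)])})"
| "delta _ _ _ _ = {}"

primrec regs_test :: "test \<Rightarrow> nat" where
  "regs_test (At a) = 0"
| "regs_test (Not_At a) = 0"
| "regs_test (Non_Zero r) = Suc r"

primrec regs :: "com \<Rightarrow> nat" where
  "regs Skip = 0"
| "regs Reject = 0"
| "regs Fwd = 0"
| "regs Rewind = 0"
| "regs (Inc r) = Suc r"
| "regs (Dec r) = Suc r"
| "regs (c ;; d) = max (regs c) (regs d)"
| "regs (If t c d) = max (regs_test t) (max (regs c) (regs d))"
| "regs (While t c) = max (regs_test t) (regs c)"
| "regs (Choice c d) = max (regs c) (regs d)"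

text \<open>The stacks that can arise while \<open>c\<close> runs on top of \<open>k\<close>, down
  to \<open>k\<close> itself. A loop body runs on top of its own loop, so the set is finite however
  long the run is; it supplies the states of the machine.\<close>

primrec conts :: "com \<Rightarrow> com list \<Rightarrow> com list set" where
  "conts Skip k = {Skip # k, k}"
| "conts Reject k = {Reject # k, k}"
| "conts Fwd k = {Fwd # k, k}"
| "conts Rewind k = {Rewind # k, k}"
| "conts (Inc r) k = {Inc r # k, k}"
| "conts (Dec r) k = {Dec r # k, k}"
| "conts (c ;; d) k = insert ((c ;; d) # k) (conts c (d # k) \<union> conts d k)"
| "conts (If t c d) k = insert (If t c d # k) (conts c k \<union> conts d k)"
| "conts (While t c) k = insert (While t c # k) (insert k (conts c (While t c # k)))"
| "conts (Choice c d) k = insert (Choice c d # k) (conts c k \<union> conts d k)"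

lemma finite_conts [simp]: "finite (conts c k)"
  by (induction c arbitrary: k) auto

lemma conts_self [simp]: "c # k \<in> conts c k"
  by (cases c) auto

lemma finite_delta [simp]: "finite (delta k ph a ss)"
  by (cases "(k, ph, a, ss)" rule: delta.cases) auto

lemma length_delta: "(q, d, acts) \<in> delta k ph a ss \<Longrightarrow> length acts = length ss"
  by (cases "(k, ph, a, ss)" rule: delta.cases) (auto simp: idle_def split: if_splits)

text \<open>At \<open>k0 = k\<close> the command \<open>c\<close> is finished, and the next
  transition belongs to \<open>k\<close>, whose further stacks may lie outside
  \<open>conts c k\<close>.\<close>

lemma delta_conts:
  assumes "((k', ph'), d, acts) \<in> delta k0 ph a ss" "k0 \<in> conts c k" "k0 \<noteq> k"
  shows "k' \<in> conts c k"
  using assms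
proof (induction c arbitrary: k)
  case (Seq c1 c2)
  then consider "k0 = (c1 ;; c2) # k" | "k0 \<in> conts c1 (c2 # k)" "k0 \<noteq> c2 # k"
    | "k0 \<in> conts c2 k"
    using conts_self[of c2 k] by (cases "k0 = c2 # k") auto
  then show ?case
  proof cases
    case 1
    then show ?thesis using Seq.prems by (cases ph) auto
  next
    case 2
    then show ?thesis using Seq.IH(1)[OF Seq.prems(1)] by simp
  next
    case 3
    then show ?thesis using Seq.IH(2)[OF Seq.prems(1)] Seq.prems(3) by simp
  qed
next
  case (If t c1 c2)
  then consider "k0 = If t c1 c2 # k" | "k0 \<in> conts c1 k" | "k0 \<in> conts c2 k" by auto
  then show ?case
  proof cases
    case 1
    then show ?thesis using If.prems by (cases ph) auto
  next
    case 2
    then show ?thesis using If.IH(1)[OF If.prems(1)] If.prems(3) by simp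
  next
    case 3
    then show ?thesis using If.IH(2)[OF If.prems(1)] If.prems(3) by simp
  qed
next
  case (While t c)
  then consider "k0 = While t c # k" | "k0 \<in> conts c (While t c # k)" "k0 \<noteq> While t c # k" by auto
  then show ?case
  proof cases
    case 1
    then show ?thesis using While.prems by (cases ph) (auto split: if_splits)
  next
    case 2
    then show ?thesis using While.IH[OF While.prems(1)] by simp
  qed
next
  case (Choice c1 c2)
  then consider "k0 = Choice c1 c2 # k" | "k0 \<in> conts c1 k" | "k0 \<in> conts c2 k" by auto
  then show ?case
  proof cases
    case 1
    then show ?thesis using Choice.prems by (cases ph) auto
  next
    case 2
    then show ?thesis using Choice.IH(1)[OF Choice.prems(1)] Choice.prems(3) by simp
  next
    case 3
    then show ?thesis using Choice.IH(2)[OF Choice.prems(1)] Choice.prems(3) by simp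
  qed
qed (cases ph; auto split: if_splits)+

text \<open>Stacks from \<open>conts prog []\<close> and symbols from 0, 1, 2 keep the relation
  finite. The empty stack and a stack with \<open>Reject\<close> on top admit no transition; only
  the former accepts.\<close>

definition machine :: "com \<Rightarrow> (nat, nat) ntm" where
  "machine prog =
     \<lparr>work_tapes = regs prog, start_state = to_nat ([prog], Go),
      accepting = {to_nat ([] :: com list, Go)}, blank = 0,
      transitions =
        (\<Union>k\<in>conts prog []. \<Union>ph. \<Union>a. \<Union>ss\<in>{ss. set ss \<subseteq> {0, 1, 2} \<and> length ss = regs prog}.
          (\<lambda>(q, d, acts). (to_nat (k, ph), a, ss, to_nat q, d, acts)) ` delta k ph a ss)\<rparr>"

lemma valid_machine: "valid_ntm (machine prog)"
proof -
  have "(UNIV :: phase set) = {Go, Back, Trim}"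
    using phase.exhaust by auto
  then have [simp]: "finite (UNIV :: phase set)" by (metis finite.simps)
  have "(UNIV :: input_symbol set) = {Left_End, Right_End, Bit True, Bit False}"
  proof -
    have "a \<in> {Left_End, Right_End, Bit True, Bit False}" for a
      by (cases a) auto
    then show ?thesis by blast
  qed
  then have [simp]: "finite (UNIV :: input_symbol set)" by (metis finite.simps)
  have [simp]: "finite {ss. set ss \<subseteq> {0, Suc 0, 2} \<and> length ss = R}" for R
    by (rule finite_lists_length_eq) simp
  show ?thesis
    by (auto simp: valid_ntm_def machine_def dest: length_delta)
qed

definition reads :: "nat \<Rightarrow> (nat \<Rightarrow> (int \<Rightarrow> nat) \<times> int) \<Rightarrow> nat list" where
  "reads R W = map (\<lambda>r. fst (W r) (snd (W r))) [0..<R]"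

definition conf ::
  "com \<Rightarrow> com list \<Rightarrow> phase \<Rightarrow> nat \<Rightarrow> (nat \<Rightarrow> (int \<Rightarrow> nat) \<times> int) \<Rightarrow> (nat, nat) config" where
  "conf prog k ph p W = (to_nat (k, ph), int p, map W [0..<regs prog])"

lemma conf_eq_iff:
  "conf prog k ph p W = conf prog k' ph' p' W' \<longleftrightarrow>
    k = k' \<and> ph = ph' \<and> p = p' \<and> (\<forall>r<regs prog. W r = W' r)"
  by (auto simp: conf_def)

abbreviation apply_acts ::
  "((int \<Rightarrow> nat) \<times> int) list \<Rightarrow> (nat \<times> direction) list \<Rightarrow> ((int \<Rightarrow> nat) \<times> int) list" where
  "apply_acts \<equiv> map2 (\<lambda>(t, h) (s, e). (t(h := s), h + shift e))"

lemma apply_idle: "apply_acts (map W [0..<R]) (idle (reads R W)) = map W [0..<R]"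
  by (rule nth_equalityI) (auto simp: idle_def reads_def split: prod.splits)

lemma apply_write:
  "apply_acts (map (W(r := (t, h))) [0..<R]) ((idle (reads R (W(r := (t, h)))))[r := (s, e)]) =
    map (W(r := (t(h := s), h + shift e))) [0..<R]"
  by (rule nth_equalityI)
     (auto simp: idle_def reads_def nth_list_update split: prod.splits)

text \<open>The table has entries only for symbols up to 2, whence the second assumption;
  injectivity of \<open>to_nat\<close> lets stack and phase be read back from a state.\<close>

lemma step_machine_iff:
  assumes "k \<in> conts prog []" "\<forall>r<regs prog. fst (W r) (snd (W r)) \<le> 2"
  shows "step (machine prog) x (conf prog k ph p W) c \<longleftrightarrow>
    (\<exists>k' ph' d acts. ((k', ph'), d, acts) \<in> delta k ph (input_read x (int p)) (reads (regs prog) W) \<and>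
       0 \<le> int p + shift d \<and> int p + shift d \<le> int (length x) + 1 \<and>
       c = (to_nat (k', ph'), int p + shift d, apply_acts (map W [0..<regs prog]) acts))"
    (is "_ \<longleftrightarrow> ?rhs")
proof -
  have le2: "set (reads (regs prog) W) \<subseteq> {0, 1, 2}" "length (reads (regs prog) W) = regs prog"
    using assms(2) by (fastforce simp: reads_def)+
  have eq: "map (\<lambda>(t, h). t h) (map W [0..<regs prog]) = reads (regs prog) W"
    by (simp add: reads_def case_prod_beta)
  have trans: "(to_nat (k, ph), a, reads (regs prog) W, q', d, acts) \<in> transitions (machine prog) \<longleftrightarrow>
      (\<exists>k' ph'. q' = to_nat (k', ph') \<and> ((k', ph'), d, acts) \<in> delta k ph a (reads (regs prog) W))"
    for a q' d acts
  proof
    assume "(to_nat (k, ph), a, reads (regs prog) W, q', d, acts) \<in> transitions (machine prog)"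
    then show "\<exists>k' ph'. q' = to_nat (k', ph') \<and> ((k', ph'), d, acts) \<in> delta k ph a (reads (regs prog) W)"
      by (auto simp: machine_def)
  next
    assume "\<exists>k' ph'. q' = to_nat (k', ph') \<and> ((k', ph'), d, acts) \<in> delta k ph a (reads (regs prog) W)"
    then obtain k' ph' where q': "q' = to_nat (k', ph')"
      and *: "((k', ph'), d, acts) \<in> delta k ph a (reads (regs prog) W)" by blast
    show "(to_nat (k, ph), a, reads (regs prog) W, q', d, acts) \<in> transitions (machine prog)"
      unfolding machine_def ntm.simps
    proof (rule UN_I[OF assms(1)], rule UN_I[where a = ph], simp, rule UN_I[where a = a], simp,
        rule UN_I[where a = "reads (regs prog) W"])
      show "reads (regs prog) W \<in> {ss. set ss \<subseteq> {0, 1, 2} \<and> length ss = regs prog}"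
        using le2 by simp
      show "(to_nat (k, ph), a, reads (regs prog) W, q', d, acts) \<in>
          (\<lambda>(q, d, acts). (to_nat (k, ph), a, reads (regs prog) W, to_nat q, d, acts)) `
            delta k ph a (reads (regs prog) W)"
        by (rule image_eqI[OF _ *]) (simp add: q')
    qed
  qed
  show ?thesis
  proof
    assume "step (machine prog) x (conf prog k ph p W) c"
    then show ?rhs
      unfolding conf_def
      by cases (use eq trans in \<open>auto simp del: map_map\<close>)
  next
    assume ?rhs
    then obtain k' ph' d acts where
      *: "((k', ph'), d, acts) \<in> delta k ph (input_read x (int p)) (reads (regs prog) W)"
      "0 \<le> int p + shift d" "int p + shift d \<le> int (length x) + 1"
      "c = (to_nat (k', ph'), int p + shift d, apply_acts (map W [0..<regs prog]) acts)"
      by blast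
    show "step (machine prog) x (conf prog k ph p W) c"
      unfolding conf_def *(4)
      by (rule step.intros) (use * trans eq in auto)
  qed
qed

definition tapes_ok :: "nat \<Rightarrow> int \<Rightarrow> (nat \<Rightarrow> (int \<Rightarrow> nat) \<times> int) \<Rightarrow> bool" where
  "tapes_ok R H W \<longleftrightarrow> (\<forall>r<R. fst (W r) (snd (W r)) \<le> 2 \<and> \<bar>snd (W r)\<bar> \<le> H)"

lemma tapes_ok_update:
  "tapes_ok R H W \<Longrightarrow> t h \<le> 2 \<Longrightarrow> \<bar>h\<bar> \<le> H \<Longrightarrow> tapes_ok R H (W(r := (t, h)))"
  by (simp add: tapes_ok_def)

lemma path_count_det:
  assumes "k \<in> conts prog []" "tapes_ok (regs prog) H W"
    and "delta k ph (input_read x (int p)) (reads (regs prog) W) = {((k', ph'), d, acts)}"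
    and "int p' = int p + shift d" "p' \<le> length x + 1"
    and "apply_acts (map W [0..<regs prog]) acts = map W' [0..<regs prog]"
    and "path_count (machine prog) x H (conf prog k' ph' p' W') N"
  shows "path_count (machine prog) x H (conf prog k ph p W) N"
proof -
  have 1: "\<forall>(t, h) \<in> set (snd (snd (conf prog k ph p W))). \<bar>h\<bar> \<le> H"
    using assms(2) by (auto simp: conf_def tapes_ok_def split: prod.splits)
  have le: "\<forall>r<regs prog. fst (W r) (snd (W r)) \<le> 2"
    using assms(2) by (simp add: tapes_ok_def)
  have 2: "{conf prog k' ph' p' W'} = {c. step (machine prog) x (conf prog k ph p W) c}"
    unfolding step_machine_iff[OF assms(1) le] using assms(3-6) by (auto simp: conf_def)
  have "path_count (machine prog) x H (conf prog k ph p W) (\<Sum>c\<in>{conf prog k' ph' p' W'}. N)"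
    by (rule path_count.succ[OF 1 2]) (use assms(7) in auto)
  then show ?thesis by simp
qed

lemma path_count_write:
  assumes "k \<in> conts prog []" "tapes_ok (regs prog) H W" "r < regs prog"
    and "t h \<le> 2" "\<bar>h\<bar> \<le> H" "p \<le> length x + 1"
    and "\<And>a ss. ss ! r = t h \<Longrightarrow> delta k ph a ss = {((k', ph'), Stay, (idle ss)[r := (s, e)])}"
    and "path_count (machine prog) x H (conf prog k' ph' p (W(r := (t(h := s), h + shift e)))) N"
  shows "path_count (machine prog) x H (conf prog k ph p (W(r := (t, h)))) N"
proof (rule path_count_det[OF assms(1) tapes_ok_update[where t = t and h = h, OF assms(2,4,5)] _ _ assms(6) apply_write assms(8)])
  show "delta k ph (input_read x (int p)) (reads (regs prog) (W(r := (t, h)))) =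
    {((k', ph'), Stay, (idle (reads (regs prog) (W(r := (t, h)))))[r := (s, e)])}"
    by (rule assms(7)) (use assms(3) in \<open>simp add: reads_def\<close>)
qed simp

section \<open>Simulation of increments and decrements by head movements\<close>

context
  fixes prog :: com and x :: "bool list" and H :: int and k :: "com list" and r p :: nat
    and W :: "nat \<Rightarrow> (int \<Rightarrow> nat) \<times> int" and N :: nat
  assumes ok: "tapes_ok (regs prog) H W" and r: "r < regs prog" and p: "p \<le> length x + 1"
    and H: "1 \<le> H"
begin

text \<open>The head walks left over nonzero digits to the blank at cell -1 and then steps right to
  the origin. The induction is on the distance to that blank; \<open>1 \<le> H\<close> permits the
  visit to cell -1.\<close>

lemma path_count_back:
  assumes c: "c = Inc r \<or> c = Dec r" "c # k \<in> conts prog []"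
    and ds: "set ds \<subseteq> {1, 2}" "int (length ds) \<le> H"
    and fin: "path_count (machine prog) x H (conf prog k Go p (W(r := (tape_of ds, 0)))) N"
    and h: "- 1 \<le> h" "h < int (length ds)"
  shows "path_count (machine prog) x H (conf prog (c # k) Back p (W(r := (tape_of ds, h)))) N"
  using h
proof (induction "nat (h + 1)" arbitrary: h)
  case 0
  then have h: "h = - 1" by simp
  have eq: "(tape_of ds)(- 1 := 0) = tape_of ds" by (simp add: fun_upd_idem)
  have fin': "path_count (machine prog) x H
      (conf prog k Go p (W(r := ((tape_of ds)(- 1 := 0), - 1 + shift Move_Right)))) N"
    using fin by (simp only: eq shift.simps) simp
  show ?case
    unfolding h
    by (rule path_count_write[OF c(2) ok r _ _ p _ fin']) (use c(1) H in auto)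
next
  case (Suc n)
  then have *: "0 \<le> h" by linarith
  have nz: "tape_of ds h \<noteq> 0" using tape_of_nonzero[OF ds(1) *] Suc.prems by simp
  have "path_count (machine prog) x H (conf prog (c # k) Back p (W(r := (tape_of ds, h + - 1)))) N"
    by (rule Suc.hyps(1)) (use Suc.hyps(2) Suc.prems * in auto)
  then have fin': "path_count (machine prog) x H (conf prog (c # k) Back p
      (W(r := ((tape_of ds)(h := tape_of ds h), h + shift Move_Left)))) N"
    by (simp only: fun_upd_triv shift.simps)
  show ?case
    by (rule path_count_write[OF c(2) ok r _ _ p _ fin'])
       (use c(1) Suc.prems * nz ds(2) tape_of_le_2[OF ds(1)] in auto)
qed

text \<open>The list \<open>pre\<close> holds the digits already passed: a carry turns a 2 into a 1
  and moves it from \<open>ds\<close> to \<open>pre\<close>, so generalizing over \<open>pre\<close>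
  lets the induction follow the head.\<close>

lemma path_count_inc:
  assumes c: "Inc r # k \<in> conts prog []"
    and "set (pre @ ds) \<subseteq> {1, 2}" "int (length (pre @ inc_digits ds)) \<le> H"
    and "path_count (machine prog) x H (conf prog k Go p (W(r := (tape_of (pre @ inc_digits ds), 0)))) N"
  shows "path_count (machine prog) x H
    (conf prog (Inc r # k) Go p (W(r := (tape_of (pre @ ds), int (length pre))))) N"
  using assms(2-)
proof (induction ds arbitrary: pre)
  case Nil
  have "path_count (machine prog) x H (conf prog (Inc r # k) Back p
      (W(r := (tape_of (pre @ [1]), int (length pre))))) N"
    by (rule path_count_back[OF _ c _ _ Nil(3)[unfolded inc_digits.simps]]) (use Nil(1,2) in auto)
  then have fin: "path_count (machine prog) x H (conf prog (Inc r # k) Back p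
      (W(r := ((tape_of (pre @ []))(int (length pre) := 1), int (length pre) + shift Stay)))) N"
    by (simp only: tape_of_extend append_Nil2 shift.simps add_0_right)
  show ?case
    by (rule path_count_write[OF c ok r _ _ p _ fin]) (use Nil(2) in auto)
next
  case (Cons d ds)
  show ?case
  proof (cases "d = 2")
    case True
    have inc: "inc_digits (d # ds) = 1 # inc_digits ds" by (simp add: True)
    have "path_count (machine prog) x H (conf prog (Inc r # k) Go p
        (W(r := (tape_of ((pre @ [1]) @ ds), int (length (pre @ [1])))))) N"
    proof (rule Cons.IH)
      show "path_count (machine prog) x H (conf prog k Go p
          (W(r := (tape_of ((pre @ [1]) @ inc_digits ds), 0)))) N"
        using Cons.prems(3) by (simp only: inc append_assoc append.simps)
    qed (use Cons.prems(1,2) inc in simp_all)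
    then have fin: "path_count (machine prog) x H (conf prog (Inc r # k) Go p
        (W(r := ((tape_of (pre @ d # ds))(int (length pre) := 1), int (length pre) + shift Move_Right)))) N"
      by (simp only: tape_of_update append_assoc append.simps shift.simps length_append_singleton of_nat_Suc add.commute)
    show ?thesis
      by (rule path_count_write[OF c ok r _ _ p _ fin]) (use Cons.prems(2) True in auto)
  next
    case False
    then have d: "d = 1" using Cons.prems by simp
    have inc: "inc_digits (d # ds) = 2 # ds" by (simp add: d)
    have "path_count (machine prog) x H (conf prog (Inc r # k) Back p
        (W(r := (tape_of (pre @ 2 # ds), int (length pre))))) N"
      by (rule path_count_back[OF _ c _ _ Cons.prems(3)[unfolded inc]])
         (use Cons.prems(1,2) inc in auto)
    then have fin: "path_count (machine prog) x H (conf prog (Inc r # k) Back p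
        (W(r := ((tape_of (pre @ d # ds))(int (length pre) := 2), int (length pre) + shift Stay)))) N"
      by (simp only: tape_of_update shift.simps add_0_right)
    show ?thesis
      by (rule path_count_write[OF c ok r _ _ p _ fin]) (use Cons.prems(2) d in \<open>auto simp: numeral_2_eq_2\<close>)
  qed
qed

text \<open>A borrow replaces 1 by 2 before it is known whether a higher digit exists. If the next
  cell is blank, the 2 just written stands at the leading place and phase \<open>Trim\<close> erases
  it.\<close>

lemma path_count_dec:
  assumes c: "Dec r # k \<in> conts prog []"
    and "ds \<noteq> []" "set (pre @ ds) \<subseteq> {1, 2}" "int (length (pre @ ds)) \<le> H"
    and "path_count (machine prog) x H (conf prog k Go p (W(r := (tape_of (pre @ dec_digits ds), 0)))) N"
  shows "path_count (machine prog) x H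
    (conf prog (Dec r # k) Go p (W(r := (tape_of (pre @ ds), int (length pre))))) N"
  using assms(2-)
proof (induction ds arbitrary: pre)
  case (Cons d ds)
  show ?case
  proof (cases "d = 2")
    case True
    have dec: "dec_digits (d # ds) = 1 # ds" by (simp add: True)
    have "path_count (machine prog) x H (conf prog (Dec r # k) Back p
        (W(r := (tape_of (pre @ 1 # ds), int (length pre))))) N"
      by (rule path_count_back[OF _ c _ _ Cons.prems(4)[unfolded dec]])
         (use Cons.prems(2,3) in auto)
    then have fin: "path_count (machine prog) x H (conf prog (Dec r # k) Back p
        (W(r := ((tape_of (pre @ d # ds))(int (length pre) := 1), int (length pre) + shift Stay)))) N"
      by (simp only: tape_of_update shift.simps add_0_right)
    show ?thesis
      by (rule path_count_write[OF c ok r _ _ p _ fin]) (use Cons.prems(3) True in auto)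
  next
    case False
    then have d: "d = 1" using Cons.prems by simp
    have "path_count (machine prog) x H (conf prog (Dec r # k) Go p
        (W(r := (tape_of ((pre @ [2]) @ ds), int (length (pre @ [2])))))) N"
    proof (cases "ds = []")
      case True
      have dec: "dec_digits (d # ds) = []" by (simp add: d True)
      have "path_count (machine prog) x H (conf prog (Dec r # k) Back p
          (W(r := (tape_of pre, int (length pre) + - 1)))) N"
        by (rule path_count_back[OF _ c _ _ Cons.prems(4)[unfolded dec append_Nil2]])
           (use Cons.prems(2,3) in auto)
      then have fin: "path_count (machine prog) x H (conf prog (Dec r # k) Back p
          (W(r := ((tape_of (pre @ [2]))(int (length pre) := 0), int (length pre) + shift Move_Left)))) N"
        by (simp only: tape_of_trim shift.simps)
      have "path_count (machine prog) x H (conf prog (Dec r # k) Trim p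
          (W(r := (tape_of (pre @ [2]), int (length pre))))) N"
        by (rule path_count_write[OF c ok r _ _ p _ fin]) (use Cons.prems(3) in auto)
      \<comment> \<open>The cell after the last digit is blank already, so the blank written on the
        way from \<open>Go\<close> to \<open>Trim\<close> changes nothing.\<close>
      moreover have "(tape_of (pre @ [2]))(int (length (pre @ [2])) := 0) = tape_of (pre @ [2])"
        by (simp only: fun_upd_idem tape_of_end)
      ultimately have fin: "path_count (machine prog) x H (conf prog (Dec r # k) Trim p
          (W(r := ((tape_of (pre @ [2]))(int (length (pre @ [2])) := 0),
             int (length (pre @ [2])) + shift Move_Left)))) N"
        by simp
      have "path_count (machine prog) x H (conf prog (Dec r # k) Go p
          (W(r := (tape_of (pre @ [2]), int (length (pre @ [2])))))) N"
        by (rule path_count_write[OF c ok r _ _ p _ fin])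
           (use Cons.prems(3) in \<open>simp_all only: tape_of_end, simp_all\<close>)
      then show ?thesis by (simp only: True append_Nil2)
    next
      case False
      then have dec: "dec_digits (d # ds) = 2 # dec_digits ds" by (simp add: d)
      show ?thesis
      proof (rule Cons.IH[OF False])
        show "path_count (machine prog) x H (conf prog k Go p
            (W(r := (tape_of ((pre @ [2]) @ dec_digits ds), 0)))) N"
          using Cons.prems(4) by (simp only: dec append_assoc append.simps)
      qed (use Cons.prems(2,3) in simp_all)
    qed
    then have fin: "path_count (machine prog) x H (conf prog (Dec r # k) Go p
        (W(r := ((tape_of (pre @ d # ds))(int (length pre) := 2), int (length pre) + shift Move_Right)))) N"
      by (simp only: tape_of_update append_assoc append.simps shift.simps length_append_singleton of_nat_Suc add.commute)
    show ?thesis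
      by (rule path_count_write[OF c ok r _ _ p _ fin]) (use Cons.prems(3) d in auto)
  qed
qed simp

end

definition counters :: "(nat \<Rightarrow> nat) \<Rightarrow> nat \<Rightarrow> (int \<Rightarrow> nat) \<times> int" where
  "counters s r = (tape_of (digits (s r)), 0)"

lemma counters_update: "counters (s(r := v)) = (counters s)(r := (tape_of (digits v), 0))"
  by (auto simp: counters_def)

lemma tape_of_digits_origin_iff: "tape_of (digits v) 0 \<noteq> 0 \<longleftrightarrow> v \<noteq> 0"
  using tape_of_nonzero[OF set_digits[of v], of 0] by (auto simp: tape_of_def)

lemma tapes_ok_counters: "0 \<le> H \<Longrightarrow> tapes_ok R H (counters s)"
  using tape_of_le_2[OF set_digits] by (simp add: tapes_ok_def counters_def)

lemma holds_read_counters: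
  "regs_test t \<le> R \<Longrightarrow> holds_read t a (reads R (counters s)) = holds t a s"
  using tape_of_digits_origin_iff by (cases t) (auto simp: reads_def counters_def)

lemma conts_step:
  assumes "k \<in> conts prog []" "k \<noteq> []" "((k', ph'), d, acts) \<in> delta k ph a ss"
  shows "k' \<in> conts prog []"
  using delta_conts[OF assms(3,1,2)] .

lemma path_count_idle:
  assumes "k \<in> conts prog []" "k \<noteq> []" "0 \<le> H"
    and "delta k Go (input_read x (int p)) (reads (regs prog) (counters s)) =
      {((k', Go), d, idle (reads (regs prog) (counters s)))}"
    and "int p' = int p + shift d" "p' \<le> length x + 1"
    and "k' \<in> conts prog [] \<Longrightarrow>
      path_count (machine prog) x H (conf prog k' Go p' (counters s)) N"
  shows "path_count (machine prog) x H (conf prog k Go p (counters s)) N"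
proof -
  have "k' \<in> conts prog []"
    by (rule conts_step[OF assms(1,2), where ph = Go and a = "input_read x (int p)"
          and ss = "reads (regs prog) (counters s)"]) (subst assms(4), rule singletonI)
  from assms(7)[OF this] show ?thesis
    by (rule path_count_det[OF assms(1) tapes_ok_counters[OF assms(3)] assms(4-6) apply_idle])
qed

text \<open>Between two commands all work heads rest at the origin, as \<open>counters\<close>
  records. The cap \<open>V < 2 ^ h\<close> limits counters to \<open>h\<close> digits; the extra 1
  leaves room for cell -1 even if \<open>h = 0\<close>.\<close>

theorem runs_path_count:
  assumes "runs x V k p s N" "k \<in> conts prog []" "\<forall>c\<in>set k. regs c \<le> regs prog"
    and "p \<le> length x + 1" "\<forall>r. s r \<le> V" "V < 2 ^ h"
  shows "path_count (machine prog) x (int h + 1) (conf prog k Go p (counters s)) N"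
  using assms
proof (induction rule: runs.induct)
  case (Nil p s)
  let ?c = "conf prog [] Go p (counters s)"
  have ok: "\<forall>r<regs prog. fst (counters s r) (snd (counters s r)) \<le> 2"
    using tape_of_le_2[OF set_digits] by (simp add: counters_def)
  have "path_count (machine prog) x (int h + 1) ?c (if fst ?c \<in> accepting (machine prog) then 1 else 0)"
    by (rule path_count.halt) (auto simp: step_machine_iff[OF Nil(1) ok], auto simp: conf_def counters_def)
  then show ?case by (simp add: conf_def machine_def)
next
  case (Reject k p s)
  let ?c = "conf prog (Reject # k) Go p (counters s)"
  have ok: "\<forall>r<regs prog. fst (counters s r) (snd (counters s r)) \<le> 2"
    using tape_of_le_2[OF set_digits] by (simp add: counters_def)
  have "path_count (machine prog) x (int h + 1) ?c (if fst ?c \<in> accepting (machine prog) then 1 else 0)"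
    by (rule path_count.halt) (auto simp: step_machine_iff[OF Reject(1) ok], auto simp: conf_def counters_def)
  then show ?case by (simp add: conf_def machine_def)
next
  case (Skip k p s N)
  show ?case
    by (rule path_count_idle[OF Skip.prems(1), where d = Stay and k' = k and p' = p])
       (use Skip in auto)
next
  case (Fwd p k s N)
  show ?case
    by (rule path_count_idle[OF Fwd.prems(1), where d = Move_Right and k' = k and p' = "Suc p"])
       (use Fwd in auto)
next
  case (Rewind k s N p)
  show ?case
    \<comment> \<open>A single \<open>Rewind\<close> takes \<open>p + 1\<close> machine steps: one
      per cell to the left and one at the marker.\<close>
    using Rewind.prems(3)
  proof (induction p)
    case 0
    show ?case
      by (rule path_count_idle[OF Rewind.prems(1), where d = Stay and k' = k and p' = 0])
         (use Rewind in \<open>auto simp: input_read_def\<close>)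
  next
    case (Suc p)
    show ?case
      by (rule path_count_idle[OF Rewind.prems(1), where d = Move_Left and k' = "Rewind # k" and p' = p])
         (use Suc in \<open>auto simp: input_read_def\<close>)
  qed
next
  case (Inc s r k p N)
  have r: "r < regs prog" using Inc.prems(2) by simp
  \<comment> \<open>Any transition with target \<open>k\<close> will do; the one used reads a
    made-up list of \<open>r + 1\<close> blanks in phase \<open>Back\<close>. Writing the list with
    \<open>rev\<close> turns it into an append, where simplification finds entry
    \<open>r\<close>.\<close>
  have k: "k \<in> conts prog []"
    by (rule conts_step[OF Inc.prems(1), of k Go Stay "(idle (rev (0 # replicate r 0)))[r := (0, Move_Right)]"
          Back undefined "rev (0 # replicate r 0)"]) (simp_all add: nth_append)
  have len: "length (digits (Suc (s r))) \<le> h"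
    by (rule length_digits_le) (use Inc.hyps(1) Inc.prems(5) in simp)
  have "path_count (machine prog) x (int h + 1) (conf prog k Go p (counters (s(r := Suc (s r))))) N"
    by (rule Inc.IH) (use k Inc.hyps(1) Inc.prems in auto)
  then have fin: "path_count (machine prog) x (int h + 1)
      (conf prog k Go p ((counters s)(r := (tape_of ([] @ inc_digits (digits (s r))), 0)))) N"
    by (simp only: counters_update digits.simps append.simps)
  have "path_count (machine prog) x (int h + 1)
      (conf prog (Inc r # k) Go p ((counters s)(r := (tape_of ([] @ digits (s r)), int (length ([] :: nat list)))))) N"
    by (rule path_count_inc[OF tapes_ok_counters r Inc.prems(3) _ Inc.prems(1) _ _ fin])
       (use len set_digits[of "s r"] in auto)
  then show ?case by (simp add: counters_def[symmetric])
next
  case (Dec s r k p N)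
  have r: "r < regs prog" using Dec.prems(2) by simp
  have k: "k \<in> conts prog []"
    by (rule conts_step[OF Dec.prems(1), of k Go Stay "(idle (rev (0 # replicate r 0)))[r := (0, Move_Right)]"
          Back undefined "rev (0 # replicate r 0)"]) (simp_all add: nth_append)
  have len: "length (digits (s r)) \<le> h"
    by (rule length_digits_le) (use Dec.prems(4,5) le_less_trans in blast)
  have "path_count (machine prog) x (int h + 1) (conf prog k Go p (counters (s(r := s r - 1)))) N"
    by (rule Dec.IH) (use k Dec.prems le_trans[OF diff_le_self] in auto)
  then have fin: "path_count (machine prog) x (int h + 1)
      (conf prog k Go p ((counters s)(r := (tape_of ([] @ dec_digits (digits (s r))), 0)))) N"
    by (simp only: counters_update digits_minus_1 append.simps)
  have "path_count (machine prog) x (int h + 1)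
      (conf prog (Dec r # k) Go p ((counters s)(r := (tape_of ([] @ digits (s r)), int (length ([] :: nat list)))))) N"
    by (rule path_count_dec[OF tapes_ok_counters r Dec.prems(3) _ Dec.prems(1) _ _ _ fin])
       (use len set_digits[of "s r"] Dec.hyps(1) in auto)
  then show ?case by (simp add: counters_def[symmetric])
next
  case (Seq c d k p s N)
  show ?case
    by (rule path_count_idle[OF Seq.prems(1), where d = Stay and k' = "c # d # k" and p' = p])
       (use Seq in auto)
next
  case (If t p s c d k N)
  show ?case
    by (rule path_count_idle[OF If.prems(1), where d = Stay and p' = p and
          k' = "(if holds t (input_read x (int p)) s then c else d) # k"])
       (use If in \<open>auto simp: holds_read_counters\<close>)
next
  case (While t p s c k N)
  show ?case
    by (rule path_count_idle[OF While.prems(1), where d = Stay and p' = p and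
          k' = "if holds t (input_read x (int p)) s then c # While t c # k else k"])
       (use While in \<open>auto simp: holds_read_counters\<close>)
next
  case (Choice c d k p s N N')
  let ?W = "counters s"
  let ?C = "conf prog (Choice c d # k) Go p ?W"
  let ?c = "conf prog (c # k) Go p ?W" and ?d = "conf prog (d # k) Go p ?W"
  have ok: "\<forall>r<regs prog. fst (?W r) (snd (?W r)) \<le> 2"
    using tape_of_le_2[OF set_digits] by (simp add: counters_def)
  have 1: "\<forall>(t, j) \<in> set (snd (snd ?C)). \<bar>j\<bar> \<le> int h + 1"
    by (auto simp: conf_def counters_def)
  have 2: "{?c, ?d} = {e. step (machine prog) x ?C e}"
    unfolding step_machine_iff[OF Choice.prems(1) ok]
    using Choice.prems(3) 
    by (auto simp: apply_idle conf_def
        intro!: exI[of _ Stay] exI[of _ "idle (reads (regs prog) (counters s))"])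
  \<comment> \<open>Equal branches would give a single successor, whose paths are counted once; this
    is why the rule for \<open>Choice\<close> demands \<open>c \<noteq> d\<close>.\<close>
  have ne: "?c \<noteq> ?d" using Choice.hyps(1) by (simp add: conf_eq_iff)
  have mem: "c # k \<in> conts prog []" "d # k \<in> conts prog []"
    by (rule conts_step[OF Choice.prems(1), where ph = Go and ph' = Go and d = Stay
          and acts = "idle []" and ss = "[]"]; simp)+
  have c: "path_count (machine prog) x (int h + 1) ?c N"
    by (rule Choice.IH(1)) (use Choice.prems mem in auto)
  have d: "path_count (machine prog) x (int h + 1) ?d N'"
    by (rule Choice.IH(2)) (use Choice.prems mem in auto)
  have "path_count (machine prog) x (int h + 1) ?C (\<Sum>e\<in>{?c, ?d}. if e = ?c then N else N')"
    by (rule path_count.succ[OF 1 2]) (use c d in auto)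
  then show ?case using ne by simp
qed

text \<open>Counters below a polynomial have logarithmically many digits: \<open>h x\<close> comes
  from \<open>c < 2 ^ c\<close> and \<open>length x + 2 \<le> 2 ^ l x\<close>. As the logarithm is
  at least 1, additive constants are absorbed into its factor.\<close>

theorem sharp_L_if_runs:
  assumes "\<And>x. runs x (c * (length x + 2) ^ e) [prog] 0 (\<lambda>_. 0) (f x)"
  shows "f \<in> sharp_L"
proof -
  define l where "l x = nat \<lceil>log 2 (real (length x) + 2)\<rceil>" for x :: "bool list"
  define h where "h x = c + e * l x" for x
  have log: "1 \<le> log 2 (real (length x) + 2)" for x :: "bool list"
    by (simp add: one_le_log_cancel_iff)
  have l: "length x + 2 \<le> 2 ^ l x" for x
  proof -
    have "real (length x + 2) = 2 powr log 2 (real (length x) + 2)" by simp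
    also have "\<dots> \<le> 2 powr real (l x)"
      using real_nat_ceiling_ge unfolding l_def by (intro powr_mono) auto
    also have "\<dots> = real (2 ^ l x)" by (simp add: powr_realpow)
    finally show ?thesis by (simp only: of_nat_le_iff)
  qed
  have V: "c * (length x + 2) ^ e < 2 ^ h x" for x
  proof -
    have "(length x + 2) ^ e \<le> (2 ^ l x) ^ e" using l by (rule power_mono) simp
    then have "c * (length x + 2) ^ e \<le> c * 2 ^ (e * l x)"
      by (simp add: power_mult[symmetric] mult.commute)
    also have "\<dots> < 2 ^ c * 2 ^ (e * l x)" by (rule mult_strict_right_mono) auto
    finally show ?thesis by (simp add: h_def power_add)
  qed
  show ?thesis
  proof (rule sharp_L_if_path_count[where H = "\<lambda>x. int (h x) + 1", OF valid_machine[of prog]])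
    fix x
    have "path_count (machine prog) x (int (h x) + 1) (conf prog [prog] Go 0 (counters (\<lambda>_. 0))) (f x)"
      by (rule runs_path_count[OF assms]) (use V in auto)
    moreover have "conf prog [prog] Go 0 (counters (\<lambda>_. 0)) = initial_config (machine prog)"
      by (auto simp: conf_def counters_def initial_config_def machine_def tape_of_def[abs_def]
          intro!: nth_equalityI ext)
    ultimately show "path_count (machine prog) x (int (h x) + 1) (initial_config (machine prog)) (f x)"
      by simp
    have "real (l x) \<le> log 2 (real (length x) + 2) + 1"
      using log[of x] unfolding l_def by linarith
    also have "\<dots> \<le> 2 * log 2 (real (length x) + 2)" using log[of x] by simp
    finally have "real e * real (l x) \<le> real e * (2 * log 2 (real (length x) + 2))"
      by (rule mult_left_mono) simp
    moreover have "real (c + 1) * 1 \<le> real (c + 1) * log 2 (real (length x) + 2)"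
      using log[of x] by (intro mult_left_mono) auto
    ultimately show "real_of_int (int (h x) + 1) \<le>
        (real (c + 1) + 2 * real e) * log 2 (real (length x) + 2)"
      by (simp add: h_def algebra_simps)
  qed
qed

section \<open>Deterministic counter programs\<close>

text \<open>Deterministic effects are stated through continuations: every count derivable after
  \<open>c\<close> is derivable before it. They thus compose directly, and with
  \<open>k = []\<close> termination is included.\<close>

definition exec ::
  "bool list \<Rightarrow> nat \<Rightarrow> com \<Rightarrow> nat \<Rightarrow> (nat \<Rightarrow> nat) \<Rightarrow> nat \<Rightarrow> (nat \<Rightarrow> nat) \<Rightarrow> bool" where
  "exec x V c p s p' s' \<longleftrightarrow> (\<forall>k N. runs x V k p' s' N \<longrightarrow> runs x V (c # k) p s N)"

definition rejects :: "bool list \<Rightarrow> nat \<Rightarrow> com \<Rightarrow> nat \<Rightarrow> (nat \<Rightarrow> nat) \<Rightarrow> bool" where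
  "rejects x V c p s \<longleftrightarrow> (\<forall>k. runs x V (c # k) p s 0)"

lemma exec_Skip: "exec x V Skip p s p s"
  by (simp add: exec_def runs.Skip)

lemma exec_Fwd: "p \<le> length x \<Longrightarrow> exec x V Fwd p s (Suc p) s"
  by (simp add: exec_def runs.Fwd)

lemma exec_Rewind: "exec x V Rewind p s 0 s"
  by (simp add: exec_def runs.Rewind)

lemma exec_Inc: "s r < V \<Longrightarrow> exec x V (Inc r) p s p (s(r := Suc (s r)))"
  by (simp add: exec_def runs.Inc)

lemma exec_Dec: "s r \<noteq> 0 \<Longrightarrow> exec x V (Dec r) p s p (s(r := s r - 1))"
  by (simp add: exec_def runs.Dec)

lemma exec_Seq:
  "exec x V c p s p1 s1 \<Longrightarrow> exec x V d p1 s1 p2 s2 \<Longrightarrow> exec x V (c ;; d) p s p2 s2"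
  by (simp add: exec_def runs.Seq)

lemma exec_If:
  "exec x V (if holds t (input_read x (int p)) s then c else d) p s p' s' \<Longrightarrow>
    exec x V (If t c d) p s p' s'"
  by (simp add: exec_def runs.If)

lemma exec_While_False:
  "\<not> holds t (input_read x (int p)) s \<Longrightarrow> exec x V (While t c) p s p s"
  by (simp add: exec_def runs.While)

lemma exec_While_True:
  "holds t (input_read x (int p)) s \<Longrightarrow> exec x V c p s p1 s1 \<Longrightarrow>
    exec x V (While t c) p1 s1 p2 s2 \<Longrightarrow> exec x V (While t c) p s p2 s2"
  by (simp add: exec_def runs.While)

lemma rejects_Reject: "rejects x V Reject p s"
  by (simp add: rejects_def runs.Reject)

lemma rejects_Seq1: "rejects x V c p s \<Longrightarrow> rejects x V (c ;; d) p s"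
  by (simp add: rejects_def runs.Seq)

lemma rejects_Seq2: "exec x V c p s p1 s1 \<Longrightarrow> rejects x V d p1 s1 \<Longrightarrow> rejects x V (c ;; d) p s"
  by (simp add: rejects_def exec_def runs.Seq)

lemma rejects_If:
  "rejects x V (if holds t (input_read x (int p)) s then c else d) p s \<Longrightarrow> rejects x V (If t c d) p s"
  by (simp add: rejects_def runs.If)

lemma rejects_While1:
  "holds t (input_read x (int p)) s \<Longrightarrow> rejects x V c p s \<Longrightarrow> rejects x V (While t c) p s"
  by (simp add: rejects_def runs.While)

lemma rejects_While2:
  "holds t (input_read x (int p)) s \<Longrightarrow> exec x V c p s p1 s1 \<Longrightarrow> rejects x V (While t c) p1 s1 \<Longrightarrow>
    rejects x V (While t c) p s"
  by (simp add: rejects_def exec_def runs.While)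

primrec iter :: "nat \<Rightarrow> com \<Rightarrow> com" where
  "iter 0 c = Skip"
| "iter (Suc k) c = c ;; iter k c"

lemma exec_iter:
  assumes "\<And>i. i < n \<Longrightarrow> exec x V c p (st i) p (st (Suc i))"
  shows "exec x V (iter n c) p (st 0) p (st n)"
  using assms
proof (induction n arbitrary: st)
  case 0
  show ?case by (simp add: exec_Skip)
next
  case (Suc n)
  have "exec x V (iter n c) p (st (Suc 0)) p (st (Suc n))"
    using Suc.IH[of "\<lambda>i. st (Suc i)"] Suc.prems by simp
  then show ?case using Suc.prems[of 0] by (auto intro: exec_Seq)
qed

definition loop :: "nat \<Rightarrow> com \<Rightarrow> com" where
  "loop t c = While (Non_Zero t) (Dec t ;; c)"

text \<open>Here \<open>st i\<close> and \<open>p i\<close> describe the situation after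
  \<open>i\<close> rounds. Overwriting \<open>t\<close> frees \<open>st\<close> from tracking the
  loop counter, which is already \<open>n - Suc i\<close> inside round \<open>i\<close> because the
  decrement comes first.\<close>

lemma exec_loop:
  assumes body: "\<And>i. i < n \<Longrightarrow>
      exec x V c (p i) ((st i)(t := n - Suc i)) (p (Suc i)) ((st (Suc i))(t := n - Suc i))"
    and eqs: "s = (st 0)(t := n)" "s' = (st n)(t := 0)" "p0 = p 0" "p1 = p n"
  shows "exec x V (loop t c) p0 s p1 s'"
proof -
  have "exec x V (loop t c) (p i) ((st i)(t := n - i)) (p n) ((st n)(t := 0))" if "i \<le> n" for i
    using that
  proof (induction i rule: inc_induct)
    case base
    show ?case unfolding loop_def by (simp add: exec_While_False)
  next
    case (step i)
    have "exec x V (Dec t) (p i) ((st i)(t := n - i)) (p i) ((st i)(t := n - Suc i))"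
      using exec_Dec[of "(st i)(t := n - i)" t x V "p i"] step by simp
    then have "exec x V (Dec t ;; c) (p i) ((st i)(t := n - i)) (p (Suc i)) ((st (Suc i))(t := n - Suc i))"
      using body step exec_Seq by blast
    moreover have "holds (Non_Zero t) (input_read x (int (p i))) ((st i)(t := n - i))"
      using step.hyps by simp
    ultimately show ?case
      unfolding loop_def by (intro exec_While_True[OF _ _ step.IH[unfolded loop_def]])
  qed
  from this[of 0] show ?thesis by (simp add: eqs)
qed

abbreviation "clear t \<equiv> loop t Skip"

lemma exec_clear: "exec x V (clear t) p s p (s(t := 0))"
  by (rule exec_loop[where st = "\<lambda>_. s" and n = "s t" and p = "\<lambda>_. p"]) (auto simp: exec_Skip)

text \<open>A counter can be read only by counting it down, so \<open>r\<close> is poured into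
  \<open>d\<close> and the scratch counter \<open>t\<close> together and then restored from
  \<open>t\<close>.\<close>

definition add :: "nat \<Rightarrow> nat \<Rightarrow> nat \<Rightarrow> com" where
  "add t r d = loop r (Inc d ;; Inc t) ;; loop t (Inc r)"

lemma exec_add:
  assumes "r \<noteq> d" "r \<noteq> t" "d \<noteq> t" "s t = 0" "s d + s r \<le> V"
  shows "exec x V (add t r d) p s p (s(d := s d + s r))"
  unfolding add_def
proof (rule exec_Seq)
  let ?st = "\<lambda>i. s(d := s d + i, t := i)"
  show "exec x V (loop r (Inc d ;; Inc t)) p s p ((?st (s r))(r := 0))"
  proof (rule exec_loop[where st = ?st and n = "s r" and p = "\<lambda>_. p"])
    fix i assume i: "i < s r"
    show "exec x V (Inc d ;; Inc t) p ((?st i)(r := s r - Suc i)) p ((?st (Suc i))(r := s r - Suc i))"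
    proof (rule exec_Seq[OF exec_Inc])
      show "((?st i)(r := s r - Suc i)) d < V" using i assms by simp
      let ?s = "((?st i)(r := s r - Suc i))(d := Suc (((?st i)(r := s r - Suc i)) d))"
      have "exec x V (Inc t) p ?s p (?s(t := Suc (?s t)))"
        by (rule exec_Inc) (use i assms in auto)
      moreover have "?s(t := Suc (?s t)) = (?st (Suc i))(r := s r - Suc i)"
        using assms by (auto simp: fun_eq_iff)
      ultimately show "exec x V (Inc t) p ?s p ((?st (Suc i))(r := s r - Suc i))" by simp
    qed
  qed (use assms in \<open>auto simp: fun_eq_iff\<close>)
  let ?st' = "\<lambda>i. s(d := s d + s r, r := i)"
  show "exec x V (loop t (Inc r)) p ((?st (s r))(r := 0)) p (s(d := s d + s r))"
  proof (rule exec_loop[where st = ?st' and n = "s r" and p = "\<lambda>_. p"])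
    fix i assume i: "i < s r"
    let ?s = "(?st' i)(t := s r - Suc i)"
    have "exec x V (Inc r) p ?s p (?s(r := Suc (?s r)))"
      by (rule exec_Inc) (use i assms in auto)
    moreover have "?s(r := Suc (?s r)) = (?st' (Suc i))(t := s r - Suc i)"
      using assms by (auto simp: fun_eq_iff)
    ultimately show "exec x V (Inc r) p ?s p ((?st' (Suc i))(t := s r - Suc i))" by simp
  qed (use assms in \<open>auto simp: fun_eq_iff\<close>)
qed

lemma exec_eqI: "exec x V c p s p' s'' \<Longrightarrow> s'' = s' \<Longrightarrow> exec x V c p s p' s'"
  by simp

section \<open>Reading the input\<close>

lemma input_read_nth:
  "x = pre @ b # suf \<Longrightarrow> p = Suc (length pre) \<Longrightarrow> input_read x (int p) = Bit b"
  by (simp add: input_read_def)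

lemma input_read_end: "p = Suc (length x) \<Longrightarrow> input_read x (int p) = Right_End"
  by (simp add: input_read_def)

definition ones :: "com \<Rightarrow> com" where
  "ones c = While (At (Bit True)) (Fwd ;; c)"

lemma exec_ones:
  assumes x: "x = pre @ replicate n True @ rest" and rest: "rest = [] \<or> \<not> hd rest"
    and body: "\<And>i p. i < n \<Longrightarrow> exec x V c p (st i) p (st (Suc i))"
    and eqs: "p0 = Suc (length pre)" "p1 = Suc (length pre) + n" "s = st 0" "s' = st n"
  shows "exec x V (ones c) p0 s p1 s'"
proof -
  have "exec x V (ones c) (Suc (length pre) + i) (st i) (Suc (length pre) + n) (st n)" if "i \<le> n" for i
    using that
  proof (induction i rule: inc_induct)
    case base
    have "input_read x (int (Suc (length pre) + n)) \<noteq> Bit True"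
    proof (cases rest)
      case Nil
      then show ?thesis using x input_read_end[of "Suc (length pre) + n" x] by simp
    next
      case (Cons b bs)
      have "input_read x (int (Suc (length pre) + n)) = Bit b"
        by (rule input_read_nth[where pre = "pre @ replicate n True" and suf = bs]) (use x Cons in auto)
      then show ?thesis using rest Cons by simp
    qed
    then show ?case unfolding ones_def by (simp add: exec_While_False)
  next
    case (step i)
    have "replicate n True = replicate i True @ True # replicate (n - Suc i) True"
      using step.hyps by (metis Suc_diff_Suc replicate_Suc replicate_add le_add_diff_inverse less_imp_le)
    then have read: "input_read x (int (Suc (length pre) + i)) = Bit True"
      by (intro input_read_nth[where pre = "pre @ replicate i True"
            and suf = "replicate (n - Suc i) True @ rest"]) (use x in auto)
    have "exec x V (Fwd ;; c) (Suc (length pre) + i) (st i) (Suc (length pre) + Suc i) (st (Suc i))"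
    proof (rule exec_Seq)
      show "exec x V Fwd (Suc (length pre) + i) (st i) (Suc (length pre) + Suc i) (st i)"
        using exec_Fwd[of "Suc (length pre) + i" x V "st i"] step.hyps x by simp
    qed (use body step.hyps in blast)
    then show ?case
      using step.IH read unfolding ones_def by (auto intro: exec_While_True)
  qed
  from this[of 0] show ?thesis by (simp add: eqs)
qed

lemma split_ones: "\<exists>n rest. xs = replicate n True @ rest \<and> (rest = [] \<or> \<not> hd rest)"
proof (induction xs)
  case Nil
  show ?case by (intro exI[of _ 0] exI[of _ "[]"]) simp
next
  case (Cons b xs)
  then obtain n rest where *: "xs = replicate n True @ rest" "rest = [] \<or> \<not> hd rest" by blast
  show ?case
  proof (cases b)
    case True
    then show ?thesis using * by (intro exI[of _ "Suc n"] exI[of _ rest]) simp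
  next
    case False
    then show ?thesis by (intro exI[of _ 0] exI[of _ "b # xs"]) simp
  qed
qed

section \<open>Syntax check of the input\<close>

text \<open>A set sign bit must be followed by a 1, since \<open>encode_int\<close> never writes
  zero as a negative number.\<close>

definition check_int :: com where
  "check_int =
     If (At (Bit True)) (Fwd ;; If (At (Bit True)) Skip Reject)
       (If (At (Bit False)) Fwd Reject) ;;
     ones Skip ;; If (At (Bit False)) Fwd Reject"

lemma check_int_accepts:
  assumes x: "x = pre @ encode_int z @ suf"
  shows "exec x V check_int (Suc (length pre)) s (Suc (length (pre @ encode_int z))) s"
proof -
  let ?n = "nat \<bar>z\<bar>"
  have x': "x = pre @ (z < 0) # replicate ?n True @ False # suf"
    using x by (simp add: encode_int_def)
  have read: "input_read x (int (Suc (length pre))) = Bit (z < 0)"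
    by (rule input_read_nth[OF x']) simp
  have fwd: "exec x V Fwd (Suc (length pre)) s (Suc (Suc (length pre))) s"
    by (rule exec_Fwd) (simp add: x')
  have 1: "exec x V (If (At (Bit True)) (Fwd ;; If (At (Bit True)) Skip Reject)
      (If (At (Bit False)) Fwd Reject)) (Suc (length pre)) s (Suc (Suc (length pre))) s"
  proof (cases "z < 0")
    case True
    then obtain j where j: "?n = Suc j" by (metis gr0_implies_Suc zero_less_nat_eq zero_less_abs_iff less_irrefl)
    have "input_read x (int (Suc (Suc (length pre)))) = Bit True"
      by (rule input_read_nth[where pre = "pre @ [True]" and suf = "replicate j True @ False # suf"])
         (use True j in \<open>simp_all add: x'\<close>)
    then show ?thesis
      using True read fwd by (intro exec_If) (auto intro!: exec_Seq[OF fwd] exec_If exec_Skip)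
  next
    case False
    then show ?thesis using read fwd by (intro exec_If) (auto intro!: exec_If)
  qed
  have 2: "exec x V (ones Skip) (Suc (Suc (length pre))) s (Suc (Suc (length pre)) + ?n) s"
    by (rule exec_ones[where pre = "pre @ [z < 0]" and rest = "False # suf" and st = "\<lambda>_. s" and n = ?n])
       (auto simp: x' exec_Skip)
  have read: "input_read x (int (Suc (Suc (length pre)) + ?n)) = Bit False"
    by (rule input_read_nth[where pre = "pre @ (z < 0) # replicate ?n True" and suf = suf]) (simp_all add: x')
  have "exec x V Fwd (Suc (Suc (length pre)) + ?n) s (Suc (Suc (Suc (length pre)) + ?n)) s"
    by (rule exec_Fwd) (simp add: x')
  then have 3: "exec x V (If (At (Bit False)) Fwd Reject) (Suc (Suc (length pre)) + ?n) s
      (Suc (length (pre @ encode_int z))) s"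
    using read by (intro exec_If) (simp add: encode_int_def)
  show ?thesis
    unfolding check_int_def using 1 2 3 by (blast intro: exec_Seq)
qed

text \<open>Splitting off the maximal block of ones after the sign bit leaves three failures: no bit
  at all, a set sign bit without ones, or a missing delimiter at the end of the input.\<close>

lemma check_int_rejects:
  assumes x: "x = pre @ suf" and no: "\<nexists>z suf'. suf = encode_int z @ suf'"
  shows "rejects x V check_int (Suc (length pre)) s"
proof -
  let ?first = "If (At (Bit True)) (Fwd ;; If (At (Bit True)) Skip Reject)
      (If (At (Bit False)) Fwd Reject)"
  show ?thesis
  proof (cases suf)
    case Nil
    then have "input_read x (int (Suc (length pre))) = Right_End"
      using x by (intro input_read_end) simp
    then show ?thesis
      unfolding check_int_def
      by (intro rejects_Seq1 rejects_If) (auto intro!: rejects_If rejects_Reject)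
  next
    case (Cons b suf')
    obtain n rest where suf': "suf' = replicate n True @ rest" "rest = [] \<or> \<not> hd rest"
      using split_ones by blast
    have x': "x = pre @ b # replicate n True @ rest" using x Cons suf' by simp
    have read: "input_read x (int (Suc (length pre))) = Bit b"
      by (rule input_read_nth[OF x']) simp
    have fwd: "exec x V Fwd (Suc (length pre)) s (Suc (Suc (length pre))) s"
      by (rule exec_Fwd) (simp add: x')
    show ?thesis
    proof (cases "b \<and> n = 0")
      case True
      have "input_read x (int (Suc (Suc (length pre)))) \<noteq> Bit True"
      proof (cases rest)
        case Nil
        then show ?thesis using x' True input_read_end[of "Suc (Suc (length pre))" x] by simp
      next
        case (Cons a list)
        have "input_read x (int (Suc (Suc (length pre)))) = Bit a"
          by (rule input_read_nth[where pre = "pre @ [b]" and suf = list]) (use x' True Cons in auto)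
        then show ?thesis using suf' Cons by simp
      qed
      then show ?thesis
        unfolding check_int_def using read True
        by (intro rejects_Seq1 rejects_If) (auto intro!: rejects_Seq2[OF fwd] rejects_If rejects_Reject)
    next
      case False
      have 1: "exec x V ?first (Suc (length pre)) s (Suc (Suc (length pre))) s"
      proof (cases b)
        case True
        with False obtain j where j: "n = Suc j" by (cases n) auto
        have "input_read x (int (Suc (Suc (length pre)))) = Bit True"
          by (rule input_read_nth[where pre = "pre @ [True]" and suf = "replicate j True @ rest"])
             (use True in \<open>simp_all add: x' j\<close>)
        then show ?thesis
          using True read fwd by (intro exec_If) (auto intro!: exec_Seq[OF fwd] exec_If exec_Skip)
      next
        case False
        then show ?thesis using read fwd by (intro exec_If) (auto intro!: exec_If)
      qed
      have 2: "exec x V (ones Skip) (Suc (Suc (length pre))) s (Suc (Suc (length pre)) + n) s"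
        by (rule exec_ones[where pre = "pre @ [b]" and rest = rest and st = "\<lambda>_. s" and n = n])
           (use suf' in \<open>auto simp: x' exec_Skip\<close>)
      have "rest = []"
      proof (rule ccontr)
        assume "rest \<noteq> []"
        then obtain rest' where r: "rest = False # rest'" using suf' by (cases rest) auto
        have "suf = encode_int (if b then - int n else int n) @ rest'"
          using Cons suf' r False by (auto simp: encode_int_def)
        then show False using no by blast
      qed
      then have "input_read x (int (Suc (Suc (length pre)) + n)) = Right_End"
        by (intro input_read_end) (simp add: x')
      then show ?thesis
        unfolding check_int_def
        by (intro rejects_Seq2[OF 1] rejects_Seq2[OF 2] rejects_If) (simp add: rejects_Reject)
    qed
  qed
qed

abbreviation encode_ints :: "int list \<Rightarrow> bool list" where
  "encode_ints zs \<equiv> concat (map encode_int zs)"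

lemma check_ints_accepts:
  assumes "x = pre @ encode_ints zs @ suf"
  shows "exec x V (iter (length zs) check_int) (Suc (length pre)) s
    (Suc (length (pre @ encode_ints zs))) s"
  using assms
proof (induction zs arbitrary: pre)
  case Nil
  show ?case by (simp add: exec_Skip)
next
  case (Cons z zs)
  have 1: "exec x V check_int (Suc (length pre)) s (Suc (length (pre @ encode_int z))) s"
    by (rule check_int_accepts) (use Cons.prems in simp)
  have "exec x V (iter (length zs) check_int) (Suc (length (pre @ encode_int z))) s
      (Suc (length ((pre @ encode_int z) @ encode_ints zs))) s"
    by (rule Cons.IH) (use Cons.prems in simp)
  with 1 show ?case by (auto intro: exec_Seq)
qed

lemma check_ints_rejects:
  assumes "x = pre @ suf" "\<nexists>zs suf'. length zs = n \<and> suf = encode_ints zs @ suf'"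
  shows "rejects x V (iter n check_int) (Suc (length pre)) s"
  using assms
proof (induction n arbitrary: pre suf)
  case 0
  then show ?case by auto
next
  case (Suc n)
  show ?case
  proof (cases "\<exists>z suf'. suf = encode_int z @ suf'")
    case False
    then have "rejects x V check_int (Suc (length pre)) s"
      using check_int_rejects Suc.prems(1) by blast
    then show ?thesis by (simp add: rejects_Seq1)
  next
    case True
    then obtain z suf' where suf: "suf = encode_int z @ suf'" by blast
    have 1: "exec x V check_int (Suc (length pre)) s (Suc (length (pre @ encode_int z))) s"
      by (rule check_int_accepts) (use Suc.prems(1) suf in simp)
    have "\<nexists>zs suf''. length zs = n \<and> suf' = encode_ints zs @ suf''"
    proof
      assume "\<exists>zs suf''. length zs = n \<and> suf' = encode_ints zs @ suf''"
      then obtain zs suf'' where "length zs = n" "suf' = encode_ints zs @ suf''" by blast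
      then have "length (z # zs) = Suc n \<and> suf = encode_ints (z # zs) @ suf''" using suf by simp
      then show False using Suc.prems(2) by blast
    qed
    then have "rejects x V (iter n check_int) (Suc (length (pre @ encode_int z))) s"
      by (intro Suc.IH) (use Suc.prems(1) suf in simp_all)
    then show ?thesis using 1 by (simp add: rejects_Seq2)
  qed
qed

text \<open>Applied with \<open>Suc n\<close>: \<open>n * m\<close> coefficients and
  \<open>m\<close> bounds form \<open>m\<close> groups of \<open>Suc n\<close> numbers, so
  \<open>r\<close> ends up as the number of inequalities, although the groups are not the
  rows.\<close>

definition check_input :: "nat \<Rightarrow> nat \<Rightarrow> com" where
  "check_input n r = Fwd ;; While (Not_At Right_End) (iter n check_int ;; Inc r)"

lemma length_encode_ints_ge: "length zs \<le> length (encode_ints zs)"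
  by (induction zs) (auto simp: encode_int_def)

lemma check_rows_accepts:
  assumes "0 < n" "x = pre @ encode_ints zs" "length zs = n * m" "s r + m \<le> V"
  shows "exec x V (While (Not_At Right_End) (iter n check_int ;; Inc r)) (Suc (length pre)) s
    (Suc (length x)) (s(r := s r + m))"
  using assms(2-)
proof (induction m arbitrary: pre zs s)
  case 0
  then have "input_read x (int (Suc (length pre))) = Right_End"
    by (intro input_read_end) simp
  then show ?case using 0 by (auto intro: exec_While_False)
next
  case (Suc m)
  let ?ys = "take n zs" and ?zs = "drop n zs"
  have split: "encode_ints zs = encode_ints ?ys @ encode_ints ?zs"
    by (metis append_take_drop_id concat_append map_append)
  have len: "length ?ys = n" "length ?zs = n * m" using Suc.prems by auto
  have "0 < length zs" using Suc.prems(2) assms(1) by simp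
  then have "0 < length (encode_ints zs)" using length_encode_ints_ge[of zs] by linarith
  then have ne: "encode_ints zs \<noteq> []" by (rule length_greater_0_conv[THEN iffD1])
  have "input_read x (int (Suc (length pre))) = Bit (hd (encode_ints zs))"
    by (rule input_read_nth[where pre = pre and suf = "tl (encode_ints zs)"])
       (use Suc.prems(1) ne in simp_all)
  then have h: "holds (Not_At Right_End) (input_read x (int (Suc (length pre)))) s" by simp
  have 1: "exec x V (iter n check_int) (Suc (length pre)) s (Suc (length (pre @ encode_ints ?ys))) s"
    using check_ints_accepts[of x pre ?ys "encode_ints ?zs" V s] Suc.prems(1) len split by simp
  have 2: "exec x V (Inc r) (Suc (length (pre @ encode_ints ?ys))) s
      (Suc (length (pre @ encode_ints ?ys))) (s(r := Suc (s r)))"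
    by (rule exec_Inc) (use Suc.prems in simp)
  have "exec x V (While (Not_At Right_End) (iter n check_int ;; Inc r))
      (Suc (length (pre @ encode_ints ?ys))) (s(r := Suc (s r)))
      (Suc (length x)) ((s(r := Suc (s r)))(r := (s(r := Suc (s r))) r + m))"
    by (rule Suc.IH[where zs = ?zs]) (use Suc.prems len split in simp_all)
  then show ?case
    by (intro exec_eqI[OF exec_While_True[OF h exec_Seq[OF 1 2]]]) (auto simp: fun_eq_iff)
qed

text \<open>A successful round consumes at least one bit, so \<open>length suf\<close> decreases; it
  also bounds how often \<open>r\<close> is incremented.\<close>

lemma check_rows_rejects:
  assumes "0 < n" "x = pre @ suf" "\<nexists>zs. n dvd length zs \<and> suf = encode_ints zs"
    and "s r + length suf \<le> V"
  shows "rejects x V (While (Not_At Right_End) (iter n check_int ;; Inc r)) (Suc (length pre)) s"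
  using assms(2-)
proof (induction "length suf" arbitrary: pre suf s rule: less_induct)
  case less
  have ne: "suf \<noteq> []"
  proof
    assume "suf = []"
    then have "n dvd length ([] :: int list) \<and> suf = encode_ints []" by simp
    with less.prems(2) show False by blast
  qed
  have "input_read x (int (Suc (length pre))) = Bit (hd suf)"
    by (rule input_read_nth[where pre = pre and suf = "tl suf"]) (use less.prems(1) ne in simp_all)
  then have h: "holds (Not_At Right_End) (input_read x (int (Suc (length pre)))) s" by simp
  show ?case
  proof (cases "\<exists>zs suf'. length zs = n \<and> suf = encode_ints zs @ suf'")
    case False
    then have "rejects x V (iter n check_int) (Suc (length pre)) s"
      using check_ints_rejects less.prems(1) by blast
    then show ?thesis by (intro rejects_While1[OF h] rejects_Seq1)
  next
    case True
    then obtain zs suf' where zs: "length zs = n" "suf = encode_ints zs @ suf'" by blast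
    have "length suf = length (encode_ints zs) + length suf'" by (simp only: zs length_append)
    then have lt: "length suf' < length suf"
      using zs(1) length_encode_ints_ge[of zs] assms(1) by linarith
    have 1: "exec x V (iter n check_int) (Suc (length pre)) s (Suc (length (pre @ encode_ints zs))) s"
      using check_ints_accepts[of x pre zs suf' V s] less.prems(1) zs by simp
    have 2: "exec x V (Inc r) (Suc (length (pre @ encode_ints zs))) s
        (Suc (length (pre @ encode_ints zs))) (s(r := Suc (s r)))"
      by (rule exec_Inc) (use less.prems(3) lt in simp)
    have "\<nexists>ys. n dvd length ys \<and> suf' = encode_ints ys"
    proof
      assume "\<exists>ys. n dvd length ys \<and> suf' = encode_ints ys"
      then obtain ys where "n dvd length ys" "suf' = encode_ints ys" by blast
      then have "n dvd length (zs @ ys) \<and> suf = encode_ints (zs @ ys)" using zs by simp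
      then show False using less.prems(2) by blast
    qed
    then have "rejects x V (While (Not_At Right_End) (iter n check_int ;; Inc r))
        (Suc (length (pre @ encode_ints zs))) (s(r := Suc (s r)))"
    proof (intro less.hyps[OF lt])
      show "(s(r := Suc (s r))) r + length suf' \<le> V" using less.prems(3) lt by simp
    qed (use less.prems(1) zs in simp_all)
    then show ?thesis by (intro rejects_While2[OF h exec_Seq[OF 1 2]])
  qed
qed

lemma check_input_accepts:
  assumes "0 < n" "x = encode_ints zs" "length zs = n * m" "s r + m \<le> V"
  shows "exec x V (check_input n r) 0 s (Suc (length x)) (s(r := s r + m))"
  unfolding check_input_def
  using exec_Seq[OF exec_Fwd check_rows_accepts[of n x "[]" zs m s r V]] assms by simp

lemma check_input_rejects:
  assumes "0 < n" "\<nexists>zs. n dvd length zs \<and> x = encode_ints zs" "s r + length x \<le> V"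
  shows "rejects x V (check_input n r) 0 s"
  unfolding check_input_def
  using rejects_Seq2[OF exec_Fwd check_rows_rejects[of n x "[]" x s r V]] assms by simp

section \<open>Evaluating the inequalities\<close>

abbreviation (input) "r_tmp \<equiv> 2 :: nat"
abbreviation (input) "r_skip \<equiv> 3 :: nat"
abbreviation (input) "r_base \<equiv> 4 :: nat"
abbreviation (input) "r_prod \<equiv> 5 :: nat"
abbreviation (input) "r_K \<equiv> 6 :: nat"
abbreviation (input) "r_rows \<equiv> 7 :: nat"
abbreviation (input) "r_rem \<equiv> 8 :: nat"
abbreviation (input) "r_ia \<equiv> 9 :: nat"
abbreviation (input) "r_ib \<equiv> 10 :: nat"
abbreviation (input) "r_lhs \<equiv> 11 :: nat"
abbreviation (input) "r_rhs \<equiv> 12 :: nat"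
abbreviation (input) "r_viol \<equiv> 13 :: nat"
abbreviation (input) "r_one \<equiv> 14 :: nat"
abbreviation (input) "r_zero \<equiv> 15 :: nat"
abbreviation (input) "r_good \<equiv> 16 :: nat"
abbreviation (input) "r_width \<equiv> 17 :: nat"

text \<open>The shifted coordinate \<open>j\<close> lives in \<open>r_u j\<close> and its loop
  counter in \<open>r_c j\<close>; interleaving keeps both families disjoint from each other and
  from the fixed registers in any dimension.\<close>

definition r_u :: "nat \<Rightarrow> nat" where "r_u j = 20 + 2 * j"
definition r_c :: "nat \<Rightarrow> nat" where "r_c j = 21 + 2 * j"

lemma r_u_r_c_simps [simp]:
  "r_u i = r_u j \<longleftrightarrow> i = j" "r_c i = r_c j \<longleftrightarrow> i = j" "r_u i \<noteq> r_c j" "r_c i \<noteq> r_u j"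
  "r < 20 \<Longrightarrow> r \<noteq> r_u j" "r < 20 \<Longrightarrow> r_u j \<noteq> r" "r < 20 \<Longrightarrow> r \<noteq> r_c j" "r < 20 \<Longrightarrow> r_c j \<noteq> r"
  unfolding r_u_def r_c_def by presburger+

definition skip_int :: com where
  "skip_int = (Fwd ;; ones Skip) ;; Fwd"

text \<open>Entries are addressed by index: starting at the left end, that many numbers are skipped,
  counted on a copy of the index.\<close>

definition go_to :: "nat \<Rightarrow> com" where
  "go_to r = Rewind ;; Fwd ;; add r_tmp r r_skip ;; loop r_skip skip_int"

text \<open>For the entry \<open>z\<close> under the head, \<open>r_lhs - r_rhs\<close> changes by
  \<open>z\<close> times the difference of the contents of \<open>X\<close> and \<open>Y\<close>;
  the sign bit decides which side receives which summand. A coefficient is paired with a coordinate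
  and \<open>K\<close>, a bound with 0 and 1, which contributes minus the bound.\<close>

definition acc :: "nat \<Rightarrow> nat \<Rightarrow> com" where
  "acc X Y =
     If (At (Bit True)) (Fwd ;; ones (add r_tmp X r_rhs ;; add r_tmp Y r_lhs))
       (Fwd ;; ones (add r_tmp X r_lhs ;; add r_tmp Y r_rhs)) ;;
     Rewind"

definition item :: "nat \<Rightarrow> nat \<Rightarrow> nat \<Rightarrow> com" where
  "item r X Y = go_to r ;; acc X Y ;; Inc r"

primrec row_a :: "nat \<Rightarrow> com" where
  "row_a 0 = Skip"
| "row_a (Suc j) = row_a j ;; item r_ia (r_u j) r_K"

definition row_b :: "bool \<Rightarrow> com" where
  "row_b wb = (if wb then item r_ib r_zero r_one else Skip)"

text \<open>Truncated subtraction is positive exactly for a violated inequality, so its sum in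
  \<open>r_viol\<close> tests all rows at once.\<close>

definition compare :: com where
  "compare = loop r_lhs (If (Non_Zero r_rhs) (Dec r_rhs) (Inc r_viol)) ;; clear r_rhs"

text \<open>The flag \<open>wb\<close> chooses between \<open>A y \<le> b\<close> and the
  homogeneous system. The bounds follow all coefficients, so \<open>r_ib\<close> has to start at
  \<open>n * m\<close>, obtained by adding the row count \<open>n\<close> times.\<close>

definition test_rows :: "nat \<Rightarrow> bool \<Rightarrow> com" where
  "test_rows n wb =
     add r_tmp r_rows r_rem ;; iter n (add r_tmp r_rows r_ib) ;;
     loop r_rem (row_a n ;; row_b wb ;; compare) ;; clear r_ia ;; clear r_ib"

definition pos :: "int list \<Rightarrow> nat \<Rightarrow> nat" where
  "pos zs i = Suc (length (encode_ints (take i zs)))"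

lemma split_input:
  "i < length zs \<Longrightarrow>
    encode_ints zs = encode_ints (take i zs) @ encode_int (zs ! i) @ encode_ints (drop (Suc i) zs)"
  by (subst id_take_nth_drop[of i zs], assumption) simp

lemma pos_Suc: "i < length zs \<Longrightarrow> pos zs (Suc i) = pos zs i + (nat \<bar>zs ! i\<bar> + 2)"
  by (simp add: pos_def take_Suc_conv_app_nth encode_int_def)

lemma exec_sign_ones:
  assumes x: "x = encode_ints zs" and i: "i < length zs"
    and body: "\<And>j p. j < nat \<bar>zs ! i\<bar> \<Longrightarrow> exec x V c p (st j) p (st (Suc j))"
  shows "exec x V (Fwd ;; ones c) (pos zs i) (st 0) (pos zs i + Suc (nat \<bar>zs ! i\<bar>)) (st (nat \<bar>zs ! i\<bar>))"
proof (rule exec_Seq)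
  let ?pre = "encode_ints (take i zs)" and ?suf = "encode_ints (drop (Suc i) zs)"
  let ?z = "zs ! i"
  have x': "x = ?pre @ (?z < 0) # replicate (nat \<bar>?z\<bar>) True @ False # ?suf"
    using split_input[OF i] x by (simp add: encode_int_def)
  show "exec x V Fwd (pos zs i) (st 0) (Suc (pos zs i)) (st 0)"
    by (rule exec_Fwd) (simp add: x' pos_def)
  show "exec x V (ones c) (Suc (pos zs i)) (st 0) (pos zs i + Suc (nat \<bar>?z\<bar>)) (st (nat \<bar>?z\<bar>))"
    by (rule exec_ones[where pre = "?pre @ [?z < 0]" and rest = "False # ?suf" and st = st
          and n = "nat \<bar>?z\<bar>"]) (use x' body in \<open>auto simp: pos_def\<close>)
qed

lemma input_read_sign:
  assumes "x = encode_ints zs" "i < length zs"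
  shows "input_read x (int (pos zs i)) = Bit (zs ! i < 0)"
  by (rule input_read_nth[where pre = "encode_ints (take i zs)"])
     (use split_input[OF assms(2)] assms(1) in \<open>auto simp: encode_int_def pos_def\<close>)

lemma exec_skip_int:
  assumes x: "x = encode_ints zs" and i: "i < length zs"
  shows "exec x V skip_int (pos zs i) s (pos zs (Suc i)) s"
  unfolding skip_int_def
proof (rule exec_Seq)
  show "exec x V (Fwd ;; ones Skip) (pos zs i) s (pos zs i + Suc (nat \<bar>zs ! i\<bar>)) s"
    using exec_sign_ones[OF x i, where st = "\<lambda>_. s"] exec_Skip by blast
  have "length x = length (encode_ints (take i zs)) + length (encode_int (zs ! i)) +
      length (encode_ints (drop (Suc i) zs))"
    by (simp only: x split_input[OF i] length_append add.assoc)
  then have "pos zs i + Suc (nat \<bar>zs ! i\<bar>) \<le> length x"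
    by (simp add: pos_def encode_int_def)
  then show "exec x V Fwd (pos zs i + Suc (nat \<bar>zs ! i\<bar>)) s (pos zs (Suc i)) s"
    using exec_Fwd[of "pos zs i + Suc (nat \<bar>zs ! i\<bar>)" x V s] by (simp add: pos_Suc[OF i])
qed

lemma exec_go_to:
  assumes x: "x = encode_ints zs" and "s r_tmp = 0" "s r_skip = 0" "s r \<le> length zs" "s r \<le> V"
    and r: "r \<noteq> r_tmp" "r \<noteq> r_skip"
  shows "exec x V (go_to r) p s (pos zs (s r)) s"
  unfolding go_to_def
proof (intro exec_Seq)
  show "exec x V Rewind p s 0 s" by (rule exec_Rewind)
  show "exec x V Fwd 0 s 1 s" using exec_Fwd[of 0 x V s] by simp
  have "exec x V (add r_tmp r r_skip) 1 s 1 (s(r_skip := s r_skip + s r))"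
    by (rule exec_add) (use assms in auto)
  then show "exec x V (add r_tmp r r_skip) 1 s 1 (s(r_skip := s r))"
    using assms by simp
  show "exec x V (loop r_skip skip_int) 1 (s(r_skip := s r)) (pos zs (s r)) s"
  proof (rule exec_loop[where st = "\<lambda>_. s" and p = "pos zs" and n = "s r"])
    show "exec x V skip_int (pos zs i) (s(r_skip := s r - Suc i)) (pos zs (Suc i)) (s(r_skip := s r - Suc i))"
      if "i < s r" for i
      by (rule exec_skip_int) (use x that assms in auto)
  qed (use assms in \<open>auto simp: pos_def fun_eq_iff\<close>)
qed

lemma exec_acc:
  assumes x: "x = encode_ints zs" and i: "i < length zs"
    and tmp: "s r_tmp = 0" and XY: "X \<notin> {r_tmp, r_lhs, r_rhs}" "Y \<notin> {r_tmp, r_lhs, r_rhs}"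
    and b: "s r_lhs + nat \<bar>zs ! i\<bar> * B \<le> V" "s r_rhs + nat \<bar>zs ! i\<bar> * B \<le> V" "s X \<le> B" "s Y \<le> B"
  shows "exec x V (acc X Y) (pos zs i) s 0
    (s(r_lhs := s r_lhs + (nat (zs ! i) * s X + nat (- (zs ! i)) * s Y),
       r_rhs := s r_rhs + (nat (zs ! i) * s Y + nat (- (zs ! i)) * s X)))"
proof -
  let ?z = "zs ! i" and ?k = "nat \<bar>zs ! i\<bar>"
  have body: "exec x V (add r_tmp P R ;; add r_tmp Q S) p
      (s(R := s R + j * s P, S := s S + j * s Q)) p
      (s(R := s R + Suc j * s P, S := s S + Suc j * s Q))"
    if j: "j < ?k" and PQ: "P \<notin> {r_tmp, r_lhs, r_rhs}" "Q \<notin> {r_tmp, r_lhs, r_rhs}" "s P \<le> B" "s Q \<le> B"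
      and RS: "R = r_lhs \<and> S = r_rhs \<or> R = r_rhs \<and> S = r_lhs" for P Q R S j p
  proof -
    let ?s = "s(R := s R + j * s P, S := s S + j * s Q)"
    have neq: "P \<noteq> R" "P \<noteq> S" "Q \<noteq> R" "Q \<noteq> S" "R \<noteq> S" "R \<noteq> r_tmp" "S \<noteq> r_tmp" "P \<noteq> r_tmp" "Q \<noteq> r_tmp"
      using PQ RS by auto
    have "Suc j * v \<le> ?k * B" if "v \<le> B" for v
      using j that by (intro mult_le_mono) auto
    then have le: "s R + Suc j * s P \<le> V" "s S + Suc j * s Q \<le> V"
      using b(1,2) RS PQ(3,4) by (metis add_left_mono order_trans)+
    have 1: "exec x V (add r_tmp P R) p ?s p (?s(R := ?s R + ?s P))"
      by (rule exec_add) (use neq tmp le in auto)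
    have 2: "exec x V (add r_tmp Q S) p (?s(R := ?s R + ?s P)) p
        ((?s(R := ?s R + ?s P))(S := (?s(R := ?s R + ?s P)) S + (?s(R := ?s R + ?s P)) Q))"
      by (rule exec_add) (use neq tmp le in auto)
    show ?thesis
      by (rule exec_eqI[OF exec_Seq[OF 1 2]]) (use neq in \<open>auto simp: fun_eq_iff\<close>)
  qed
  have "exec x V (If (At (Bit True)) (Fwd ;; ones (add r_tmp X r_rhs ;; add r_tmp Y r_lhs))
       (Fwd ;; ones (add r_tmp X r_lhs ;; add r_tmp Y r_rhs))) (pos zs i) s (pos zs i + Suc ?k)
    (s(r_lhs := s r_lhs + (nat ?z * s X + nat (- ?z) * s Y),
       r_rhs := s r_rhs + (nat ?z * s Y + nat (- ?z) * s X)))"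
  proof (cases "?z < 0")
    case True
    have "exec x V (Fwd ;; ones (add r_tmp X r_rhs ;; add r_tmp Y r_lhs)) (pos zs i)
        (s(r_rhs := s r_rhs + 0 * s X, r_lhs := s r_lhs + 0 * s Y)) (pos zs i + Suc ?k)
        (s(r_rhs := s r_rhs + ?k * s X, r_lhs := s r_lhs + ?k * s Y))"
      by (rule exec_sign_ones[OF x i, where st = "\<lambda>j. s(r_rhs := s r_rhs + j * s X, r_lhs := s r_lhs + j * s Y)"],
          rule body) (use XY b in auto)
    then have "exec x V (Fwd ;; ones (add r_tmp X r_rhs ;; add r_tmp Y r_lhs)) (pos zs i)
        s (pos zs i + Suc ?k)
        (s(r_rhs := s r_rhs + ?k * s X, r_lhs := s r_lhs + ?k * s Y))"
      by simp
    then have "exec x V (Fwd ;; ones (add r_tmp X r_rhs ;; add r_tmp Y r_lhs)) (pos zs i)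
        s (pos zs i + Suc ?k)
        (s(r_lhs := s r_lhs + (nat ?z * s X + nat (- ?z) * s Y),
           r_rhs := s r_rhs + (nat ?z * s Y + nat (- ?z) * s X)))"
      by (rule exec_eqI) (use True in \<open>simp add: fun_eq_iff\<close>)
    then show ?thesis
      using True input_read_sign[OF x i] by (intro exec_If) simp
  next
    case False
    have "exec x V (Fwd ;; ones (add r_tmp X r_lhs ;; add r_tmp Y r_rhs)) (pos zs i)
        (s(r_lhs := s r_lhs + 0 * s X, r_rhs := s r_rhs + 0 * s Y)) (pos zs i + Suc ?k)
        (s(r_lhs := s r_lhs + ?k * s X, r_rhs := s r_rhs + ?k * s Y))"
      by (rule exec_sign_ones[OF x i, where st = "\<lambda>j. s(r_lhs := s r_lhs + j * s X, r_rhs := s r_rhs + j * s Y)"],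
          rule body) (use XY b in auto)
    then have "exec x V (Fwd ;; ones (add r_tmp X r_lhs ;; add r_tmp Y r_rhs)) (pos zs i)
        s (pos zs i + Suc ?k)
        (s(r_lhs := s r_lhs + ?k * s X, r_rhs := s r_rhs + ?k * s Y))"
      by simp
    then have "exec x V (Fwd ;; ones (add r_tmp X r_lhs ;; add r_tmp Y r_rhs)) (pos zs i)
        s (pos zs i + Suc ?k)
        (s(r_lhs := s r_lhs + (nat ?z * s X + nat (- ?z) * s Y),
           r_rhs := s r_rhs + (nat ?z * s Y + nat (- ?z) * s X)))"
      by (rule exec_eqI) (use False in \<open>simp add: fun_eq_iff\<close>)
    then show ?thesis
      using False input_read_sign[OF x i] by (intro exec_If) simp
  qed
  from exec_Seq[OF this exec_Rewind] show ?thesis by (simp add: acc_def)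
qed

lemma exec_item:
  assumes x: "x = encode_ints zs" and i: "s r < length zs" "s r < V"
    and 0: "s r_tmp = 0" "s r_skip = 0" and XY: "X \<notin> {r_tmp, r_lhs, r_rhs}" "Y \<notin> {r_tmp, r_lhs, r_rhs}"
    and r: "r \<notin> {r_tmp, r_skip, r_lhs, r_rhs}"
    and b: "s r_lhs + nat \<bar>zs ! s r\<bar> * B \<le> V" "s r_rhs + nat \<bar>zs ! s r\<bar> * B \<le> V" "s X \<le> B" "s Y \<le> B"
  shows "exec x V (item r X Y) p s 0
    (s(r_lhs := s r_lhs + (nat (zs ! s r) * s X + nat (- (zs ! s r)) * s Y),
       r_rhs := s r_rhs + (nat (zs ! s r) * s Y + nat (- (zs ! s r)) * s X), r := Suc (s r)))"
    (is "exec x V _ p s 0 (?s(r := _))")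
  unfolding item_def
proof (intro exec_Seq)
  show "exec x V (go_to r) p s (pos zs (s r)) s"
    by (rule exec_go_to) (use assms in auto)
  show "exec x V (acc X Y) (pos zs (s r)) s 0 ?s"
    by (rule exec_acc[OF x i(1) 0(1) XY b])
  have "exec x V (Inc r) 0 ?s 0 (?s(r := Suc (?s r)))"
    by (rule exec_Inc) (use i r in auto)
  then show "exec x V (Inc r) 0 ?s 0 (?s(r := Suc (s r)))" using r by simp
qed

text \<open>Together with \<open>part_rhs\<close>, the sum of the terms \<open>z * (w t - K)\<close>
  over the first \<open>j\<close> entries of a row, separated into two nonnegative sides as
  \<open>acc\<close> accumulates them; \<open>a\<close> is the index where the row begins.\<close>

definition part_lhs :: "int list \<Rightarrow> nat \<Rightarrow> (nat \<Rightarrow> nat) \<Rightarrow> nat \<Rightarrow> nat \<Rightarrow> nat" where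
  "part_lhs zs K w a j = (\<Sum>t<j. nat (zs ! (a + t)) * w t + nat (- (zs ! (a + t))) * K)"

definition part_rhs :: "int list \<Rightarrow> nat \<Rightarrow> (nat \<Rightarrow> nat) \<Rightarrow> nat \<Rightarrow> nat \<Rightarrow> nat" where
  "part_rhs zs K w a j = (\<Sum>t<j. nat (zs ! (a + t)) * K + nat (- (zs ! (a + t))) * w t)"

lemma abs_nth_le_length: "i < length zs \<Longrightarrow> nat \<bar>zs ! i\<bar> \<le> length (encode_ints zs)"
  by (subst split_input) (auto simp: encode_int_def)

text \<open>At most one of \<open>nat z\<close> and \<open>nat (- z)\<close> is nonzero, so a single
  product bounds the sum.\<close>

lemma weighted_le:
  assumes "nat \<bar>z\<bar> \<le> L" "p \<le> B" "q \<le> B"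
  shows "nat z * p + nat (- z) * q \<le> L * B"
proof (cases "0 \<le> z")
  case True
  then show ?thesis using assms by (auto intro: mult_le_mono)
next
  case False
  then show ?thesis using assms by (auto intro: mult_le_mono)
qed

lemma part_le:
  assumes "a + j \<le> length zs" "\<forall>t<j. w t \<le> B" "K \<le> B"
  shows "part_lhs zs K w a j \<le> j * (length (encode_ints zs) * B)"
    and "part_rhs zs K w a j \<le> j * (length (encode_ints zs) * B)"
proof -
  have "part_lhs zs K w a j \<le> of_nat (card {..<j}) * (length (encode_ints zs) * B)"
    unfolding part_lhs_def
    by (rule sum_bounded_above) (use assms in \<open>intro weighted_le abs_nth_le_length; simp\<close>)
  then show "part_lhs zs K w a j \<le> j * (length (encode_ints zs) * B)" by simp
  have "part_rhs zs K w a j \<le> of_nat (card {..<j}) * (length (encode_ints zs) * B)"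
    unfolding part_rhs_def
    by (rule sum_bounded_above) (use assms in \<open>intro weighted_le abs_nth_le_length; simp\<close>)
  then show "part_rhs zs K w a j \<le> j * (length (encode_ints zs) * B)" by simp
qed

lemma exec_row_a:
  assumes x: "x = encode_ints zs" and a: "s r_ia + j \<le> length zs" "length zs \<le> V"
    and z0: "s r_tmp = 0" "s r_skip = 0" "s r_lhs = 0" "s r_rhs = 0" and K: "s r_K = K"
    and w: "\<forall>t<j. s (r_u t) \<le> B" "K \<le> B"
    and V: "j * (length x * B) \<le> V"
  shows "exec x V (row_a j) 0 s 0
    (s(r_lhs := part_lhs zs K (\<lambda>t. s (r_u t)) (s r_ia) j,
       r_rhs := part_rhs zs K (\<lambda>t. s (r_u t)) (s r_ia) j, r_ia := s r_ia + j))"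
  using a(1) w(1) V
proof (induction j)
  case 0
  show ?case
    unfolding row_a.simps
    by (rule exec_eqI[OF exec_Skip]) (use z0 in \<open>auto simp: fun_eq_iff part_lhs_def part_rhs_def\<close>)
next
  case (Suc j)
  let ?st = "\<lambda>j. s(r_lhs := part_lhs zs K (\<lambda>t. s (r_u t)) (s r_ia) j,
       r_rhs := part_rhs zs K (\<lambda>t. s (r_u t)) (s r_ia) j, r_ia := s r_ia + j)"
  have 1: "exec x V (row_a j) 0 s 0 (?st j)"
    by (rule Suc.IH) (use Suc.prems in auto)
  let ?z = "zs ! (s r_ia + j)"
  have le: "part_lhs zs K (\<lambda>t. s (r_u t)) (s r_ia) j \<le> j * (length x * B)"
    "part_rhs zs K (\<lambda>t. s (r_u t)) (s r_ia) j \<le> j * (length x * B)"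
    using part_le[of "s r_ia" j zs "\<lambda>t. s (r_u t)" B K] Suc.prems w(2) x by auto
  have "nat \<bar>?z\<bar> * B \<le> length x * B"
    using abs_nth_le_length[of "s r_ia + j" zs] Suc.prems(1) x by (intro mult_le_mono) auto
  moreover have "Suc j * (length x * B) = length x * B + j * (length x * B)" by simp
  ultimately have b: "v + nat \<bar>?z\<bar> * B \<le> V" if "v \<le> j * (length x * B)" for v
    using that Suc.prems(3) by linarith
  have 2: "exec x V (item r_ia (r_u j) r_K) 0 (?st j) 0
      ((?st j)(r_lhs := (?st j) r_lhs + (nat (zs ! (?st j) r_ia) * (?st j) (r_u j) + nat (- (zs ! (?st j) r_ia)) * (?st j) r_K),
       r_rhs := (?st j) r_rhs + (nat (zs ! (?st j) r_ia) * (?st j) r_K + nat (- (zs ! (?st j) r_ia)) * (?st j) (r_u j)),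
       r_ia := Suc ((?st j) r_ia)))"
    by (rule exec_item[OF x, where B = B])
       (use Suc.prems a(2) z0 K w(2) b[OF le(1)] b[OF le(2)] in auto)
  show ?case
    unfolding row_a.simps
    by (rule exec_eqI[OF exec_Seq[OF 1 2]])
       (use K in \<open>auto simp: fun_eq_iff part_lhs_def part_rhs_def\<close>)
qed

lemma exec_compare:
  assumes "s r_viol + (s r_lhs - s r_rhs) \<le> V"
  shows "exec x V compare p s p
    (s(r_lhs := 0, r_rhs := 0, r_viol := s r_viol + (s r_lhs - s r_rhs)))"
  unfolding compare_def
proof (rule exec_Seq)
  let ?st = "\<lambda>i. s(r_rhs := s r_rhs - i, r_viol := s r_viol + (i - s r_rhs))"
  show "exec x V (loop r_lhs (If (Non_Zero r_rhs) (Dec r_rhs) (Inc r_viol))) p s p ((?st (s r_lhs))(r_lhs := 0))"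
  proof (rule exec_loop[where st = ?st and n = "s r_lhs" and p = "\<lambda>_. p"])
    fix i assume i: "i < s r_lhs"
    let ?s = "(?st i)(r_lhs := s r_lhs - Suc i)"
    show "exec x V (If (Non_Zero r_rhs) (Dec r_rhs) (Inc r_viol)) p ?s p ((?st (Suc i))(r_lhs := s r_lhs - Suc i))"
    proof (rule exec_If, cases "i < s r_rhs")
      case True
      have "exec x V (Dec r_rhs) p ?s p (?s(r_rhs := ?s r_rhs - 1))"
        by (rule exec_Dec) (use True in simp)
      moreover have "?s(r_rhs := ?s r_rhs - 1) = (?st (Suc i))(r_lhs := s r_lhs - Suc i)"
        using True by (auto simp: fun_eq_iff)
      ultimately show "exec x V (if holds (Non_Zero r_rhs) (input_read x (int p)) ?s then Dec r_rhs else Inc r_viol)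
          p ?s p ((?st (Suc i))(r_lhs := s r_lhs - Suc i))"
        using True by simp
    next
      case False
      have "exec x V (Inc r_viol) p ?s p (?s(r_viol := Suc (?s r_viol)))"
        by (rule exec_Inc) (use False i assms in simp)
      moreover have "?s(r_viol := Suc (?s r_viol)) = (?st (Suc i))(r_lhs := s r_lhs - Suc i)"
        using False by (auto simp: fun_eq_iff)
      ultimately show "exec x V (if holds (Non_Zero r_rhs) (input_read x (int p)) ?s then Dec r_rhs else Inc r_viol)
          p ?s p ((?st (Suc i))(r_lhs := s r_lhs - Suc i))"
        using False by simp
    qed
  qed (auto simp: fun_eq_iff)
  show "exec x V (clear r_rhs) p ((?st (s r_lhs))(r_lhs := 0)) p
      (s(r_lhs := 0, r_rhs := 0, r_viol := s r_viol + (s r_lhs - s r_rhs)))"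
    by (rule exec_eqI[OF exec_clear]) (auto simp: fun_eq_iff)
qed

definition violation :: "int list \<Rightarrow> nat \<Rightarrow> nat \<Rightarrow> nat \<Rightarrow> bool \<Rightarrow> (nat \<Rightarrow> nat) \<Rightarrow> nat \<Rightarrow> nat" where
  "violation zs n m K wb w i =
     (part_lhs zs K w (i * n) n + (if wb then nat (- (zs ! (m * n + i))) else 0)) -
     (part_rhs zs K w (i * n) n + (if wb then nat (zs ! (m * n + i)) else 0))"

definition total_violation :: "int list \<Rightarrow> nat \<Rightarrow> nat \<Rightarrow> nat \<Rightarrow> bool \<Rightarrow> (nat \<Rightarrow> nat) \<Rightarrow> nat" where
  "total_violation zs n m K wb w = (\<Sum>i<m. violation zs n m K wb w i)"

section \<open>Enumerating and guessing points\<close>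

text \<open>The value 0 of a coordinate is treated before its loop, so \<open>2 * K\<close> rounds
  cover \<open>2 * K + 1\<close> values. All registers except \<open>r_good\<close> are restored, on
  which the enclosing loop relies.\<close>

primrec enumerate_good :: "nat \<Rightarrow> nat \<Rightarrow> com" where
  "enumerate_good n 0 = test_rows n False ;; If (Non_Zero r_viol) (clear r_viol) (Inc r_good)"
| "enumerate_good n (Suc j) =
     add r_tmp r_width (r_c j) ;; enumerate_good n j ;;
     loop (r_c j) (Inc (r_u j) ;; enumerate_good n j) ;; clear (r_u j)"

text \<open>Each unit of \<open>r_c j\<close> offers a choice between increasing the coordinate and
  stopping; at \<open>2 * K\<close> the units run out. Every value thus arises from exactly one
  sequence of choices, so that accepting paths count points without repetition.\<close>

definition guess :: "nat \<Rightarrow> com" where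
  "guess j = add r_tmp r_width (r_c j) ;;
     While (Non_Zero (r_c j)) (Dec (r_c j) ;; Choice (Inc (r_u j)) (clear (r_c j)))"

primrec guess_all :: "nat \<Rightarrow> com" where
  "guess_all 0 = Skip"
| "guess_all (Suc j) = guess j ;; guess_all j"

text \<open>The recursion fixes the highest coordinate first, in the order in which both
  \<open>enumerate_good\<close> and \<open>guess_all\<close> do; \<open>box_count_eq_card\<close>
  turns it into a cardinality.\<close>

primrec box_count :: "nat \<Rightarrow> ((nat \<Rightarrow> nat) \<Rightarrow> bool) \<Rightarrow> nat \<Rightarrow> (nat \<Rightarrow> nat) \<Rightarrow> nat" where
  "box_count W Q 0 w = of_bool (Q w)"
| "box_count W Q (Suc j) w = (\<Sum>v\<le>W. box_count W Q j (w(j := v)))"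

lemma box_count_le: "box_count W Q j w \<le> Suc W ^ j"
proof (induction j arbitrary: w)
  case (Suc j)
  have "(\<Sum>v\<le>W. box_count W Q j (w(j := v))) \<le> of_nat (card {..W}) * Suc W ^ j"
    by (rule sum_bounded_above) (rule Suc.IH)
  then show ?case by simp
qed simp

text \<open>
  The variables \<open>u j\<close> run over \<open>{0..2 * K}\<close> and stand for the coordinates \<open>u j - K\<close>, so
  that no counter has to hold a negative number.
\<close>

locale encoded_rows =
  fixes x :: "bool list" and zs :: "int list" and n m K V :: nat
  assumes x: "x = encode_ints zs" and length_zs: "length zs = Suc n * m"
    and K_pos: "0 < K"
    and V: "Suc m * (Suc n * (length x * (2 * K))) \<le> V" "Suc (2 * K) ^ n \<le> V" "2 * K \<le> V"
begin

text \<open>The invariant between two row tests. It leaves \<open>r_good\<close> and the loop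
  counters \<open>r_c j\<close> free, since these change during the enumeration.\<close>

definition ready :: "(nat \<Rightarrow> nat) \<Rightarrow> bool" where
  "ready s \<longleftrightarrow> s r_tmp = 0 \<and> s r_skip = 0 \<and> s r_rem = 0 \<and> s r_ia = 0 \<and> s r_ib = 0 \<and>
     s r_lhs = 0 \<and> s r_rhs = 0 \<and> s r_viol = 0 \<and> s r_zero = 0 \<and> s r_one = 1 \<and>
     s r_K = K \<and> s r_rows = m \<and> s r_width = 2 * K \<and> (\<forall>j<n. s (r_u j) \<le> 2 * K)"

lemma length_zs_le: "length zs \<le> length x"
  using length_encode_ints_ge x by simp

lemma row_bound_le: "Suc n * (length x * (2 * K)) \<le> V"
  using V(1) by (metis le_trans le_add1 mult_Suc)

lemma length_x_le: "length x \<le> V"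
proof -
  have "length x * 1 \<le> length x * (2 * K)" using K_pos by (intro mult_le_mono) auto
  also have "\<dots> \<le> Suc n * (length x * (2 * K))" by simp
  finally show ?thesis using row_bound_le by simp
qed

text \<open>This is where the first lower bound on \<open>V\<close> comes from: \<open>n\<close>
  coefficients and one bound, each at most \<open>length x\<close>, with weights at most
  \<open>2 * K\<close>. Its factor \<open>Suc m\<close> pays for the sum over the rows.\<close>

lemma violation_le:
  assumes "i < m" "\<forall>j<n. w j \<le> 2 * K"
  shows "violation zs n m K wb w i \<le> Suc n * (length x * (2 * K))"
    and "part_lhs zs K w (i * n) n + nat \<bar>zs ! (m * n + i)\<bar> \<le> Suc n * (length x * (2 * K))"
    and "part_rhs zs K w (i * n) n + nat \<bar>zs ! (m * n + i)\<bar> \<le> Suc n * (length x * (2 * K))"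
proof -
  have "Suc i * n \<le> m * n" using assms(1) by (intro mult_le_mono) auto
  then have "i * n + n \<le> length zs" by (simp add: length_zs algebra_simps)
  then have p: "part_lhs zs K w (i * n) n \<le> n * (length x * (2 * K))"
    "part_rhs zs K w (i * n) n \<le> n * (length x * (2 * K))"
    using part_le[of "i * n" n zs w "2 * K" K] assms(2) x by auto
  have "nat \<bar>zs ! (m * n + i)\<bar> * 1 \<le> length x * (2 * K)"
    using abs_nth_le_length[of "m * n + i" zs] assms(1) K_pos length_zs x
    by (intro mult_le_mono) (auto simp: algebra_simps)
  moreover have "Suc n * (length x * (2 * K)) = length x * (2 * K) + n * (length x * (2 * K))"
    by simp
  ultimately show
    1: "part_lhs zs K w (i * n) n + nat \<bar>zs ! (m * n + i)\<bar> \<le> Suc n * (length x * (2 * K))"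
    "part_rhs zs K w (i * n) n + nat \<bar>zs ! (m * n + i)\<bar> \<le> Suc n * (length x * (2 * K))"
    using p by linarith+
  have "violation zs n m K wb w i \<le> part_lhs zs K w (i * n) n + nat \<bar>zs ! (m * n + i)\<bar>"
    unfolding violation_def by (rule le_trans[OF diff_le_self]) auto
  with 1 show "violation zs n m K wb w i \<le> Suc n * (length x * (2 * K))" by linarith
qed

lemma exec_row_b:
  assumes i: "i < m" "s r_ib = m * n + i \<or> \<not> wb"
    and s: "s r_tmp = 0" "s r_skip = 0" "s r_zero = 0" "s r_one = 1"
    and le: "s r_lhs + nat \<bar>zs ! (m * n + i)\<bar> \<le> V" "s r_rhs + nat \<bar>zs ! (m * n + i)\<bar> \<le> V"
  shows "exec x V (row_b wb) 0 s 0
    (s(r_lhs := s r_lhs + (if wb then nat (- (zs ! (m * n + i))) else 0),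
       r_rhs := s r_rhs + (if wb then nat (zs ! (m * n + i)) else 0),
       r_ib := s r_ib + (if wb then 1 else 0)))"
proof (cases wb)
  case False
  then show ?thesis
    unfolding row_b_def by (simp only: if_False) (rule exec_eqI[OF exec_Skip], simp add: fun_eq_iff)
next
  case True
  have lt: "m * n + i < length zs" using i(1) by (simp add: length_zs)
  have ib: "s r_ib = m * n + i" using i(2) True by simp
  have "exec x V (item r_ib r_zero r_one) 0 s 0
    (s(r_lhs := s r_lhs + (nat (zs ! s r_ib) * s r_zero + nat (- (zs ! s r_ib)) * s r_one),
       r_rhs := s r_rhs + (nat (zs ! s r_ib) * s r_one + nat (- (zs ! s r_ib)) * s r_zero),
       r_ib := Suc (s r_ib)))"
    by (rule exec_item[OF x, where B = 1])
       (use s le ib lt length_zs_le length_x_le in auto)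
  then show ?thesis
    using True unfolding row_b_def by (simp only: if_True) (rule exec_eqI, assumption, simp add: fun_eq_iff s ib)
qed

lemma exec_row:
  assumes i: "i < m" "s r_ia = i * n" "s r_ib = m * n + i \<or> \<not> wb"
    and s: "s r_tmp = 0" "s r_skip = 0" "s r_lhs = 0" "s r_rhs = 0" "s r_zero = 0" "s r_one = 1"
      "s r_K = K" "\<forall>j<n. s (r_u j) \<le> 2 * K"
    and le: "s r_viol + violation zs n m K wb (\<lambda>t. s (r_u t)) i \<le> V"
  shows "exec x V (row_a n ;; row_b wb ;; compare) 0 s 0
    (s(r_ia := s r_ia + n, r_ib := s r_ib + (if wb then 1 else 0),
       r_viol := s r_viol + violation zs n m K wb (\<lambda>t. s (r_u t)) i))"
proof -
  let ?w = "\<lambda>t. s (r_u t)"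
  let ?s1 = "s(r_lhs := part_lhs zs K ?w (s r_ia) n, r_rhs := part_rhs zs K ?w (s r_ia) n,
      r_ia := s r_ia + n)"
  have "Suc i * n \<le> m * n" using i(1) by (intro mult_le_mono) auto
  then have "i * n + n \<le> length zs" by (simp add: length_zs algebra_simps)
  then have 1: "exec x V (row_a n) 0 s 0 ?s1"
    using i s length_zs_le length_x_le row_bound_le by (intro exec_row_a[OF x, where B = "2 * K"]) auto
  let ?s2 = "?s1(r_lhs := ?s1 r_lhs + (if wb then nat (- (zs ! (m * n + i))) else 0),
       r_rhs := ?s1 r_rhs + (if wb then nat (zs ! (m * n + i)) else 0),
       r_ib := ?s1 r_ib + (if wb then 1 else 0))"
  have 2: "exec x V (row_b wb) 0 ?s1 0 ?s2"
    by (rule exec_row_b[OF i(1)])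
       (use i s violation_le(2,3)[OF i(1), of ?w] row_bound_le in auto)
  have viol: "?s2 r_lhs - ?s2 r_rhs = violation zs n m K wb ?w i"
    by (simp add: violation_def i(2))
  have 3: "exec x V compare 0 ?s2 0
      (?s2(r_lhs := 0, r_rhs := 0, r_viol := ?s2 r_viol + (?s2 r_lhs - ?s2 r_rhs)))"
    by (rule exec_compare) (unfold viol, use le in simp)
  show ?thesis
    by (rule exec_eqI[OF exec_Seq[OF 1 exec_Seq[OF 2 3]]]) (unfold viol, use s in \<open>auto simp: fun_eq_iff\<close>)
qed

lemma exec_test_rows:
  assumes "ready s"
  shows "exec x V (test_rows n wb) 0 s 0
    (s(r_viol := total_violation zs n m K wb (\<lambda>t. s (r_u t))))"
proof -
  note s = assms[unfolded ready_def]
  let ?w = "\<lambda>t. s (r_u t)"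
  let ?v = "\<lambda>i. violation zs n m K wb ?w i"
  let ?s1 = "s(r_rem := m)"
  have "m * n + m \<le> V" using length_zs length_zs_le length_x_le by (simp add: mult.commute)
  then have "m \<le> V" by simp
  have 1: "exec x V (add r_tmp r_rows r_rem) 0 s 0 ?s1"
    by (rule exec_eqI[OF exec_add]) (use s \<open>m \<le> V\<close> in auto)
  let ?t = "\<lambda>i. ?s1(r_ib := i * m)"
  have 2: "exec x V (iter n (add r_tmp r_rows r_ib)) 0 (?t 0) 0 (?t n)"
  proof (rule exec_iter)
    fix i assume "i < n"
    then have "Suc i * m \<le> n * m" by (intro mult_le_mono) auto
    then have "i * m + m \<le> V" using \<open>m * n + m \<le> V\<close> by (simp add: mult.commute)
    then show "exec x V (add r_tmp r_rows r_ib) 0 (?t i) 0 (?t (Suc i))"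
      by (intro exec_eqI[OF exec_add]) (use s in \<open>auto simp: fun_eq_iff\<close>)
  qed
  let ?st = "\<lambda>i. s(r_ia := i * n, r_ib := m * n + (if wb then i else 0), r_viol := \<Sum>i'<i. ?v i')"
  have sum_le: "(\<Sum>i'<i. ?v i') + ?v i \<le> V" if "i < m" for i
  proof -
    have "(\<Sum>i'<Suc i. ?v i') \<le> of_nat (card {..<Suc i}) * (Suc n * (length x * (2 * K)))"
      by (rule sum_bounded_above) (use that s in \<open>intro violation_le; simp\<close>)
    also have "\<dots> \<le> Suc m * (Suc n * (length x * (2 * K)))"
      by (rule mult_le_mono1) (use that in simp)
    finally show ?thesis using V(1) by simp
  qed
  have 3: "exec x V (loop r_rem (row_a n ;; row_b wb ;; compare)) 0 (?t n) 0 ((?st m)(r_rem := 0))"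
  proof (rule exec_loop[where st = ?st and n = m and p = "\<lambda>_. 0"])
    fix i assume i: "i < m"
    let ?a = "(?st i)(r_rem := m - Suc i)"
    have w: "(\<lambda>t. ?a (r_u t)) = ?w" by simp
    have "exec x V (row_a n ;; row_b wb ;; compare) 0 ?a 0
      (?a(r_ia := ?a r_ia + n, r_ib := ?a r_ib + (if wb then 1 else 0),
       r_viol := ?a r_viol + violation zs n m K wb (\<lambda>t. ?a (r_u t)) i))"
      by (rule exec_row[OF i]; (unfold w)?) (use s sum_le[OF i] in auto)
    then show "exec x V (row_a n ;; row_b wb ;; compare) 0 ?a 0 ((?st (Suc i))(r_rem := m - Suc i))"
      by (rule exec_eqI) (unfold w, auto simp: fun_eq_iff)
  qed (use s in \<open>auto simp: fun_eq_iff\<close>)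
  have 4: "exec x V (clear r_ia) 0 ((?st m)(r_rem := 0)) 0 ((?st m)(r_rem := 0, r_ia := 0))"
    by (rule exec_clear)
  have 5: "exec x V (clear r_ib) 0 ((?st m)(r_rem := 0, r_ia := 0)) 0 ((?st m)(r_rem := 0, r_ia := 0, r_ib := 0))"
    by (rule exec_clear)
  have "?t 0 = ?s1" using s by (auto simp: fun_eq_iff)
  with 2 have 2: "exec x V (iter n (add r_tmp r_rows r_ib)) 0 ?s1 0 (?t n)" by (simp only:)
  show ?thesis
    unfolding test_rows_def
    by (rule exec_eqI[OF exec_Seq[OF 1 exec_Seq[OF 2 exec_Seq[OF 3 exec_Seq[OF 4 5]]]]])
       (use s in \<open>auto simp: fun_eq_iff total_violation_def\<close>)
qed

abbreviation good :: "bool \<Rightarrow> (nat \<Rightarrow> nat) \<Rightarrow> bool" where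
  "good wb w \<equiv> total_violation zs n m K wb w = 0"

text \<open>The power \<open>Suc (2 * K) ^ j\<close> is the number of points visited by the call,
  hence a bound for the growth of \<open>r_good\<close>.\<close>

lemma exec_enumerate_good:
  assumes "ready s" "j \<le> n" "\<forall>t<j. s (r_u t) = 0 \<and> s (r_c t) = 0"
    and "s r_good + Suc (2 * K) ^ j \<le> V"
  shows "exec x V (enumerate_good n j) 0 s 0
    (s(r_good := s r_good + box_count (2 * K) (good False) j (\<lambda>t. s (r_u t))))"
  using assms
proof (induction j arbitrary: s)
  case 0
  note s = 0(1)[unfolded ready_def]
  let ?v = "total_violation zs n m K False (\<lambda>t. s (r_u t))"
  let ?s1 = "s(r_viol := ?v)"
  have 1: "exec x V (test_rows n False) 0 s 0 ?s1" by (rule exec_test_rows[OF 0(1)])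
  have 2: "exec x V (If (Non_Zero r_viol) (clear r_viol) (Inc r_good)) 0 ?s1 0
      (s(r_good := s r_good + of_bool (good False (\<lambda>t. s (r_u t)))))"
  proof (rule exec_If, cases "?v = 0")
    case True
    have "exec x V (Inc r_good) 0 ?s1 0 (?s1(r_good := Suc (?s1 r_good)))"
      by (rule exec_Inc) (use 0 in auto)
    then have "exec x V (Inc r_good) 0 ?s1 0
      (s(r_good := s r_good + of_bool (good False (\<lambda>t. s (r_u t)))))"
      by (rule exec_eqI) (use True s in \<open>auto simp: fun_eq_iff\<close>)
    then show "exec x V (if holds (Non_Zero r_viol) (input_read x (int 0)) ?s1 then clear r_viol else Inc r_good)
        0 ?s1 0 (s(r_good := s r_good + of_bool (good False (\<lambda>t. s (r_u t)))))"
      using True by simp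
  next
    case False
    have "exec x V (clear r_viol) 0 ?s1 0
      (s(r_good := s r_good + of_bool (good False (\<lambda>t. s (r_u t)))))"
      by (rule exec_eqI[OF exec_clear]) (use False s in \<open>auto simp: fun_eq_iff\<close>)
    then show "exec x V (if holds (Non_Zero r_viol) (input_read x (int 0)) ?s1 then clear r_viol else Inc r_good)
        0 ?s1 0 (s(r_good := s r_good + of_bool (good False (\<lambda>t. s (r_u t)))))"
      using False by simp
  qed
  show ?case
    unfolding enumerate_good.simps box_count.simps by (rule exec_Seq[OF 1 2])
next
  case (Suc j)
  note s = Suc.prems(1)[unfolded ready_def]
  let ?w = "\<lambda>t. s (r_u t)"
  let ?b = "\<lambda>v. box_count (2 * K) (good False) j (?w(j := v))"
  let ?s1 = "s(r_c j := 2 * K)"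
  let ?st = "\<lambda>i. s(r_u j := i, r_good := s r_good + (\<Sum>v\<le>i. ?b v))"
  have V': "2 * K \<le> V" "s r_good + Suc (2 * K) * Suc (2 * K) ^ j \<le> V"
    using V(3) Suc.prems(4) by simp_all
  \<comment> \<open>The values \<open>0..i\<close> are done and one more follows; together these are
    \<open>i + 2\<close>, at most \<open>2 * K + 1\<close>, blocks of points.\<close>
  have b_le: "s r_good + (\<Sum>v\<le>i. ?b v) + Suc (2 * K) ^ j \<le> V" if "i < 2 * K" for i
  proof -
    have "(\<Sum>v\<le>i. ?b v) \<le> of_nat (card {..i}) * Suc (2 * K) ^ j"
      by (rule sum_bounded_above) (rule box_count_le)
    then have "(\<Sum>v\<le>i. ?b v) + Suc (2 * K) ^ j \<le> (i + 2) * Suc (2 * K) ^ j" by simp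
    also have "\<dots> \<le> Suc (2 * K) * Suc (2 * K) ^ j"
      by (rule mult_le_mono1) (use that in simp)
    finally show ?thesis using V'(2) by linarith
  qed
  have upd: "(\<lambda>t. (s'(r_u j := v)) (r_u t)) = (\<lambda>t. s' (r_u t))(j := v)" for s' :: "nat \<Rightarrow> nat" and v
    by (auto simp: fun_eq_iff)
  have 1: "exec x V (add r_tmp r_width (r_c j)) 0 s 0 ?s1"
    by (rule exec_eqI[OF exec_add]) (use s V' Suc.prems(3) in auto)
  have 2: "exec x V (enumerate_good n j) 0 ?s1 0 ((?st 0)(r_c j := 2 * K))"
  proof (rule exec_eqI[OF Suc.IH])
    show "ready ?s1" using s by (simp add: ready_def)
    have "Suc (2 * K) ^ j \<le> Suc (2 * K) * Suc (2 * K) ^ j" by simp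
    then show "?s1 r_good + Suc (2 * K) ^ j \<le> V" using V'(2) by simp
    have w: "(\<lambda>t. ?s1 (r_u t)) = ?w(j := 0)" using Suc.prems(3) by (auto simp: fun_eq_iff)
    show "?s1(r_good := ?s1 r_good + box_count (2 * K) (good False) j (\<lambda>t. ?s1 (r_u t))) =
        (?st 0)(r_c j := 2 * K)"
      unfolding w using Suc.prems(3) by (auto simp: fun_eq_iff)
  qed (use Suc.prems in auto)
  have 3: "exec x V (loop (r_c j) (Inc (r_u j) ;; enumerate_good n j)) 0 ((?st 0)(r_c j := 2 * K))
      0 ((?st (2 * K))(r_c j := 0))"
  proof (rule exec_loop[where st = ?st and n = "2 * K" and p = "\<lambda>_. 0"])
    fix i assume i: "i < 2 * K"
    let ?a = "(?st i)(r_c j := 2 * K - Suc i)"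
    let ?a' = "?a(r_u j := Suc i)"
    have "exec x V (Inc (r_u j)) 0 ?a 0 (?a(r_u j := Suc (?a (r_u j))))"
      by (rule exec_Inc) (use i V' in simp)
    then have I: "exec x V (Inc (r_u j)) 0 ?a 0 ?a'" by simp
    have E: "exec x V (enumerate_good n j) 0 ?a' 0
        (?a'(r_good := ?a' r_good + box_count (2 * K) (good False) j (\<lambda>t. ?a' (r_u t))))"
    proof (rule Suc.IH)
      show "ready ?a'" using s i by (auto simp: ready_def)
    qed (use Suc.prems b_le[OF i] in auto)
    have w: "(\<lambda>t. ?a' (r_u t)) = ?w(j := Suc i)" by (auto simp: fun_eq_iff)
    show "exec x V (Inc (r_u j) ;; enumerate_good n j) 0 ?a 0 ((?st (Suc i))(r_c j := 2 * K - Suc i))"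
      by (rule exec_eqI[OF exec_Seq[OF I E]]) (unfold w, auto simp: fun_eq_iff)
  qed auto
  have 4: "exec x V (clear (r_u j)) 0 ((?st (2 * K))(r_c j := 0)) 0 ((?st (2 * K))(r_c j := 0, r_u j := 0))"
    by (rule exec_clear)
  show ?case
    unfolding enumerate_good.simps
    by (rule exec_eqI[OF exec_Seq[OF 1 exec_Seq[OF 2 exec_Seq[OF 3 4]]]])
       (use Suc.prems(3) in \<open>auto simp: fun_eq_iff\<close>)
qed

text \<open>By downward induction, the loop entered with coordinate \<open>v\<close> and
  \<open>2 * K - v\<close> units left accounts for the values \<open>v..2 * K\<close>: stopping
  contributes \<open>F v\<close>, incrementing the rest.\<close>

lemma runs_guess:
  assumes s: "ready s" "s (r_u j) = 0" "s (r_c j) = 0"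
    and k: "\<And>v. v \<le> 2 * K \<Longrightarrow> runs x V k 0 (s(r_u j := v)) (F v)"
  shows "runs x V (guess j # k) 0 s (\<Sum>v\<le>2 * K. F v)"
proof -
  let ?c = "Dec (r_c j) ;; Choice (Inc (r_u j)) (clear (r_c j))"
  let ?loop = "While (Non_Zero (r_c j)) ?c"
  have exit: "runs x V (?loop # k) 0 (s(r_u j := v, r_c j := 0)) (F v)" if "v \<le> 2 * K" for v
  proof -
    have "s(r_u j := v, r_c j := 0) = s(r_u j := v)" using s(3) by (auto simp: fun_eq_iff)
    then show ?thesis using k[OF that] s(3) by (intro runs.While) simp
  qed
  have "runs x V (?loop # k) 0 (s(r_u j := v, r_c j := 2 * K - v)) (\<Sum>v'\<in>{v..2 * K}. F v')"
    if "v \<le> 2 * K" for v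
    using that
  proof (induction v rule: inc_induct)
    case base
    have "(\<Sum>v'\<in>{2 * K..2 * K}. F v') = F (2 * K)" by simp
    then show ?case using exit[OF order_refl] by (simp only: diff_self_eq_0)
  next
    case (step v)
    let ?s = "s(r_u j := v, r_c j := 2 * K - Suc v)"
    have eq: "?s(r_u j := Suc (?s (r_u j))) = s(r_u j := Suc v, r_c j := 2 * K - Suc v)"
      by (auto simp: fun_eq_iff)
    have 1: "runs x V (Inc (r_u j) # ?loop # k) 0 ?s (\<Sum>v'\<in>{Suc v..2 * K}. F v')"
      by (rule runs.Inc, use step.hyps V(3) in simp) (subst eq, rule step.IH)
    have "exec x V (clear (r_c j)) 0 ?s 0 (s(r_u j := v, r_c j := 0))"
      by (rule exec_eqI[OF exec_clear]) simp
    then have 2: "runs x V (clear (r_c j) # ?loop # k) 0 ?s (F v)"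
      using exit[of v] step.hyps by (simp add: exec_def)
    have 3: "runs x V (Choice (Inc (r_u j)) (clear (r_c j)) # ?loop # k) 0 ?s
        ((\<Sum>v'\<in>{Suc v..2 * K}. F v') + F v)"
      by (rule runs.Choice[OF _ 1 2]) (simp add: loop_def)
    have "exec x V (Dec (r_c j)) 0 (s(r_u j := v, r_c j := 2 * K - v)) 0 ?s"
      by (rule exec_eqI[OF exec_Dec]) (use step.hyps in auto)
    with 3 have "runs x V (Dec (r_c j) # Choice (Inc (r_u j)) (clear (r_c j)) # ?loop # k) 0
        (s(r_u j := v, r_c j := 2 * K - v)) ((\<Sum>v'\<in>{Suc v..2 * K}. F v') + F v)"
      by (simp add: exec_def)
    moreover have "(\<Sum>v'\<in>{Suc v..2 * K}. F v') + F v = (\<Sum>v'\<in>{v..2 * K}. F v')"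
      using step.hyps by (simp add: sum.atLeast_Suc_atMost)
    ultimately have *: "runs x V (?c # ?loop # k) 0 (s(r_u j := v, r_c j := 2 * K - v))
        (\<Sum>v'\<in>{v..2 * K}. F v')"
      by (metis runs.Seq)
    have "holds (Non_Zero (r_c j)) (input_read x (int 0)) (s(r_u j := v, r_c j := 2 * K - v))"
      using step.hyps by simp
    then show ?case by (intro runs.While) (subst if_P, assumption, rule *)
  qed
  from this[of 0] have *: "runs x V (?loop # k) 0 (s(r_u j := 0, r_c j := 2 * K)) (\<Sum>v\<le>2 * K. F v)"
    by (simp add: atMost_atLeast0)
  have "s(r_u j := 0, r_c j := 2 * K) = s(r_c j := 2 * K)" using s(2) by (auto simp: fun_eq_iff)
  moreover have "exec x V (add r_tmp r_width (r_c j)) 0 s 0 (s(r_c j := 2 * K))"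
    by (rule exec_eqI[OF exec_add]) (use s V(3) in \<open>auto simp: ready_def\<close>)
  ultimately show ?thesis
    using * unfolding guess_def by (intro runs.Seq) (simp add: exec_def)
qed

text \<open>The continuation decides \<open>Q\<close> from any ready state, so each complete guess
  contributes 0 or 1.\<close>

lemma runs_guess_all:
  assumes "ready s" "j \<le> n" "\<forall>t<j. s (r_u t) = 0 \<and> s (r_c t) = 0"
    and k: "\<And>s. ready s \<Longrightarrow> runs x V k 0 s (of_bool (Q (\<lambda>t. s (r_u t))))"
  shows "runs x V (guess_all j # k) 0 s (box_count (2 * K) Q j (\<lambda>t. s (r_u t)))"
  using assms(1-3)
proof (induction j arbitrary: s)
  case 0
  show ?case
    unfolding guess_all.simps box_count.simps by (intro runs.Skip k 0)
next
  case (Suc j)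
  have "runs x V (guess_all j # k) 0 (s(r_u j := v)) (box_count (2 * K) Q j ((\<lambda>t. s (r_u t))(j := v)))"
    if "v \<le> 2 * K" for v
  proof -
    have w: "(\<lambda>t. (s(r_u j := v)) (r_u t)) = (\<lambda>t. s (r_u t))(j := v)" by (auto simp: fun_eq_iff)
    have "ready (s(r_u j := v))" using Suc.prems(1) that by (auto simp: ready_def)
    then have "runs x V (guess_all j # k) 0 (s(r_u j := v))
        (box_count (2 * K) Q j (\<lambda>t. (s(r_u j := v)) (r_u t)))"
      by (rule Suc.IH) (use Suc.prems in auto)
    then show ?thesis unfolding w .
  qed
  then show ?case
    unfolding guess_all.simps box_count.simps
    by (intro runs.Seq runs_guess) (use Suc.prems in auto)
qed

end

section \<open>The counting program\<close>

definition multiply :: com where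
  "multiply = loop r_K (add r_tmp r_base r_prod) ;; loop r_prod (Inc r_K)"

text \<open>One addition of \<open>d\<close> before the loop and one per input bit give
  \<open>d * Suc (length x)\<close>, which for positive \<open>d\<close> is positive even on the
  empty input.\<close>

definition measure_input :: "nat \<Rightarrow> com" where
  "measure_input d = Rewind ;; Fwd ;; iter d (Inc r_base) ;;
     While (Not_At Right_End) (Fwd ;; iter d (Inc r_base)) ;; Rewind"

text \<open>Since \<open>n\<close> is fixed, the power that defines \<open>K\<close> is computed by
  \<open>Suc n\<close> hard-wired multiplications starting from 1.\<close>

definition setup_box :: "nat \<Rightarrow> com" where
  "setup_box n = measure_input (2 * Suc n) ;; Inc r_K ;; iter (Suc n) multiply ;;
     add r_tmp r_K r_width ;; add r_tmp r_K r_width ;; Inc r_one"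

text \<open>
  The zero vector satisfies the homogeneous system, so the recession cone contains a nonzero vector
  of the box iff the counter \<open>r_good\<close> exceeds \<open>1\<close> after the enumeration.  In that case the polyhedron
  is empty or unbounded, and the value to be computed is \<open>0\<close>.
\<close>

definition count_points :: "nat \<Rightarrow> com" where
  "count_points n =
     check_input (Suc n) r_rows ;; setup_box n ;; enumerate_good n n ;;
     If (Non_Zero r_good) (Dec r_good) Skip ;; If (Non_Zero r_good) Reject Skip ;;
     guess_all n ;; test_rows n True ;; If (Non_Zero r_viol) Reject Skip"

lemma exec_iter_Inc:
  assumes "s r + d \<le> V"
  shows "exec x V (iter d (Inc r)) p s p (s(r := s r + d))"
proof -
  have "exec x V (iter d (Inc r)) p (s(r := s r + 0)) p (s(r := s r + d))"
  proof (rule exec_iter)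
    fix i assume "i < d"
    then show "exec x V (Inc r) p (s(r := s r + i)) p (s(r := s r + Suc i))"
      by (intro exec_eqI[OF exec_Inc]) (use assms in auto)
  qed
  then show ?thesis by simp
qed

lemma exec_measure_input:
  assumes "s r_base = 0" "d * Suc (length x) \<le> V"
  shows "exec x V (measure_input d) p s 0 (s(r_base := d * Suc (length x)))"
proof -
  let ?L = "length x"
  let ?c = "Fwd ;; iter d (Inc r_base)"
  let ?st = "\<lambda>i. s(r_base := d * Suc i)"
  have le: "d * Suc i \<le> V" if "i \<le> ?L" for i
    using assms(2) mult_le_mono2[of "Suc i" "Suc ?L" d] that by linarith
  have while: "exec x V (While (Not_At Right_End) ?c) (Suc i) (?st i) (Suc ?L) (?st ?L)" if "i \<le> ?L" for i
    using that
  proof (induction i rule: inc_induct)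
    case base
    have "input_read x (int (Suc ?L)) = Right_End" by (rule input_read_end) simp
    then show ?case by (intro exec_While_False) simp
  next
    case (step i)
    have "input_read x (int (Suc i)) = Bit (x ! i)" using step.hyps by (simp add: input_read_def)
    then have h: "holds (Not_At Right_End) (input_read x (int (Suc i))) (?st i)" by simp
    have 1: "exec x V Fwd (Suc i) (?st i) (Suc (Suc i)) (?st i)"
      by (rule exec_Fwd) (use step.hyps in simp)
    have 2: "exec x V (iter d (Inc r_base)) (Suc (Suc i)) (?st i) (Suc (Suc i)) (?st (Suc i))"
      by (rule exec_eqI[OF exec_iter_Inc]) (use le[of "Suc i"] step.hyps in auto)
    show ?case by (rule exec_While_True[OF h exec_Seq[OF 1 2] step.IH])
  qed
  have 1: "exec x V Fwd 0 s (Suc 0) s" by (rule exec_Fwd) simp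
  have 2: "exec x V (iter d (Inc r_base)) (Suc 0) s (Suc 0) (?st 0)"
    by (rule exec_eqI[OF exec_iter_Inc]) (use le[of 0] assms(1) in auto)
  show ?thesis
    unfolding measure_input_def
    by (rule exec_Seq[OF exec_Rewind exec_Seq[OF 1 exec_Seq[OF 2 exec_Seq[OF while[OF le0] exec_Rewind]]]])
qed

lemma exec_multiply:
  assumes "s r_tmp = 0" "s r_prod = 0" "s r_K * s r_base \<le> V"
  shows "exec x V multiply p s p (s(r_K := s r_K * s r_base))"
  unfolding multiply_def
proof (rule exec_Seq)
  let ?B = "s r_base" and ?n = "s r_K"
  let ?st = "\<lambda>i. s(r_prod := i * ?B)"
  show "exec x V (loop r_K (add r_tmp r_base r_prod)) p s p (s(r_prod := ?n * ?B, r_K := 0))"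
  proof (rule exec_loop[where st = ?st and n = ?n and p = "\<lambda>_. p"])
    fix i assume i: "i < ?n"
    have "Suc i * ?B \<le> ?n * ?B" using i by (intro mult_le_mono1) simp
    then have "i * ?B + ?B \<le> V" using assms(3) by simp
    then show "exec x V (add r_tmp r_base r_prod) p ((?st i)(r_K := ?n - Suc i)) p
        ((?st (Suc i))(r_K := ?n - Suc i))"
      by (intro exec_eqI[OF exec_add]) (use assms in \<open>auto simp: fun_eq_iff\<close>)
  qed (use assms in \<open>auto simp: fun_eq_iff\<close>)
  show "exec x V (loop r_prod (Inc r_K)) p (s(r_prod := ?n * ?B, r_K := 0)) p (s(r_K := ?n * ?B))"
  proof (rule exec_loop[where st = "\<lambda>i. s(r_K := i)" and n = "?n * ?B" and p = "\<lambda>_. p"])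
    fix i assume "i < ?n * ?B"
    then show "exec x V (Inc r_K) p (s(r_K := i, r_prod := ?n * ?B - Suc i)) p
        (s(r_K := Suc i, r_prod := ?n * ?B - Suc i))"
      by (intro exec_eqI[OF exec_Inc]) (use assms in \<open>auto simp: fun_eq_iff\<close>)
  qed (use assms in \<open>auto simp: fun_eq_iff\<close>)
qed

locale encoded_box = encoded_rows +
  assumes K: "K = (2 * Suc n * Suc (length x)) ^ Suc n"
begin

abbreviation ready_state :: "nat \<Rightarrow> nat" where
  "ready_state \<equiv> (\<lambda>_. 0)(r_rows := m, r_base := 2 * Suc n * Suc (length x), r_K := K,
     r_width := 2 * K, r_one := 1)"

lemma exec_setup_box: "exec x V (setup_box n) p ((\<lambda>_. 0)(r_rows := m)) 0 ready_state"
proof -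
  let ?B = "2 * Suc n * Suc (length x)"
  let ?s0 = "(\<lambda>_. 0 :: nat)(r_rows := m)"
  let ?s1 = "?s0(r_base := ?B)"
  have pow: "?B ^ i \<le> K" if "i \<le> Suc n" for i
    unfolding K by (rule power_increasing[OF that]) simp
  have KV: "K \<le> V" using V(3) by simp
  have 1: "exec x V (measure_input (2 * Suc n)) p ?s0 0 ?s1"
    by (rule exec_measure_input) (use pow[of 1] KV in auto)
  have 2: "exec x V (Inc r_K) 0 ?s1 0 (?s1(r_K := 1))"
    by (rule exec_eqI[OF exec_Inc]) (use K_pos KV in auto)
  have "exec x V (iter (Suc n) multiply) 0 (?s1(r_K := ?B ^ 0)) 0 (?s1(r_K := ?B ^ Suc n))"
  proof (rule exec_iter)
    fix i assume "i < Suc n"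
    then have "?B ^ Suc i \<le> V" using pow[of "Suc i"] KV by linarith
    then show "exec x V multiply 0 (?s1(r_K := ?B ^ i)) 0 (?s1(r_K := ?B ^ Suc i))"
      by (intro exec_eqI[OF exec_multiply]) (auto simp: mult.commute fun_eq_iff)
  qed
  then have 3: "exec x V (iter (Suc n) multiply) 0 (?s1(r_K := 1)) 0 (?s1(r_K := K))"
    by (simp only: K power_0)
  have 4: "exec x V (add r_tmp r_K r_width) 0 (?s1(r_K := K)) 0 (?s1(r_K := K, r_width := K))"
    by (rule exec_eqI[OF exec_add]) (use KV in auto)
  have 5: "exec x V (add r_tmp r_K r_width) 0 (?s1(r_K := K, r_width := K)) 0 (?s1(r_K := K, r_width := 2 * K))"
    by (rule exec_eqI[OF exec_add]) (use V(3) in auto)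
  have 6: "exec x V (Inc r_one) 0 (?s1(r_K := K, r_width := 2 * K)) 0 ready_state"
    by (rule exec_eqI[OF exec_Inc]) (use K_pos KV in auto)
  show ?thesis
    unfolding setup_box_def
    by (rule exec_Seq[OF 1 exec_Seq[OF 2 exec_Seq[OF 3 exec_Seq[OF 4 exec_Seq[OF 5 6]]]]])
qed

lemma runs_final:
  assumes "ready s"
  shows "runs x V [test_rows n True ;; If (Non_Zero r_viol) Reject Skip] 0 s
    (of_bool (good True (\<lambda>t. s (r_u t))))"
proof -
  let ?v = "total_violation zs n m K True (\<lambda>t. s (r_u t))"
  let ?s1 = "s(r_viol := ?v)"
  have "runs x V [If (Non_Zero r_viol) Reject Skip] 0 ?s1 (of_bool (?v = 0))"
  proof (rule runs.If, cases "?v = 0")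
    case True
    have "runs x V [Skip] 0 ?s1 1" by (intro runs.Skip runs.Nil)
    then show "runs x V [if holds (Non_Zero r_viol) (input_read x (int 0)) ?s1 then Reject else Skip] 0 ?s1
        (of_bool (?v = 0))" using True by simp
  next
    case False
    have "runs x V [Reject] 0 ?s1 0" by (rule runs.Reject)
    then show "runs x V [if holds (Non_Zero r_viol) (input_read x (int 0)) ?s1 then Reject else Skip] 0 ?s1
        (of_bool (?v = 0))" using False by simp
  qed
  then show ?thesis
    using exec_test_rows[OF assms, of True] by (intro runs.Seq) (simp add: exec_def)
qed

theorem runs_count_points:
  "runs x V [count_points n] 0 (\<lambda>_. 0)
     (if box_count (2 * K) (good False) n (\<lambda>_. 0) \<le> 1
      then box_count (2 * K) (good True) n (\<lambda>_. 0) else 0)"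
proof -
  let ?g = "box_count (2 * K) (good False) n (\<lambda>_. 0)"
  let ?tail = "guess_all n ;; test_rows n True ;; If (Non_Zero r_viol) Reject Skip"
  let ?s = "ready_state(r_good := ?g)" and ?s' = "ready_state(r_good := ?g - 1)"
  let ?N = "box_count (2 * K) (good True) n (\<lambda>_. 0)"
  have "m \<le> length zs" by (simp add: length_zs)
  then have mV: "m \<le> V" using length_zs_le length_x_le by linarith
  have 1: "exec x V (check_input (Suc n) r_rows) 0 (\<lambda>_. 0) (Suc (length x)) ((\<lambda>_. 0)(r_rows := m))"
    by (rule exec_eqI[OF check_input_accepts[OF _ x length_zs]]) (use mV in auto)
  have r: "ready ready_state" by (simp add: ready_def)
  have 2: "exec x V (enumerate_good n n) 0 ready_state 0 ?s"
    by (rule exec_eqI[OF exec_enumerate_good[OF r]]) (use V(2) in auto)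
  \<comment> \<open>Decrementing a positive \<open>r_good\<close> turns the comparison with 1 into a
    zero test.\<close>
  have 3: "exec x V (If (Non_Zero r_good) (Dec r_good) Skip) 0 ?s 0 ?s'"
  proof (rule exec_If, cases "?g = 0")
    case True
    have "exec x V Skip 0 ?s 0 ?s'"
      by (rule exec_eqI[OF exec_Skip]) (use True in simp)
    then show "exec x V (if holds (Non_Zero r_good) (input_read x (int 0)) ?s then Dec r_good else Skip) 0 ?s 0 ?s'"
      using True by simp
  next
    case False
    have "exec x V (Dec r_good) 0 ?s 0 ?s'"
      by (rule exec_eqI[OF exec_Dec]) (use False in auto)
    then show "exec x V (if holds (Non_Zero r_good) (input_read x (int 0)) ?s then Dec r_good else Skip) 0 ?s 0 ?s'"
      using False by simp
  qed
  have r': "ready ?s'" by (simp add: ready_def)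
  have "runs x V (guess_all n # [test_rows n True ;; If (Non_Zero r_viol) Reject Skip]) 0 ?s'
      (box_count (2 * K) (good True) n (\<lambda>t. ?s' (r_u t)))"
    by (rule runs_guess_all[OF r' order_refl _ runs_final]) simp_all
  then have tail: "runs x V [?tail] 0 ?s' ?N" by (intro runs.Seq) simp
  have 4: "runs x V [If (Non_Zero r_good) Reject Skip ;; ?tail] 0 ?s' (if ?g \<le> 1 then ?N else 0)"
  proof (rule runs.Seq, rule runs.If, cases "?g \<le> 1")
    case True
    have "runs x V (Skip # [?tail]) 0 ?s' ?N" using tail by (rule runs.Skip)
    then show "runs x V ((if holds (Non_Zero r_good) (input_read x (int 0)) ?s' then Reject else Skip) # [?tail]) 0 ?s'
        (if ?g \<le> 1 then ?N else 0)" using True by simp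
  next
    case False
    have "runs x V (Reject # [?tail]) 0 ?s' 0" by (rule runs.Reject)
    then show "runs x V ((if holds (Non_Zero r_good) (input_read x (int 0)) ?s' then Reject else Skip) # [?tail]) 0 ?s'
        (if ?g \<le> 1 then ?N else 0)" using False by simp
  qed
  have seq: "runs x V [c ;; d] p s N" if "exec x V c p s p' s'" "runs x V [d] p' s' N" for c d p s p' s' N
    using that by (intro runs.Seq) (simp add: exec_def)
  show ?thesis
    unfolding count_points_def
    by (rule seq[OF 1 seq[OF exec_setup_box seq[OF 2 seq[OF 3 4]]]])
qed

end

lemma runs_count_points_malformed:
  assumes "\<nexists>zs. Suc n dvd length zs \<and> x = encode_ints zs" "length x \<le> V"
  shows "runs x V [count_points n] 0 (\<lambda>_. 0) 0"
proof -
  have "rejects x V (check_input (Suc n) r_rows) 0 (\<lambda>_. 0)"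
    by (rule check_input_rejects) (use assms in simp_all)
  then show ?thesis
    unfolding count_points_def by (intro runs.Seq) (simp add: rejects_def)
qed

section \<open>Large points yield small recession vectors\<close>

text \<open>
  Scale \<open>p\<close> to maximum norm 1 and approximate it simultaneously by rationals \<open>y j / q\<close>.  The
  approximation is so good that \<open>a i \<bullet> y < 1\<close>, hence \<open>a i \<bullet> y \<le> 0\<close> by integrality.
\<close>

lemma small_recession_vector:
  fixes a :: "nat \<Rightarrow> nat \<Rightarrow> int" and b :: "nat \<Rightarrow> int" and p :: "nat \<Rightarrow> real" and n m L K :: nat
  assumes a: "\<And>i j. i < m \<Longrightarrow> j < n \<Longrightarrow> \<bar>a i j\<bar> \<le> int L" and b: "\<And>i. i < m \<Longrightarrow> \<bar>b i\<bar> \<le> int L"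
    and p: "\<And>i. i < m \<Longrightarrow> (\<Sum>j<n. real_of_int (a i j) * p j) \<le> real_of_int (b i)"
    and K: "K = (2 * Suc n * Suc L) ^ Suc n" and big: "j1 < n" "real K < \<bar>p j1\<bar>"
  obtains y :: "nat \<Rightarrow> int" and j where "\<And>i. i < m \<Longrightarrow> (\<Sum>j<n. a i j * y j) \<le> 0"
    and "j < n" "y j \<noteq> 0" and "\<And>j. j < n \<Longrightarrow> \<bar>y j\<bar> \<le> int K"
proof -
  \<comment> \<open>Two errors must sum to less than 1. Rounding costs at most
    \<open>n * L / Q\<close>, which this \<open>Q\<close> keeps below 1/2; the right-hand side costs
    at most \<open>q * L / R\<close>, which is at most 1/2 because \<open>q \<le> Q ^ n\<close> and
    \<open>2 * L * Q ^ n \<le> K < R\<close>. The last inequality dictates the size of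
    \<open>K\<close>.\<close>
  define Q where "Q = 2 * n * L + 1"
  define R where "R = Max ((\<lambda>j. \<bar>p j\<bar>) ` {..<n})"
  have "R \<in> (\<lambda>j. \<bar>p j\<bar>) ` {..<n}"
    unfolding R_def by (rule Max_in) (use big(1) in auto)
  then obtain j0 where j0: "j0 < n" "\<bar>p j0\<bar> = R" by auto
  have le_R: "\<bar>p j\<bar> \<le> R" if "j < n" for j
    unfolding R_def by (rule Max_ge) (use that in auto)
  have KR: "real K < R" using big le_R[of j1] by linarith
  have R0: "0 < R" using KR by (meson le_less_trans of_nat_0_le_iff)
  have "Q > 0" by (simp add: Q_def)
  then obtain q y where q: "0 < q" "q \<le> int (Q ^ n)"
    and y: "\<And>j. j < n \<Longrightarrow> \<bar>real_of_int q * (p j / R) - real_of_int (y j)\<bar> < 1 / real Q"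
    using Dirichlet_approx_simult[of Q n "\<lambda>j. p j / R"] by metis
  have Q1: "1 / real Q \<le> 1" using \<open>Q > 0\<close> by (simp add: divide_le_eq)
  have K_ge: "2 * L * Q ^ n \<le> K"
  proof -
    have "Q ^ n \<le> (2 * Suc n * Suc L) ^ n" unfolding Q_def by (rule power_mono) auto
    then have "(2 * L) * Q ^ n \<le> (2 * Suc n * Suc L) * (2 * Suc n * Suc L) ^ n"
      by (intro mult_le_mono) auto
    then show ?thesis by (simp add: K)
  qed
  \<comment> \<open>Needed besides \<open>K_ge\<close>, which says nothing about
    \<open>Q ^ n\<close> when \<open>L = 0\<close>.\<close>
  have QK: "Q ^ n \<le> K"
  proof -
    have "Q ^ n \<le> (2 * Suc n * Suc L) ^ n" unfolding Q_def by (rule power_mono) auto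
    also have "\<dots> \<le> K" unfolding K by (rule power_increasing) auto
    finally show ?thesis .
  qed
  \<comment> \<open>The approximated number is at most \<open>q\<close> in absolute value and the
    error is below 1; integrality removes the error.\<close>
  have y_le: "\<bar>y j\<bar> \<le> q" if "j < n" for j
  proof -
    have "\<bar>real_of_int q * (p j / R)\<bar> \<le> real_of_int q * 1"
      unfolding abs_mult using le_R[OF that] R0 q(1) by (intro mult_mono) auto
    moreover have "\<bar>v\<bar> < c + 1" if "\<bar>u\<bar> \<le> c * 1" "\<bar>u - v\<bar> < e" "e \<le> 1" for u v c e :: real
      using that by linarith
    ultimately have "\<bar>real_of_int (y j)\<bar> < real_of_int q + 1" using y[OF that] Q1 by blast
    then show ?thesis by linarith
  qed
  \<comment> \<open>At \<open>j0\<close> the scaled coordinate is 1 or -1, so its multiple by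
    \<open>q\<close> has distance at least 1 from 0.\<close>
  have "y j0 \<noteq> 0"
  proof
    assume "y j0 = 0"
    then have "\<bar>real_of_int q * (p j0 / R)\<bar> < 1" using y[OF j0(1)] Q1 by simp
    moreover have "\<bar>real_of_int q * (p j0 / R)\<bar> = real_of_int q"
      using j0(2) R0 q(1) by (simp add: abs_mult)
    ultimately show False using q(1) by simp
  qed
  moreover have "(\<Sum>j<n. a i j * y j) \<le> 0" if i: "i < m" for i
  proof -
    have diff: "real_of_int (a i j) * real_of_int (y j) \<le>
        real_of_int (a i j) * (real_of_int q * (p j / R)) + real L / real Q" if "j < n" for j
    proof -
      have "real_of_int (a i j) * (real_of_int (y j) - real_of_int q * (p j / R)) \<le>
          \<bar>real_of_int (a i j)\<bar> * \<bar>real_of_int (y j) - real_of_int q * (p j / R)\<bar>"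
        by (metis abs_ge_self abs_mult)
      also have "\<dots> \<le> real L * (1 / real Q)"
      proof (rule mult_mono)
        show "\<bar>real_of_int (a i j)\<bar> \<le> real L" using a[OF i that] by linarith
        show "\<bar>real_of_int (y j) - real_of_int q * (p j / R)\<bar> \<le> 1 / real Q"
          using y[OF that] by linarith
      qed auto
      finally show ?thesis by (simp add: algebra_simps)
    qed
    have "real_of_int (\<Sum>j<n. a i j * y j) = (\<Sum>j<n. real_of_int (a i j) * real_of_int (y j))" by simp
    also have "\<dots> \<le> (\<Sum>j<n. real_of_int (a i j) * (real_of_int q * (p j / R)) + real L / real Q)"
      by (rule sum_mono) (use diff in simp)
    also have "\<dots> = real_of_int q / R * (\<Sum>j<n. real_of_int (a i j) * p j) + real n * (real L / real Q)"
      by (simp add: sum.distrib sum_distrib_left mult.commute mult.left_commute)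
    also have "\<dots> \<le> real_of_int q / R * real L + real n * (real L / real Q)"
    proof -
      have "(\<Sum>j<n. real_of_int (a i j) * p j) \<le> real L" using p[OF i] b[OF i] by linarith
      then have "real_of_int q / R * (\<Sum>j<n. real_of_int (a i j) * p j) \<le> real_of_int q / R * real L"
        using q(1) R0 by (intro mult_left_mono) auto
      then show ?thesis by simp
    qed
    also have "\<dots> < 1"
    proof -
      have "real_of_int q * real L \<le> real (Q ^ n) * real L"
        using q(2) by (intro mult_right_mono) (metis of_int_le_iff of_int_of_nat_eq, simp)
      then have "2 * (real_of_int q * real L) \<le> 2 * (real (Q ^ n) * real L)" by simp
      also have "\<dots> = real (2 * L * Q ^ n)" by simp
      also have "\<dots> \<le> R" using K_ge KR by (meson less_eq_real_def of_nat_le_iff order_trans)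
      finally have "real_of_int q / R * real L \<le> 1 / 2"
        using R0 by (simp add: field_simps)
      moreover have "2 * (real n * real L) < real Q" by (simp add: Q_def)
      then have "real n * (real L / real Q) < 1 / 2"
        using \<open>Q > 0\<close> by (simp add: field_simps)
      ultimately show ?thesis by linarith
    qed
    finally show ?thesis by linarith
  qed
  moreover have "\<bar>y j\<bar> \<le> int K" if "j < n" for j
    using y_le[OF that] q(2) QK by (metis of_nat_le_iff order_trans)
  ultimately show ?thesis using that j0(1) by blast
qed

section \<open>Counting in the box\<close>

text \<open>Pinning the coordinates from \<open>j\<close> on to \<open>w\<close> makes the set
  finite and splits it disjointly by the value of the next coordinate.\<close>

lemma box_count_eq_card:
  "finite {w'. (\<forall>t<j. w' t \<le> W) \<and> (\<forall>t\<ge>j. w' t = w t) \<and> Q w'} \<and>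
   box_count W Q j w = card {w'. (\<forall>t<j. w' t \<le> W) \<and> (\<forall>t\<ge>j. w' t = w t) \<and> Q w'}"
proof (induction j arbitrary: w)
  case 0
  have "{w'. (\<forall>t<0. w' t \<le> W) \<and> (\<forall>t\<ge>0. w' t = w t) \<and> Q w'} = (if Q w then {w} else {})"
    by (auto simp: fun_eq_iff[symmetric])
  then show ?case by simp
next
  case (Suc j)
  let ?S = "\<lambda>v. {w'. (\<forall>t<j. w' t \<le> W) \<and> (\<forall>t\<ge>j. w' t = (w(j := v)) t) \<and> Q w'}"
  have eq: "{w'. (\<forall>t<Suc j. w' t \<le> W) \<and> (\<forall>t\<ge>Suc j. w' t = w t) \<and> Q w'} = (\<Union>v\<in>{..W}. ?S v)"
  proof (intro equalityI subsetI)
    fix w' assume "w' \<in> {w'. (\<forall>t<Suc j. w' t \<le> W) \<and> (\<forall>t\<ge>Suc j. w' t = w t) \<and> Q w'}"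
    then have "w' j \<le> W" "w' \<in> ?S (w' j)" by (auto simp: Suc_le_eq)
    then show "w' \<in> (\<Union>v\<in>{..W}. ?S v)" by blast
  next
    fix w' assume "w' \<in> (\<Union>v\<in>{..W}. ?S v)"
    then obtain v where v: "v \<le> W" "\<forall>t<j. w' t \<le> W" "\<forall>t\<ge>j. w' t = (w(j := v)) t" "Q w'" by blast
    have "w' j = v" using v(3) by simp
    moreover have "w' t = w t" if "Suc j \<le> t" for t
    proof -
      have "w' t = (w(j := v)) t" using v(3) that by simp
      then show ?thesis using that by simp
    qed
    ultimately show "w' \<in> {w'. (\<forall>t<Suc j. w' t \<le> W) \<and> (\<forall>t\<ge>Suc j. w' t = w t) \<and> Q w'}"
      using v by (auto simp: less_Suc_eq)
  qed
  have disj: "\<forall>v\<in>{..W}. \<forall>v'\<in>{..W}. v \<noteq> v' \<longrightarrow> ?S v \<inter> ?S v' = {}"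
  proof (intro ballI impI)
    fix v v' :: nat assume "v \<noteq> v'"
    then show "?S v \<inter> ?S v' = {}" by fastforce
  qed
  have "card (\<Union>v\<in>{..W}. ?S v) = (\<Sum>v\<le>W. card (?S v))"
    by (rule card_UN_disjoint) (use Suc.IH disj in blast)+
  moreover have "(\<Sum>v\<le>W. card (?S v)) = (\<Sum>v\<le>W. box_count W Q j (w(j := v)))"
    using Suc.IH by simp
  moreover have "finite (\<Union>v\<in>{..W}. ?S v)" using Suc.IH by blast
  ultimately show ?case unfolding eq by simp
qed

lemma part_diff:
  "int (part_lhs zs K w a j) - int (part_rhs zs K w a j) =
    (\<Sum>t<j. zs ! (a + t) * (int (w t) - int K))"
proof -
  have "int (nat z * u + nat (- z) * K) - int (nat z * K + nat (- z) * u) = z * (int u - int K)"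
    for z u by (cases "0 \<le> z") (simp_all add: algebra_simps)
  then show ?thesis
    unfolding part_lhs_def part_rhs_def of_nat_sum sum_subtractf[symmetric] by simp
qed

text \<open>A truncated difference vanishes iff the left side is at most the right side. The
  negative part of a bound was added on the left and its positive part on the right, which leaves
  the bound itself after cancellation.\<close>

lemma total_violation_eq_0_iff:
  "total_violation zs n m K wb w = 0 \<longleftrightarrow>
    (\<forall>i<m. (\<Sum>j<n. zs ! (i * n + j) * (int (w j) - int K)) \<le> (if wb then zs ! (m * n + i) else 0))"
proof -
  have "violation zs n m K wb w i = 0 \<longleftrightarrow>
      (\<Sum>j<n. zs ! (i * n + j) * (int (w j) - int K)) \<le> (if wb then zs ! (m * n + i) else 0)" for i
    unfolding part_diff[symmetric] violation_def by (cases wb) auto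
  then show ?thesis by (auto simp: total_violation_def)
qed

section \<open>Encodings of systems of inequalities\<close>

definition matrix_of :: "int list \<Rightarrow> nat \<Rightarrow> nat \<Rightarrow> int mat" where
  "matrix_of zs m n = mat m n (\<lambda>(i, j). zs ! (i * n + j))"

definition bounds_of :: "int list \<Rightarrow> nat \<Rightarrow> nat \<Rightarrow> int Matrix.vec" where
  "bounds_of zs m n = vec m (\<lambda>i. zs ! (m * n + i))"

lemma length_concat_rows: "length (concat (map (\<lambda>i. map (g i) [0..<n]) [0..<m])) = m * n"
  by (induction m) auto

lemma nth_concat_rows:
  "i < m \<Longrightarrow> j < n \<Longrightarrow> concat (map (\<lambda>i. map (g i) [0..<n]) [0..<m]) ! (i * n + j) = g i j"
proof (induction m)
  case (Suc m)
  show ?case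
  proof (cases "i < m")
    case True
    then have "Suc i * n \<le> m * n" by (intro mult_le_mono1) simp
    then have "i * n + j < m * n" using Suc.prems(2) by simp
    then show ?thesis using Suc.IH[OF True Suc.prems(2)] by (simp add: nth_append length_concat_rows)
  next
    case False
    then have "i = m" using Suc.prems(1) by simp
    then show ?thesis using Suc.prems(2) by (simp add: nth_append length_concat_rows)
  qed
qed simp

lemma nth_entries:
  assumes "A \<in> carrier_mat m n" "i < m" "j < n"
  shows "concat (mat_to_list A) ! (i * n + j) = A $$ (i, j)"
  using nth_concat_rows[OF assms(2,3), of "\<lambda>i j. A $$ (i, j)"] assms(1) by (simp add: mat_to_list_def)

lemma length_entries: "A \<in> carrier_mat m n \<Longrightarrow> length (concat (mat_to_list A)) = m * n"
  using length_concat_rows[of "\<lambda>i j. A $$ (i, j)" n m] by (simp add: mat_to_list_def)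

lemma encode_input_matrix_of:
  assumes "length zs = Suc n * m"
  shows "encode_input (matrix_of zs m n, bounds_of zs m n) = encode_ints zs"
proof -
  let ?A = "matrix_of zs m n" and ?b = "bounds_of zs m n"
  have A: "?A \<in> carrier_mat m n" by (simp add: matrix_of_def)
  have "concat (mat_to_list ?A) @ list_of_vec ?b = zs"
  proof (rule nth_equalityI)
    show "length (concat (mat_to_list ?A) @ list_of_vec ?b) = length zs"
      using assms by (simp add: length_entries[OF A] bounds_of_def mult.commute del: length_concat)
    fix k assume "k < length (concat (mat_to_list ?A) @ list_of_vec ?b)"
    then have k: "k < m * n + m"
      by (simp add: length_entries[OF A] bounds_of_def del: length_concat)
    show "(concat (mat_to_list ?A) @ list_of_vec ?b) ! k = zs ! k"
    proof (cases "k < m * n")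
      case True
      then have "k div n < m" by (simp add: less_mult_imp_div_less)
      \<comment> \<open>For \<open>n = 0\<close> there is no \<open>k < m * n\<close>.\<close>
      moreover have "k mod n < n" using True by (cases n) auto
      ultimately have "concat (mat_to_list ?A) ! k = zs ! k"
        using nth_entries[OF A, of "k div n" "k mod n"] by (simp add: matrix_of_def)
      then show ?thesis
        using True by (simp add: nth_append length_entries[OF A] del: length_concat)
    next
      case False
      then have "k - m * n < m" "m * n + (k - m * n) = k" using k by auto
      then show ?thesis
        using False by (simp add: nth_append length_entries[OF A] bounds_of_def del: length_concat)
    qed
  qed
  then show ?thesis by (simp only: encode_input_def prod.case)
qed

lemma encode_input_eq_encode_ints:
  assumes "A \<in> carrier_mat m n" "b \<in> carrier_vec m" "encode_input (A, b) = encode_ints zs"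
  shows "length zs = Suc n * m \<and> A = matrix_of zs m n \<and> b = bounds_of zs m n"
proof -
  have zs: "zs = concat (mat_to_list A) @ list_of_vec b"
    using assms(3) unfolding encode_input_def prod.case concat_encode_int_inject by simp
  have len: "length (list_of_vec b) = m" using assms(2) by simp
  have "length zs = Suc n * m"
    using len by (simp add: zs length_entries[OF assms(1)] mult.commute del: length_concat)
  moreover have "A = matrix_of zs m n"
  proof (rule eq_matI)
    fix i j assume "i < dim_row (matrix_of zs m n)" "j < dim_col (matrix_of zs m n)"
    then have ij: "i < m" "j < n" by (simp_all add: matrix_of_def)
    then have "Suc i * n \<le> m * n" by (intro mult_le_mono1) simp
    then have "i * n + j < m * n" using ij by simp
    then show "A $$ (i, j) = matrix_of zs m n $$ (i, j)"
      using ij nth_entries[OF assms(1) ij]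
      by (simp add: matrix_of_def zs nth_append length_entries[OF assms(1)] del: length_concat)
  qed (use assms(1) in \<open>auto simp: matrix_of_def\<close>)
  moreover have "b = bounds_of zs m n"
  proof (rule eq_vecI)
    fix i assume "i < dim_vec (bounds_of zs m n)"
    then have "i < m" by (simp add: bounds_of_def)
    then show "vec_index b i = vec_index (bounds_of zs m n) i"
      using assms(2)
      by (simp add: bounds_of_def zs nth_append length_entries[OF assms(1)] list_of_vec_index del: length_concat)
  qed (use assms(2) in \<open>auto simp: bounds_of_def\<close>)
  ultimately show ?thesis by blast
qed

lemma extend_by_zero_malformed:
  assumes "\<nexists>zs. Suc n dvd length zs \<and> s = encode_ints zs"
  shows "extend_by_zero (polytope_inputs n) encode_input f s = 0"
proof -
  have False if A: "A \<in> carrier_mat m n" and b: "b \<in> carrier_vec m" and s: "s = encode_input (A, b)" for A b m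
  proof -
    let ?zs = "concat (mat_to_list A) @ list_of_vec b"
    have e: "encode_input (A, b) = encode_ints ?zs" by (simp add: encode_input_def)
    then have "length ?zs = Suc n * m" using encode_input_eq_encode_ints[OF A b e] by blast
    then have "Suc n dvd length ?zs" by (metis dvd_triv_left)
    with e s assms show False by blast
  qed
  then have "s \<notin> encode_input ` polytope_inputs n" by (auto simp: polytope_inputs_def)
  then show ?thesis by (simp add: extend_by_zero_def)
qed

text \<open>With \<open>n\<close> fixed, the length of \<open>zs\<close> determines the number of
  rows, so only one pair can have this code; that pair belongs to the domain iff its polyhedron is
  bounded.\<close>

lemma extend_by_zero_wellformed:
  fixes zs :: "int list" and n m :: nat
  defines "A \<equiv> matrix_of zs m n" and "b \<equiv> bounds_of zs m n"
  assumes len: "length zs = Suc n * m"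
  shows "extend_by_zero (polytope_inputs n) encode_input f (encode_ints zs) =
    (if bounded_vecs (polyhedron A b) then f (A, b) else 0)"
proof -
  have enc: "encode_input (A, b) = encode_ints zs"
    unfolding A_def b_def by (rule encode_input_matrix_of[OF len])
  have mem: "(A, b) \<in> polytope_inputs n \<longleftrightarrow> bounded_vecs (polyhedron A b)"
    by (auto simp: polytope_inputs_def A_def b_def matrix_of_def bounds_of_def)
  have eq: "(A', b') = (A, b)" if in_D: "(A', b') \<in> polytope_inputs n"
    and e: "encode_input (A', b') = encode_ints zs" for A' b'
  proof -
    from in_D obtain m' where m': "A' \<in> carrier_mat m' n" "b' \<in> carrier_vec m'"
      by (auto simp: polytope_inputs_def)
    from encode_input_eq_encode_ints[OF m' e]
    have *: "length zs = Suc n * m'" "A' = matrix_of zs m' n" "b' = bounds_of zs m' n" by auto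
    then have "m' = m" using len by (metis mult_cancel1 nat.distinct(1))
    then show ?thesis using * by (simp add: A_def b_def)
  qed
  show ?thesis
  proof (cases "bounded_vecs (polyhedron A b)")
    case True
    then have "encode_ints zs \<in> encode_input ` polytope_inputs n"
      using enc mem by (metis image_eqI)
    moreover have "inv_into (polytope_inputs n) encode_input (encode_ints zs) = (A, b)"
      using inv_into_f_f[OF inj_on_encode_input] True mem enc by metis
    ultimately show ?thesis using True by (simp add: extend_by_zero_def)
  next
    case False
    then have "encode_ints zs \<notin> encode_input ` polytope_inputs n"
      using eq mem by (metis imageE surj_pair)
    then show ?thesis using False by (simp add: extend_by_zero_def)
  qed
qed

section \<open>Counting integer points\<close>

context encoded_box
begin

abbreviation "P \<equiv> polyhedron (matrix_of zs m n) (bounds_of zs m n)"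

text \<open>Values from \<open>n\<close> on are set to 0, so that each point of the box is
  represented by exactly one function.\<close>

definition grid :: "bool \<Rightarrow> (nat \<Rightarrow> nat) set" where
  "grid wb = {w. (\<forall>t<n. w t \<le> 2 * K) \<and> (\<forall>t\<ge>n. w t = 0) \<and> good wb w}"

lemma finite_grid: "finite (grid wb)"
  and box_count_eq: "box_count (2 * K) (good wb) n (\<lambda>_. 0) = card (grid wb)"
  using box_count_eq_card[of n "2 * K" "\<lambda>_. 0" "good wb"] by (auto simp: grid_def)

lemma mem_P_iff:
  "v \<in> P \<longleftrightarrow> v \<in> carrier_vec n \<and>
    (\<forall>i<m. (\<Sum>j<n. real_of_int (zs ! (i * n + j)) * vec_index v j) \<le> real_of_int (zs ! (m * n + i)))"
  by (auto simp: polyhedron_def matrix_of_def bounds_of_def less_eq_vec_def scalar_prod_def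
      atLeast0LessThan)

definition point :: "(nat \<Rightarrow> nat) \<Rightarrow> real Matrix.vec" where
  "point w = vec n (\<lambda>j. real_of_int (int (w j) - int K))"

lemma point_mem_P_iff: "point w \<in> P \<longleftrightarrow> good True w"
proof -
  have "(\<Sum>j<n. real_of_int (zs ! (i * n + j)) * vec_index (point w) j) =
      real_of_int (\<Sum>j<n. zs ! (i * n + j) * (int (w j) - int K))" for i
    by (simp add: point_def)
  then show ?thesis
    unfolding mem_P_iff total_violation_eq_0_iff
    by (simp only: of_int_le_iff) (simp add: point_def)
qed

lemma point_integer_points: "w \<in> grid True \<Longrightarrow> point w \<in> integer_points P"
  using point_mem_P_iff by (simp add: integer_points_def grid_def) (simp add: point_def)

text \<open>Translation by \<open>K\<close> always embeds the grid into the integer points; the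
  assumption that \<open>P\<close> lies in the box makes it surjective.\<close>

lemma card_integer_points:
  assumes "\<forall>v\<in>P. \<forall>j<n. \<bar>vec_index v j\<bar> \<le> real K"
  shows "card (integer_points P) = card (grid True)"
proof -
  have "bij_betw point (grid True) (integer_points P)"
    unfolding bij_betw_def
  proof
    show "inj_on point (grid True)"
    proof (rule inj_onI, rule ext)
      fix w w' t assume w: "w \<in> grid True" "w' \<in> grid True" and eq: "point w = point w'"
      show "w t = w' t"
      proof (cases "t < n")
        case True
        then show ?thesis using arg_cong[OF eq, of "\<lambda>v. vec_index v t"] by (simp add: point_def)
      next
        case False
        then show ?thesis using w by (simp add: grid_def)
      qed
    qed
    show "point ` grid True = integer_points P"
    proof (intro equalityI subsetI)
      fix v assume "v \<in> point ` grid True"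
      then show "v \<in> integer_points P" using point_integer_points by blast
    next
      fix v assume "v \<in> integer_points P"
      then have v: "v \<in> P" "v \<in> carrier_vec n" "\<forall>j<n. vec_index v j \<in> \<int>"
        by (auto simp: integer_points_def mem_P_iff)
      define w where "w t = (if t < n then nat (\<lfloor>vec_index v t\<rfloor> + int K) else 0)" for t
      have w: "vec_index v t = real_of_int (int (w t) - int K)" "w t \<le> 2 * K" if "t < n" for t
      proof -
        have "vec_index v t \<in> \<int>" using v(3) that by blast
        then obtain z where z: "vec_index v t = real_of_int z" by (rule Ints_cases)
        moreover have "\<bar>z\<bar> \<le> int K" using assms v(1) that z by fastforce
        ultimately show "vec_index v t = real_of_int (int (w t) - int K)" "w t \<le> 2 * K"
          using that by (simp_all add: w_def)
      qed
      have "point w = v"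
        by (rule eq_vecI) (use w v(2) in \<open>auto simp: point_def\<close>)
      moreover have "w \<in> grid True"
        using w(2) point_mem_P_iff[of w] v(1) \<open>point w = v\<close> by (auto simp: grid_def w_def)
      ultimately show "v \<in> point ` grid True" by blast
    qed
  qed
  then show ?thesis by (metis bij_betw_same_card)
qed

text \<open>The zero vector in shifted coordinates.\<close>

definition center :: "nat \<Rightarrow> nat" where
  "center t = (if t < n then K else 0)"

lemma center_in_grid: "center \<in> grid False"
  by (simp add: grid_def center_def total_violation_eq_0_iff)

text \<open>A point of \<open>P\<close> outside the box would produce, by
  \<open>small_recession_vector\<close>, a homogeneous solution in the grid besides
  \<open>center\<close>.\<close>

lemma bounded_if_card_grid_le_1:
  assumes "card (grid False) \<le> 1"
  shows "\<forall>v\<in>P. \<forall>j<n. \<bar>vec_index v j\<bar> \<le> real K"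
proof (rule ccontr)
  assume "\<not> ?thesis"
  then obtain v j1 where v: "v \<in> P" "j1 < n" "real K < \<bar>vec_index v j1\<bar>" by force
  have abs: "\<bar>zs ! k\<bar> \<le> int (length x)" if "k < length zs" for k
    using abs_nth_le_length[OF that] x by simp
  have idx: "i * n + j < length zs" if "i < m" "j < n" for i j
  proof -
    have "Suc i * n \<le> m * n" using that by (intro mult_le_mono1) simp
    then show ?thesis using that by (simp add: length_zs mult.commute)
  qed
  have a_le: "\<bar>zs ! (i * n + j)\<bar> \<le> int (length x)" if "i < m" "j < n" for i j
    using abs idx[OF that] by blast
  have b_le: "\<bar>zs ! (m * n + i)\<bar> \<le> int (length x)" if "i < m" for i
    using abs that by (simp add: length_zs mult.commute)
  have v_le: "(\<Sum>j<n. real_of_int (zs ! (i * n + j)) * vec_index v j) \<le> real_of_int (zs ! (m * n + i))"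
    if "i < m" for i
    using v(1) that by (simp add: mem_P_iff)
  obtain y j where y: "\<And>i. i < m \<Longrightarrow> (\<Sum>j<n. zs ! (i * n + j) * y j) \<le> 0"
    and j: "j < n" "y j \<noteq> 0" and y_le: "\<And>j. j < n \<Longrightarrow> \<bar>y j\<bar> \<le> int K"
    using small_recession_vector[where a = "\<lambda>i j. zs ! (i * n + j)" and b = "\<lambda>i. zs ! (m * n + i)"
          and p = "vec_index v", OF a_le b_le v_le K v(2,3)] by blast
  define w where "w t = (if t < n then nat (y t + int K) else 0)" for t
  have wy: "int (w t) - int K = y t" "w t \<le> 2 * K" if "t < n" for t
    using y_le[OF that] that by (auto simp: w_def)
  have "(\<Sum>j<n. zs ! (i * n + j) * (int (w j) - int K)) = (\<Sum>j<n. zs ! (i * n + j) * y j)" for i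
    by (rule sum.cong) (use wy in auto)
  then have "good False w" using y by (simp add: total_violation_eq_0_iff)
  then have "w \<in> grid False" using wy(2) by (auto simp: grid_def w_def)
  have "w \<noteq> center"
  proof
    assume "w = center"
    then have "w j = K" using j(1) by (simp add: center_def)
    then show False using wy(1)[OF j(1)] j(2) by simp
  qed
  then have "card {w, center} = 2" by simp
  moreover have "card {w, center} \<le> card (grid False)"
    by (rule card_mono[OF finite_grid]) (use \<open>w \<in> grid False\<close> center_in_grid in simp)
  ultimately show False using assms by linarith
qed

text \<open>Any other grid point is a nonzero direction along which a ray from \<open>v\<close>
  stays in \<open>P\<close> and leaves every bounded set. The point \<open>v\<close> is where the
  ray starts: an empty polyhedron can have such directions.\<close>

lemma grid_False_if_bounded:
  assumes "bounded_vecs P" "v \<in> P"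
  shows "grid False \<subseteq> {center}"
proof
  fix w assume w: "w \<in> grid False"
  obtain B where B: "\<And>v i. v \<in> P \<Longrightarrow> i < dim_vec v \<Longrightarrow> \<bar>vec_index v i\<bar> \<le> B"
    using assms(1) by (auto simp: bounded_vecs_def)
  let ?y = "\<lambda>j. int (w j) - int K"
  have v: "v \<in> carrier_vec n" using assms(2) by (simp add: mem_P_iff)
  have ray: "vec n (\<lambda>j. vec_index v j + real k * real_of_int (?y j)) \<in> P" for k
    unfolding mem_P_iff
  proof (intro conjI allI impI)
    fix i assume i: "i < m"
    have "(\<Sum>j<n. zs ! (i * n + j) * ?y j) \<le> 0"
      using w i by (simp add: grid_def total_violation_eq_0_iff)
    then have "real_of_int (\<Sum>j<n. zs ! (i * n + j) * ?y j) \<le> 0" by (simp only: of_int_le_0_iff)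
    then have "real k * real_of_int (\<Sum>j<n. zs ! (i * n + j) * ?y j) \<le> 0"
      by (simp only: mult_nonneg_nonpos of_nat_0_le_iff)
    moreover have "(\<Sum>j<n. real_of_int (zs ! (i * n + j)) * vec_index v j) \<le> real_of_int (zs ! (m * n + i))"
      using assms(2) i by (simp add: mem_P_iff)
    moreover have "(\<Sum>j<n. real_of_int (zs ! (i * n + j)) * (vec_index v j + real k * real_of_int (?y j))) =
        (\<Sum>j<n. real_of_int (zs ! (i * n + j)) * vec_index v j) +
        real k * real_of_int (\<Sum>j<n. zs ! (i * n + j) * ?y j)"
      unfolding of_int_sum sum_distrib_left sum.distrib[symmetric]
      by (rule sum.cong) (simp_all add: algebra_simps)
    ultimately show "(\<Sum>j<n. real_of_int (zs ! (i * n + j)) *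
        vec_index (vec n (\<lambda>j. vec_index v j + real k * real_of_int (?y j))) j) \<le> real_of_int (zs ! (m * n + i))"
      by simp
  qed simp
  have "?y j = 0" if j: "j < n" for j
  proof (rule ccontr)
    assume ne: "?y j \<noteq> 0"
    obtain k :: nat where k: "B + \<bar>vec_index v j\<bar> < real k" using reals_Archimedean2 by blast
    have "real k * 1 \<le> real k * \<bar>real_of_int (?y j)\<bar>" by (rule mult_left_mono) (use ne in linarith)+
    then have "real k \<le> \<bar>real k * real_of_int (?y j)\<bar>" by (simp add: abs_mult)
    moreover have "\<bar>vec_index v j + real k * real_of_int (?y j)\<bar> \<le> B"
      using B[OF ray[of k], of j] j by simp
    ultimately show False using k by linarith
  qed
  then have "w = center" using w by (auto simp: grid_def center_def fun_eq_iff)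
  then show "w \<in> {center}" by simp
qed

theorem count_eq:
  "(if box_count (2 * K) (good False) n (\<lambda>_. 0) \<le> 1
    then box_count (2 * K) (good True) n (\<lambda>_. 0) else 0) =
   (if bounded_vecs P then card (integer_points P) else 0)"
  unfolding box_count_eq
proof (cases "bounded_vecs P")
  case False
  have "\<not> card (grid False) \<le> 1"
  proof
    assume "card (grid False) \<le> 1"
    from bounded_if_card_grid_le_1[OF this] have "bounded_vecs P"
      unfolding bounded_vecs_def by (auto simp: mem_P_iff intro!: exI[of _ "real K"])
    with False show False by contradiction
  qed
  with False show "(if card (grid False) \<le> 1 then card (grid True) else 0) =
    (if bounded_vecs P then card (integer_points P) else 0)" by simp
next
  case True
  show "(if card (grid False) \<le> 1 then card (grid True) else 0) =
    (if bounded_vecs P then card (integer_points P) else 0)"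
  proof (cases "P = {}")
    \<comment> \<open>The size of \<open>grid False\<close> is unknown for an empty
      \<open>P\<close>, but both branches give 0.\<close>
    case P: True
    then have "integer_points P = {}" by (simp add: integer_points_def)
    moreover have "grid True = {}"
      using point_integer_points calculation by blast
    ultimately show ?thesis by simp
  next
    case P: False
    then obtain v where "v \<in> P" by blast
    from grid_False_if_bounded[OF True this] have "card (grid False) \<le> card {center}"
      by (intro card_mono) auto
    then have le: "card (grid False) \<le> 1" by simp
    then show ?thesis
      using True card_integer_points[OF bounded_if_card_grid_le_1[OF le]] by simp
  qed
qed

end

lemma runs_count_points_bounded:
  "runs x ((Suc n * 2 * 3 ^ Suc n * (2 * Suc n) ^ (Suc n * Suc n)) * (length x + 2) ^ (2 + Suc n * Suc n))
     [count_points n] 0 (\<lambda>_. 0)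
     (extend_by_zero (polytope_inputs n) encode_input
        (\<lambda>(A, b). card (integer_points (polyhedron A b))) x)"
  (is "runs x ?V _ _ _ _")
proof -
  let ?L = "length x"
  \<comment> \<open>With \<open>?L + 2\<close> in place of \<open>Suc ?L\<close>, the cap becomes a
    constant times a pure power of \<open>?L + 2\<close>, the form that
    \<open>sharp_L_if_runs\<close> expects. Later \<open>3 * M\<close> dominates
    \<open>2 * K + 1\<close>.\<close>
  define M where "M = (2 * Suc n * (?L + 2)) ^ Suc n"
  define K where "K = (2 * Suc n * Suc ?L) ^ Suc n"
  have KM: "K \<le> M" unfolding K_def M_def by (rule power_mono) auto
  have K0: "0 < K" by (simp add: K_def)
  \<comment> \<open>One factor \<open>?L + 2\<close> will pay for \<open>Suc m\<close>, the other
    for \<open>?L\<close>.\<close>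
  have V: "?V = Suc n * (?L + 2) ^ 2 * (2 * (3 * M) ^ Suc n)"
    unfolding M_def power_mult_distrib power_mult[symmetric] power_add by (simp only: mult_ac)
  have M_le: "3 * M \<le> (3 * M) ^ Suc n"
    using self_le_power[of "3 * M" "Suc n"] KM K0 by simp
  have KM': "2 * K \<le> 2 * (3 * M) ^ Suc n" using KM M_le by linarith
  have "0 < Suc n * (?L + 2) ^ 2" by simp
  then have one: "1 \<le> Suc n * (?L + 2) ^ 2" by linarith
  have M_V: "2 * (3 * M) ^ Suc n \<le> ?V"
    unfolding V using mult_le_mono1[OF one, of "2 * (3 * M) ^ Suc n"] by simp
  show ?thesis
  proof (cases "\<exists>zs. Suc n dvd length zs \<and> x = encode_ints zs")
    case False
    have "?L * 1 \<le> (?L + 2) ^ 2 * (2 * (3 * M) ^ Suc n)"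
    proof (rule mult_le_mono)
      show "?L \<le> (?L + 2) ^ 2" by (simp add: power2_eq_square)
      show "1 \<le> 2 * (3 * M) ^ Suc n" using KM K0 by simp
    qed
    also have "\<dots> \<le> ?V" unfolding V by simp
    finally have "?L \<le> ?V" by simp
    from runs_count_points_malformed[OF False this] show ?thesis
      by (simp add: extend_by_zero_malformed[OF False])
  next
    case True
    then obtain zs m where zs: "x = encode_ints zs" "length zs = Suc n * m" by (auto elim: dvdE)
    have m: "m \<le> ?L" using length_encode_ints_ge[of zs] zs by simp
    interpret encoded_box x zs n m K ?V
    proof
      show "x = encode_ints zs" "length zs = Suc n * m" "0 < K" by (fact zs K0)+
      show "K = (2 * Suc n * Suc ?L) ^ Suc n" by (fact K_def)
      have "Suc m * (Suc n * (?L * (2 * K))) \<le> (?L + 2) * (Suc n * ((?L + 2) * (2 * (3 * M) ^ Suc n)))"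
        by (intro mult_le_mono[OF _ mult_le_mono[OF order_refl mult_le_mono[OF _ KM']]])
          (use m in auto)
      also have "\<dots> = ?V" unfolding V power2_eq_square by (simp only: mult_ac)
      finally show "Suc m * (Suc n * (?L * (2 * K))) \<le> ?V" .
      have "Suc (2 * K) ^ n \<le> (3 * M) ^ n" using KM K0 by (intro power_mono) auto
      also have "\<dots> \<le> (3 * M) ^ Suc n" using KM K0 by (intro power_increasing) auto
      finally show "Suc (2 * K) ^ n \<le> ?V" using M_V by linarith
      show "2 * K \<le> ?V" using KM' M_V by linarith
    qed
    have "extend_by_zero (polytope_inputs n) encode_input
        (\<lambda>(A, b). card (integer_points (polyhedron A b))) x =
        (if bounded_vecs P then card (integer_points P) else 0)"
      by (simp only: zs(1) extend_by_zero_wellformed[OF zs(2)] prod.case)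
    with runs_count_points show ?thesis by (simp only: count_eq)
  qed
qed

theorem theorem4p1:
  fixes n :: nat
  shows "extend_by_zero (polytope_inputs n) encode_input
           (\<lambda>(A, b). card (integer_points (polyhedron A b))) \<in> sharp_L"
  by (rule sharp_L_if_runs[OF runs_count_points_bounded])

end
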